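(* Let $n\geq 5$ be an integer. Then $$ \begin{aligned} \mathrm{CW}_{\mathrm{depth},\dim}(n) &= \mathrm{CW}_{2,\dim}(n) \cup \left\{ (b,b)\in\mathbb{N}^2 \;\middle|\; \tfrac{n}{3} < b < \tfrac{n}{2} \right\} \\ &\cup \left\{ (a,b)\in\mathbb{N}^2 \;\middle|\; 3\leq a\leq \left\lfloor \tfrac{n-1}{2}\right\rfloor,\ \max\left\{a,\tfrac{n-a}{2}\right\} < b \leq n-a \right\}, \end{aligned} $$ where $\mathrm{CW}_{2,\dim}(n)=\{(2,n-2),(2,n-3)\}$ if $n$ is even, and $\mathrm{CW}_{2,\dim}(n)=\left\{(2,n-2),(2,n-3),\left(2,\tfrac{n-1}{2}\right)\right\}$ if $n$ is odd.
   Context: Let $K$ be a field. For a finite simple graph $G$ with vertex set $\{x_1,\ldots,x_n\}$, let $R=K[x_1,\ldots,x_n]$ and let $I(G)=(x_ix_j \mid \{x_i,x_j\}\in E(G))\subseteq R$ be its edge ideal. $\mathrm{depth}(R/I(G))$ is the length of a longest regular sequence and $\dim R/I(G)$ is the Krull dimension. A matching of $G$ is a set of pairwise disjoint edges; an induced matching is a matching $\mathcal{M}$ such that for distinct $e,e'\in\mathcal{M}$ no edge $f$ of $G$ meets both $e$ and $e'$. The matching number $\mathrm{m}(G)$ (resp. induced matching number $\mathrm{im}(G)$) is the maximum cardinality of a matching (resp. induced matching). A star graph is a graph obtained by joining some edges at one common vertex; a star triangle is a graph obtained by joining some triangles at one common vertex. A finite connected simple graph $G$ is a Cameron--Walker graph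 if $\mathrm{im}(G)=\mathrm{m}(G)$ and $G$ is neither a star graph nor a star triangle. $\mathrm{CW}(n)$ is the set of all Cameron--Walker graphs with $n$ vertices, and $\mathrm{CW}_{\mathrm{depth},\dim}(n)=\{(\mathrm{depth}(R/I(G)),\dim R/I(G)) \mid G\in\mathrm{CW}(n)\}$. *)

theory Defs
  imports
    "HOL-Algebra.QuotRing"
    "HOL-Library.Poly_Mapping"
    "HOL-Library.Extended_Nat"
    Complex_Main
begin

section \<open>Dimension and depth of a commutative ring\<close>

definition krull_dim :: "('a, 'b) ring_scheme \<Rightarrow> enat" where
  "krull_dim A = (SUP r \<in> {r. \<exists>P :: nat \<Rightarrow> 'a set.
      (\<forall>i\<le>r. primeideal (P i) A) \<and> (\<forall>i<r. P i \<subset> P (Suc i))}. enat r)"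

definition nonzerodivisor :: "('a, 'b) ring_scheme \<Rightarrow> 'a \<Rightarrow> bool" where
  "nonzerodivisor A a \<longleftrightarrow>
     a \<in> carrier A \<and> (\<forall>x\<in>carrier A. a \<otimes>\<^bsub>A\<^esub> x = \<zero>\<^bsub>A\<^esub> \<longrightarrow> x = \<zero>\<^bsub>A\<^esub>)"

text \<open>In a regular sequence \<open>a\<^sub>1, \<dots>, a\<^sub>r\<close> the class of \<open>a\<^sub>i\<close> is a nonzerodivisor of
  \<open>A/(a\<^sub>1, \<dots>, a\<^bsub>i-1\<^esub>)\<close>, and \<open>A/(a\<^sub>1, \<dots>, a\<^sub>r)\<close> is not the zero ring. The list below is
  indexed from 0.\<close>

definition regular_sequence :: "('a, 'b) ring_scheme \<Rightarrow> 'a list \<Rightarrow> bool" where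
  "regular_sequence A as \<longleftrightarrow>
     set as \<subseteq> carrier A \<and>
     (\<forall>i<length as. let J = genideal A (set (take i as)) in
        nonzerodivisor (A Quot J) (J +>\<^bsub>A\<^esub> (as ! i))) \<and>
     genideal A (set as) \<noteq> carrier A"

text \<open>Depth is taken with respect to an ideal \<open>M\<close>; for a standard graded algebra \<open>M\<close> is the
  graded maximal ideal.\<close>

definition depth :: "('a, 'b) ring_scheme \<Rightarrow> 'a set \<Rightarrow> enat" where
  "depth A M = (SUP as \<in> {as. regular_sequence A as \<and> set as \<subseteq> M}. enat (length as))"

section \<open>Polynomial rings and edge ideals\<close>

text \<open>An exponent vector is a finitely supported map from variables to \<^typ>\<open>nat\<close>, and a polynomial
  is a finitely supported map from exponent vectors to coefficients; multiplication on
  \<^type>\<open>poly_mapping\<close> is convolution. The type has one variable for each element of \<^typ>\<open>'v\<close>, so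
  the carrier restricts to polynomials in the variables from \<open>V\<close>.\<close>

type_synonym ('v, 'k) mpolynomial = "('v \<Rightarrow>\<^sub>0 nat) \<Rightarrow>\<^sub>0 'k"

definition mpoly_ring :: "'v set \<Rightarrow> ('v, 'k::field) mpolynomial ring" where
  "mpoly_ring V = \<lparr>carrier = {p. \<forall>m \<in> Poly_Mapping.keys p. Poly_Mapping.keys m \<subseteq> V},
     monoid.mult = (*), one = 1, zero = 0, add = (+)\<rparr>"

definition var :: "'v \<Rightarrow> ('v, 'k::field) mpolynomial" where
  "var v = Poly_Mapping.single (Poly_Mapping.single v 1) 1"

lemma cring_mpoly_ring: "cring (mpoly_ring V :: ('v, 'k::field) mpolynomial ring)"
proof (rule cringI)
  show "abelian_group (mpoly_ring V :: ('v, 'k) mpolynomial ring)"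
  proof (rule abelian_groupI)
    fix x y :: "('v, 'k) mpolynomial"
    assume "x \<in> carrier (mpoly_ring V)" "y \<in> carrier (mpoly_ring V)"
    then show "x \<oplus>\<^bsub>mpoly_ring V\<^esub> y \<in> carrier (mpoly_ring V)"
      using Poly_Mapping.keys_add[of x y] by (auto simp: mpoly_ring_def)
  next
    fix x :: "('v, 'k) mpolynomial"
    assume "x \<in> carrier (mpoly_ring V)"
    then show "\<exists>y\<in>carrier (mpoly_ring V). y \<oplus>\<^bsub>mpoly_ring V\<^esub> x = \<zero>\<^bsub>mpoly_ring V\<^esub>"
      by (intro bexI[of _ "- x"]) (auto simp: mpoly_ring_def in_keys_iff)
  qed (auto simp: mpoly_ring_def algebra_simps)
  show "Group.comm_monoid (mpoly_ring V :: ('v, 'k) mpolynomial ring)"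
  proof (rule comm_monoidI)
    fix x y :: "('v, 'k) mpolynomial"
    assume *: "x \<in> carrier (mpoly_ring V)" "y \<in> carrier (mpoly_ring V)"
    have "Poly_Mapping.keys m \<subseteq> V" if m: "m \<in> Poly_Mapping.keys (x * y)" for m
    proof -
      obtain a b where ab: "m = a + b" "a \<in> Poly_Mapping.keys x" "b \<in> Poly_Mapping.keys y"
        using m Poly_Mapping.keys_mult[of x y] by blast
      then show ?thesis
        using * Poly_Mapping.keys_add[of a b] by (fastforce simp: mpoly_ring_def)
    qed
    then show "x \<otimes>\<^bsub>mpoly_ring V\<^esub> y \<in> carrier (mpoly_ring V)"
      by (simp add: mpoly_ring_def)
  qed (auto simp: mpoly_ring_def algebra_simps)
qed (auto simp: mpoly_ring_def algebra_simps)

definition edge_ideal :: "'v set \<Rightarrow> 'v set set \<Rightarrow> ('v, 'k::field) mpolynomial set" where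
  "edge_ideal V E = genideal (mpoly_ring V) {var i * var j | i j. {i, j} \<in> E}"

definition edge_ring :: "'v set \<Rightarrow> 'v set set \<Rightarrow> ('v, 'k::field) mpolynomial set ring" where
  "edge_ring V E = mpoly_ring V Quot edge_ideal V E"

text \<open>The image in the edge ring of the ideal generated by all variables.\<close>

definition edge_ring_max_ideal ::
  "'v set \<Rightarrow> 'v set set \<Rightarrow> ('v, 'k::field) mpolynomial set set" where
  "edge_ring_max_ideal V E =
     (\<lambda>p. edge_ideal V E +>\<^bsub>mpoly_ring V\<^esub> p) ` genideal (mpoly_ring V) (var ` V)"

section \<open>Cameron--Walker graphs\<close>

definition simple_graph :: "'v set \<Rightarrow> 'v set set \<Rightarrow> bool" where
  "simple_graph V E \<longleftrightarrow> finite V \<and> (\<forall>e\<in>E. e \<subseteq> V \<and> card e = 2)"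

definition connected_graph :: "'v set \<Rightarrow> 'v set set \<Rightarrow> bool" where
  "connected_graph V E \<longleftrightarrow> V \<noteq> {} \<and> (\<forall>u\<in>V. \<forall>v\<in>V. (u, v) \<in> {(x, y). {x, y} \<in> E}\<^sup>*)"

definition matching :: "'v set set \<Rightarrow> 'v set set \<Rightarrow> bool" where
  "matching E M \<longleftrightarrow> M \<subseteq> E \<and> (\<forall>e\<in>M. \<forall>e'\<in>M. e \<noteq> e' \<longrightarrow> e \<inter> e' = {})"

definition induced_matching :: "'v set set \<Rightarrow> 'v set set \<Rightarrow> bool" where
  "induced_matching E M \<longleftrightarrow> matching E M \<and>
     (\<forall>e\<in>M. \<forall>e'\<in>M. e \<noteq> e' \<longrightarrow> \<not> (\<exists>f\<in>E. f \<inter> e \<noteq> {} \<and> f \<inter> e' \<noteq> {}))"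

definition matching_number :: "'v set set \<Rightarrow> nat" where
  "matching_number E = Max (card ` {M. matching E M})"

definition induced_matching_number :: "'v set set \<Rightarrow> nat" where
  "induced_matching_number E = Max (card ` {M. induced_matching E M})"

definition star_graph :: "'v set \<Rightarrow> 'v set set \<Rightarrow> bool" where
  "star_graph V E \<longleftrightarrow> simple_graph V E \<and> E \<noteq> {} \<and> V = \<Union>E \<and> (\<exists>c. \<forall>e\<in>E. c \<in> e)"

text \<open>\<open>T\<close> is the set of vertex sets of the triangles joined at \<open>c\<close>.\<close>

definition star_triangle :: "'v set \<Rightarrow> 'v set set \<Rightarrow> bool" where
  "star_triangle V E \<longleftrightarrow> simple_graph V E \<and>
     (\<exists>c T. T \<noteq> {} \<and> V = \<Union>T \<and> (\<forall>t\<in>T. card t = 3 \<and> c \<in> t) \<and>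
       (\<forall>t\<in>T. \<forall>t'\<in>T. t \<noteq> t' \<longrightarrow> t \<inter> t' = {c}) \<and>
       E = {e. card e = 2 \<and> (\<exists>t\<in>T. e \<subseteq> t)})"

definition cameron_walker :: "'v set \<Rightarrow> 'v set set \<Rightarrow> bool" where
  "cameron_walker V E \<longleftrightarrow> simple_graph V E \<and> connected_graph V E \<and>
     induced_matching_number E = matching_number E \<and>
     \<not> star_graph V E \<and> \<not> star_triangle V E"

text \<open>Graphs on \<open>n\<close> vertices have vertex set \<open>{1..n}\<close> and are represented by their edge sets.\<close>

definition CW :: "nat \<Rightarrow> nat set set set" where
  "CW n = {E. cameron_walker {1..n} E}"

definition CW_depth_dim :: "'k::field itself \<Rightarrow> nat \<Rightarrow> (enat \<times> enat) set" where
  "CW_depth_dim _ n =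
     (\<lambda>E. let A = (edge_ring {1..n} E :: (nat, 'k) mpolynomial set ring)
           in (depth A (edge_ring_max_ideal {1..n} E), krull_dim A)) ` CW n"

definition CW_2_dim :: "nat \<Rightarrow> (nat \<times> nat) set" where
  "CW_2_dim n =
     (if even n then {(2, n - 2), (2, n - 3)}
      else {(2, n - 2), (2, n - 3), (2, (n - 1) div 2)})"

end

theory Submission
  imports Defs
begin

text \<open>Both invariants of a Cameron--Walker graph are combinatorial: the Krull dimension of the edge ring
  is the largest and the depth is the smallest size of a maximal independent set. The theorem follows
  by computing these two sizes from an explicit description of the graphs.

  \<^bold>\<open>Upper bounds.\<close> Let \<open>J\<^sub>0 \<subseteq> \<dots> \<subseteq> J\<^sub>r\<close> be ideals and let \<open>f\<^sub>i \<in> J\<^sub>i\<close> be a nonzerodivisor modulo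
  \<open>J\<^bsub>i-1\<^esub>\<close>. Dividing by powers of \<open>f\<^sub>1\<close>, then of \<open>f\<^sub>2\<close> and so on shows that the products of a fixed
  \<open>u \<notin> J\<^sub>r\<close> with the monomials in the \<open>f\<^sub>i\<close> are linearly independent modulo \<open>J\<^sub>0\<close>
  (\<open>regular_chain_lexicographic\<close>). There are \<open>(d+1)\<^sup>r\<close> such monomials with exponents at most \<open>d\<close>, and if
  only \<open>O(d\<^sup>s)\<close> ordinary monomials are available to express the products, then \<open>r \<le> s\<close>
  (\<open>length_regular_chain_le\<close>). A chain of primes with \<open>f\<^sub>i \<in> P\<^sub>i - P\<^bsub>i-1\<^esub>\<close> and \<open>u = 1\<close> bounds the dimension by
  the independence number. A regular sequence with \<open>u = x\<^sup>S\<close>, where \<open>S\<close> is a maximal independent set,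
  bounds the depth by the size of \<open>S\<close>: the multiples of \<open>x\<^sup>S\<close> form a copy of \<open>K[S]\<close>. Here \<open>u \<notin> J\<^sub>r\<close> holds
  once the members of the sequence are replaced by high powers (\<open>weakly_regular_powers\<close>).

  \<^bold>\<open>Lower bounds.\<close> Primes generated by variables give chains of the required length. For the depth, the
  elementary symmetric polynomials \<open>e\<^sub>1, \<dots>, e\<^sub>r\<close> in all variables form a regular sequence. They do so on every polynomial
  ring \<open>K[F]\<close> with \<open>r \<le> |F|\<close>, and the exact sequences
  \<open>0 \<rightarrow> R/(I : x) \<rightarrow> R/I \<rightarrow> R/(I + x) \<rightarrow> 0\<close> carry this to the edge ring along a
  vertex decomposition of the independence complex whose final facets are the maximal independent sets
  (\<open>weakly_regular_of_colon_adjoin\<close>, \<open>esym_weakly_regular\<close>).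

  \<^bold>\<open>Graphs.\<close> Take an induced matching that is also a maximum matching and let \<open>U\<close> be the set of
  unmatched vertices. As there is no augmenting path, every matching edge is either a pendant edge at a vertex
  \<open>v\<close> or completes a triangle with one vertex of \<open>U\<close>, and the remaining edges join vertices \<open>v\<close> to \<open>U\<close>
  (\<open>cameron_walker_structure\<close>). With \<open>m\<close> pendant edges, \<open>T\<close> triangles, \<open>p = |U|\<close> and \<open>y\<close> elements of
  \<open>U\<close> that lie in triangles,
  the graph has \<open>2m + 2T + p\<close> vertices and the dimension is \<open>m + T + (p - y)\<close>. The smallest maximal
  independent sets that contain exactly the set \<open>A\<close> of vertices \<open>v\<close> have size \<open>m\<close> plus the number of triangles
  at neighbours of \<open>A\<close> plus the number of elements of \<open>U\<close> that are not neighbours of \<open>A\<close>. The estimates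
  \<open>m + y \<le> depth \<le> m + min p T\<close>, of which the second is an equality for \<open>m = 1\<close>, confine the pair to the
  stated set. Conversely, two
  families of such graphs reach every pair: either all \<open>v\<close> are joined to all of \<open>U\<close>, or one \<open>v\<close> misses
  the only element of \<open>U\<close> that lies in triangles.\<close>

section \<open>Ideals and weakly regular sequences\<close>

text \<open>The carrier of a polynomial ring in the variables from \<open>V\<close> is a subring of a ring that is a
  type-class instance. Ideals of such a subring \<open>C\<close> are handled as sets, which leaves all ring arithmetic to
  the type class.\<close>

locale unital_subring =
  fixes C :: "'a::comm_ring_1 set"
  assumes one_closed: "1 \<in> C"
    and diff_closed: "x \<in> C \<Longrightarrow> y \<in> C \<Longrightarrow> x - y \<in> C"
    and mult_closed: "x \<in> C \<Longrightarrow> y \<in> C \<Longrightarrow> x * y \<in> C"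
begin

lemma zero_closed: "0 \<in> C"
  using diff_closed[OF one_closed one_closed] by simp

lemma uminus_closed: "x \<in> C \<Longrightarrow> - x \<in> C"
  using diff_closed[OF zero_closed] by fastforce

lemma add_closed: "x \<in> C \<Longrightarrow> y \<in> C \<Longrightarrow> x + y \<in> C"
  using diff_closed[OF _ uminus_closed] by fastforce

lemma power_closed: "x \<in> C \<Longrightarrow> x ^ k \<in> C"
  by (induction k) (auto intro: one_closed mult_closed)

lemma sum_closed: "(\<And>i. i \<in> X \<Longrightarrow> g i \<in> C) \<Longrightarrow> sum g X \<in> C"
  by (induction X rule: infinite_finite_induct) (auto intro: zero_closed add_closed)

lemma prod_closed: "(\<And>i. i \<in> X \<Longrightarrow> g i \<in> C) \<Longrightarrow> prod g X \<in> C"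
  by (induction X rule: infinite_finite_induct) (auto intro: one_closed mult_closed)

lemmas closed = one_closed zero_closed diff_closed uminus_closed add_closed mult_closed power_closed

definition is_ideal :: "'a set \<Rightarrow> bool" where
  "is_ideal J \<longleftrightarrow> J \<subseteq> C \<and> 0 \<in> J \<and> (\<forall>x\<in>J. \<forall>y\<in>J. x + y \<in> J) \<and> (\<forall>c\<in>C. \<forall>x\<in>J. c * x \<in> J)"

lemma is_idealI:
  assumes "J \<subseteq> C" "0 \<in> J" "\<And>x y. x \<in> J \<Longrightarrow> y \<in> J \<Longrightarrow> x + y \<in> J"
    "\<And>c x. c \<in> C \<Longrightarrow> x \<in> J \<Longrightarrow> c * x \<in> J"
  shows "is_ideal J"
  using assms by (auto simp: is_ideal_def)

lemma is_idealD:
  assumes "is_ideal J"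
  shows ideal_closed: "x \<in> J \<Longrightarrow> x \<in> C"
    and ideal_zero: "0 \<in> J"
    and ideal_add: "x \<in> J \<Longrightarrow> y \<in> J \<Longrightarrow> x + y \<in> J"
    and ideal_mult: "c \<in> C \<Longrightarrow> x \<in> J \<Longrightarrow> c * x \<in> J"
    and ideal_diff: "x \<in> J \<Longrightarrow> y \<in> J \<Longrightarrow> x - y \<in> J"
proof -
  show "x \<in> J \<Longrightarrow> x \<in> C" "0 \<in> J" "x \<in> J \<Longrightarrow> y \<in> J \<Longrightarrow> x + y \<in> J" "c \<in> C \<Longrightarrow> x \<in> J \<Longrightarrow> c * x \<in> J"
    for x y c using assms by (auto simp: is_ideal_def)
  moreover have "- 1 \<in> C" by (intro closed)
  ultimately show "x - y \<in> J" if "x \<in> J" "y \<in> J"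
    using that by (metis diff_conv_add_uminus mult_minus1)
qed

lemma ideal_sum: "is_ideal J \<Longrightarrow> (\<And>i. i \<in> X \<Longrightarrow> g i \<in> J) \<Longrightarrow> sum g X \<in> J"
  by (induction X rule: infinite_finite_induct) (auto intro: ideal_zero ideal_add)

definition adjoin :: "'a set \<Rightarrow> 'a \<Rightarrow> 'a set" where
  "adjoin J f = {j + c * f | j c. j \<in> J \<and> c \<in> C}"

definition nzd :: "'a set \<Rightarrow> 'a \<Rightarrow> bool" where
  "nzd J f \<longleftrightarrow> (\<forall>g\<in>C. f * g \<in> J \<longrightarrow> g \<in> J)"

definition colon :: "'a set \<Rightarrow> 'a \<Rightarrow> 'a set" where
  "colon J x = {g \<in> C. x * g \<in> J}"

lemma adjoinI: "j \<in> J \<Longrightarrow> c \<in> C \<Longrightarrow> j + c * f \<in> adjoin J f"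
  by (auto simp: adjoin_def)

lemma adjoinE:
  assumes "g \<in> adjoin J f"
  obtains j c where "g = j + c * f" "j \<in> J" "c \<in> C"
  using assms by (auto simp: adjoin_def)

lemma nzdD: "nzd J f \<Longrightarrow> g \<in> C \<Longrightarrow> f * g \<in> J \<Longrightarrow> g \<in> J"
  by (auto simp: nzd_def)

lemma is_ideal_adjoin:
  assumes J: "is_ideal J" and f: "f \<in> C"
  shows "is_ideal (adjoin J f)"
proof (rule is_idealI)
  show "adjoin J f \<subseteq> C"
    using ideal_closed[OF J] f by (auto elim!: adjoinE intro!: closed)
  show "0 \<in> adjoin J f"
    using adjoinI[OF ideal_zero[OF J] zero_closed, of f] by simp
next
  fix x y assume "x \<in> adjoin J f" "y \<in> adjoin J f"
  then obtain j c j' c' where "x = j + c * f" "j \<in> J" "c \<in> C" "y = j' + c' * f" "j' \<in> J" "c' \<in> C"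
    by (metis adjoinE)
  moreover from this have "x + y = (j + j') + (c + c') * f" by (simp add: algebra_simps)
  ultimately show "x + y \<in> adjoin J f"
    by (metis adjoinI add_closed ideal_add[OF J])
next
  fix x y assume "x \<in> C" "y \<in> adjoin J f"
  then obtain j c where "y = j + c * f" "j \<in> J" "c \<in> C" "x \<in> C" by (metis adjoinE)
  moreover from this have "x * y = x * j + (x * c) * f" by (simp add: algebra_simps)
  ultimately show "x * y \<in> adjoin J f"
    by (metis adjoinI mult_closed ideal_mult[OF J])
qed

lemma subset_adjoin: "J \<subseteq> adjoin J f"
  using adjoinI[OF _ zero_closed] by fastforce

lemma adjoin_self: "is_ideal J \<Longrightarrow> f \<in> adjoin J f"
  using adjoinI[OF ideal_zero one_closed] by fastforce

lemma adjoin_least: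
  assumes "is_ideal K" "J \<subseteq> K" "f \<in> K"
  shows "adjoin J f \<subseteq> K"
  using assms by (auto elim!: adjoinE intro!: ideal_add[OF assms(1)] ideal_mult[OF assms(1)])

lemma adjoin_commute: "adjoin (adjoin J f) g = adjoin (adjoin J g) f"
proof -
  have "adjoin (adjoin J f) g \<subseteq> adjoin (adjoin J g) f" for f g
  proof
    fix x assume "x \<in> adjoin (adjoin J f) g"
    then obtain j c d where "x = (j + c * f) + d * g" "j \<in> J" "c \<in> C" "d \<in> C"
      by (metis adjoinE)
    moreover from this have "x = (j + d * g) + c * f" by (simp add: algebra_simps)
    ultimately show "x \<in> adjoin (adjoin J g) f" by (metis adjoinI)
  qed
  then show ?thesis by blast
qed

lemma adjoin_cong:
  assumes J: "is_ideal J" and "f \<in> C" "f' \<in> C" and d: "f - f' \<in> J"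
  shows "adjoin J f = adjoin J f'"
proof -
  have *: "f' \<in> adjoin J f" if "f - f' \<in> J" "f \<in> C" "f' \<in> C" for f f'
  proof -
    have "f' = (0 - (f - f')) + 1 * f" by simp
    then show ?thesis
      by (metis adjoinI one_closed ideal_diff[OF J] ideal_zero[OF J] that(1))
  qed
  have d': "f' - f \<in> J" using ideal_diff[OF J ideal_zero[OF J] d] by simp
  show ?thesis
    using *[OF d assms(2,3)] *[OF d' assms(3,2)] assms
    by (intro equalityI adjoin_least is_ideal_adjoin subset_adjoin) auto
qed

lemma nzd_cong:
  assumes J: "is_ideal J" and d: "f - f' \<in> J" and f: "nzd J f"
  shows "nzd J f'"
  unfolding nzd_def
proof (intro ballI impI)
  fix g assume g: "g \<in> C" "f' * g \<in> J"
  have "f * g = f' * g + g * (f - f')" by (simp add: algebra_simps)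
  then show "g \<in> J" using nzdD[OF f g(1)] ideal_add[OF J g(2) ideal_mult[OF J g(1) d]] by simp
qed

lemma nzd_mult: "nzd J f \<Longrightarrow> nzd J g \<Longrightarrow> g \<in> C \<Longrightarrow> nzd J (f * g)"
  unfolding nzd_def by (metis mult_closed mult.assoc)

lemma nzd_one: "nzd J 1" by (simp add: nzd_def)

lemma nzd_prod: "(\<And>i. i \<in> X \<Longrightarrow> nzd J (g i)) \<Longrightarrow> (\<And>i. i \<in> X \<Longrightarrow> g i \<in> C) \<Longrightarrow> nzd J (prod g X)"
proof (induction X rule: infinite_finite_induct)
  case (insert x F)
  then have "nzd J (g x * prod g F)" by (intro nzd_mult prod_closed) auto
  then show ?case using insert by simp
qed (simp_all add: nzd_one)

lemma nzd_power: "nzd J f \<Longrightarrow> f \<in> C \<Longrightarrow> nzd J (f ^ k)"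
  by (induction k) (auto intro: nzd_one nzd_mult closed)

fun adjoins :: "'a set \<Rightarrow> 'a list \<Rightarrow> 'a set" where
  "adjoins J [] = J"
| "adjoins J (f # fs) = adjoins (adjoin J f) fs"

text \<open>Regular sequences modulo \<open>J\<close> whose last quotient may vanish, as can happen for the outer terms of an
  exact sequence.\<close>

fun weakly_regular :: "'a set \<Rightarrow> 'a list \<Rightarrow> bool" where
  "weakly_regular J [] \<longleftrightarrow> True"
| "weakly_regular J (f # fs) \<longleftrightarrow> nzd J f \<and> weakly_regular (adjoin J f) fs"

lemma weakly_regular_append:
  "weakly_regular J (fs @ gs) \<longleftrightarrow> weakly_regular J fs \<and> weakly_regular (adjoins J fs) gs"
  by (induction fs arbitrary: J) auto

lemma is_ideal_adjoins: "is_ideal J \<Longrightarrow> set fs \<subseteq> C \<Longrightarrow> is_ideal (adjoins J fs)"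
  by (induction fs arbitrary: J) (auto intro: is_ideal_adjoin)

lemma subset_adjoins: "J \<subseteq> adjoins J fs"
  by (induction fs arbitrary: J) (use subset_adjoin in fastforce)+

lemma set_subset_adjoins: "is_ideal J \<Longrightarrow> set fs \<subseteq> C \<Longrightarrow> set fs \<subseteq> adjoins J fs"
proof (induction fs arbitrary: J)
  case (Cons f fs)
  then show ?case
    using subset_adjoins[of "adjoin J f" fs] adjoin_self[of J f] is_ideal_adjoin[of J f] by auto
qed simp

lemma adjoins_least:
  assumes "is_ideal K" "J \<subseteq> K" "set fs \<subseteq> K"
  shows "adjoins J fs \<subseteq> K"
  using assms by (induction fs arbitrary: J) (auto dest: adjoin_least)

lemma weakly_regular_cong:
  assumes "is_ideal J" "list_all2 (\<lambda>f f'. f \<in> C \<and> f' \<in> C \<and> f - f' \<in> J) fs fs'" "weakly_regular J fs"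
  shows "weakly_regular J fs'"
  using assms
proof (induction fs arbitrary: J fs')
  case (Cons f fs)
  then obtain f' fs'' where fs': "fs' = f' # fs''" by (auto simp: list_all2_Cons1)
  then have f: "f \<in> C" "f' \<in> C" "f - f' \<in> J" and
    tl: "list_all2 (\<lambda>f f'. f \<in> C \<and> f' \<in> C \<and> f - f' \<in> J) fs fs''"
    using Cons.prems(2) by auto
  have "list_all2 (\<lambda>f f'. f \<in> C \<and> f' \<in> C \<and> f - f' \<in> adjoin J g) fs fs''" for g
    using tl by (rule list_all2_mono) (use subset_adjoin in blast)
  note tl' = this[of f]
  have "weakly_regular (adjoin J f) fs''"
    by (rule Cons.IH[OF is_ideal_adjoin[OF Cons.prems(1) f(1)] tl']) (use Cons.prems(3) in simp)
  then show ?case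
    using adjoin_cong[OF Cons.prems(1) f] nzd_cong[OF Cons.prems(1) f(3)] Cons.prems(3) by (simp add: fs')
qed simp

text \<open>The modules \<open>C/(J : x)\<close> and \<open>C/(J + x)\<close> are the outer terms of
  \<open>0 \<rightarrow> C/(J : x) \<rightarrow> C/J \<rightarrow> C/(J + x) \<rightarrow> 0\<close>, whose first map is multiplication by \<open>x\<close>. An element that is
  regular on both outer terms is regular on the middle one, and the sequence stays exact modulo this element.\<close>

lemma nzd_of_colon_adjoin:
  assumes J: "is_ideal J" and x: "x \<in> C" and f: "f \<in> C"
    and c: "nzd (colon J x) f" and a: "nzd (adjoin J x) f"
  shows "nzd J f"
  unfolding nzd_def
proof (intro ballI impI)
  fix g assume g: "g \<in> C" "f * g \<in> J"
  then have "g \<in> adjoin J x" using nzdD[OF a] subset_adjoin by blast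
  then obtain j h where gj: "g = j + h * x" "j \<in> J" "h \<in> C" by (rule adjoinE)
  have "x * (f * h) = f * g - f * j" by (simp add: gj algebra_simps)
  then have "f * h \<in> colon J x"
    using ideal_diff[OF J g(2) ideal_mult[OF J f gj(2)]] f gj by (auto simp: colon_def closed)
  then have "h \<in> colon J x" using nzdD[OF c gj(3)] by blast
  then show "g \<in> J" using gj ideal_add[OF J] by (auto simp: colon_def mult.commute)
qed

lemma colon_adjoin:
  assumes J: "is_ideal J" and x: "x \<in> C" and f: "f \<in> C" and a: "nzd (adjoin J x) f"
  shows "colon (adjoin J f) x = adjoin (colon J x) f"
proof
  show "adjoin (colon J x) f \<subseteq> colon (adjoin J f) x"
  proof
    fix h assume "h \<in> adjoin (colon J x) f"
    then obtain j c where h: "h = j + c * f" "j \<in> colon J x" "c \<in> C" by (rule adjoinE)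
    have "x * h = x * j + (x * c) * f" by (simp add: h algebra_simps)
    then show "h \<in> colon (adjoin J f) x"
      using h x f adjoinI[of "x * j" J "x * c" f] by (auto simp: colon_def closed)
  qed
  show "colon (adjoin J f) x \<subseteq> adjoin (colon J x) f"
  proof
    fix h assume "h \<in> colon (adjoin J f) x"
    then have h: "h \<in> C" "x * h \<in> adjoin J f" by (auto simp: colon_def)
    then obtain j g where g: "x * h = j + g * f" "j \<in> J" "g \<in> C" by (metis adjoinE)
    have "f * g = (0 - j) + h * x" using g(1) by (simp add: algebra_simps)
    then have "f * g \<in> adjoin J x" using adjoinI[OF ideal_diff[OF J ideal_zero[OF J] g(2)] h(1)] by simp
    then obtain j' g' where g': "g = j' + g' * x" "j' \<in> J" "g' \<in> C"
      using nzdD[OF a g(3)] by (metis adjoinE)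
    have "x * (h - g' * f) = j + f * j'"
      using g(1) by (simp add: g' algebra_simps)
    then have "h - g' * f \<in> colon J x"
      using ideal_add[OF J g(2) ideal_mult[OF J f g'(2)]] h g' f by (auto simp: colon_def closed)
    then show "h \<in> adjoin (colon J x) f"
      using adjoinI[of "h - g' * f" "colon J x" g' f] g' by simp
  qed
qed

lemma weakly_regular_of_colon_adjoin:
  assumes "is_ideal J" "x \<in> C" "set fs \<subseteq> C"
    and "weakly_regular (colon J x) fs" "weakly_regular (adjoin J x) fs"
  shows "weakly_regular J fs"
  using assms
proof (induction fs arbitrary: J)
  case (Cons f fs)
  have "weakly_regular (adjoin J f) fs"
  proof (rule Cons.IH)
    show "is_ideal (adjoin J f)" "x \<in> C" "set fs \<subseteq> C"
      using Cons.prems by (auto intro: is_ideal_adjoin)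
    show "weakly_regular (colon (adjoin J f) x) fs"
      using Cons.prems by (subst colon_adjoin) auto
    show "weakly_regular (adjoin (adjoin J f) x) fs"
      using Cons.prems by (subst adjoin_commute) auto
  qed
  then show ?case
    using Cons.prems nzd_of_colon_adjoin[of J x f] by auto
qed simp

text \<open>For \<open>J' = J + (a b)\<close> the two outer terms are \<open>C/(J' : b) = C/(J + a)\<close> and
  \<open>C/(J' + b) = C/(J + b)\<close>.\<close>

lemma weakly_regular_mult:
  assumes J: "is_ideal J" and ab: "a \<in> C" "b \<in> C" and b: "nzd J b" and fs: "set fs \<subseteq> C"
    and wa: "weakly_regular (adjoin J a) fs" and wb: "weakly_regular (adjoin J b) fs"
  shows "weakly_regular (adjoin J (a * b)) fs"
proof (rule weakly_regular_of_colon_adjoin)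
  show "is_ideal (adjoin J (a * b))" "b \<in> C" "set fs \<subseteq> C"
    using assms by (auto intro: is_ideal_adjoin closed)
  have "colon (adjoin J (a * b)) b = adjoin J a"
  proof (intro equalityI subsetI)
    fix h assume "h \<in> colon (adjoin J (a * b)) b"
    then obtain j c where h: "h \<in> C" "b * h = j + c * (a * b)" "j \<in> J" "c \<in> C"
      by (auto simp: colon_def elim: adjoinE)
    then have "b * (h - c * a) = j" by (simp add: algebra_simps)
    then have "h - c * a \<in> J" using nzdD[OF b] h ab by (auto simp: closed)
    then show "h \<in> adjoin J a" using adjoinI[of "h - c * a" J c a] h by simp
  next
    fix h assume "h \<in> adjoin J a"
    then obtain j c where h: "h = j + c * a" "j \<in> J" "c \<in> C" by (rule adjoinE)
    then have "b * h = b * j + c * (a * b)" by (simp add: algebra_simps)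
    then show "h \<in> colon (adjoin J (a * b)) b"
      using h ab adjoinI[OF ideal_mult[OF J ab(2) h(2)] h(3)] ideal_closed[OF J]
      by (auto simp: colon_def closed)
  qed
  then show "weakly_regular (colon (adjoin J (a * b)) b) fs" using wa by simp
  have "adjoin (adjoin J (a * b)) b = adjoin J b"
  proof (rule equalityI)
    show "adjoin (adjoin J (a * b)) b \<subseteq> adjoin J b"
      using ab ideal_mult[OF is_ideal_adjoin[OF J ab(2)] ab(1) adjoin_self[OF J]]
      by (intro adjoin_least is_ideal_adjoin J subset_adjoin adjoin_self)
    show "adjoin J b \<subseteq> adjoin (adjoin J (a * b)) b"
      using ab subset_adjoin[of J "a * b"] subset_adjoin[of "adjoin J (a * b)" b]
      by (intro adjoin_least is_ideal_adjoin J adjoin_self) (auto simp: closed)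
  qed
  then show "weakly_regular (adjoin (adjoin J (a * b)) b) fs" using wb by simp
qed

lemma weakly_regular_power_hd:
  assumes "is_ideal J" "f \<in> C" "set fs \<subseteq> C" "nzd J f" "weakly_regular (adjoin J f) fs"
  shows "weakly_regular (adjoin J (f ^ Suc t)) fs"
proof (induction t)
  case (Suc t)
  have "weakly_regular (adjoin J (f * f ^ Suc t)) fs"
    by (rule weakly_regular_mult) (use assms Suc in \<open>auto simp del: power_Suc intro: closed nzd_power\<close>)
  then show ?case by simp
qed (use assms in simp)

lemma weakly_regular_powers:
  assumes "is_ideal J" "set fs \<subseteq> C" "weakly_regular J fs" "t > 0"
  shows "weakly_regular J (map (\<lambda>f. f ^ t) fs)"
  using assms
proof (induction fs arbitrary: J)
  case (Cons f fs)
  obtain t' where t': "t = Suc t'" using Cons.prems(4) by (cases t) auto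
  have "weakly_regular (adjoin J (f ^ t)) fs"
    unfolding t' using Cons.prems by (intro weakly_regular_power_hd) auto
  then have "weakly_regular (adjoin J (f ^ t)) (map (\<lambda>f. f ^ t) fs)"
    using Cons.prems by (intro Cons.IH is_ideal_adjoin) (auto intro: closed)
  then show ?case using Cons.prems by (auto intro: nzd_power)
qed simp

text \<open>Half of the statement that two members of a regular sequence may be exchanged. This half needs no
  grading, as \<open>(J : x) = J\<close> makes \<open>((J + f) : x)\<close> equal to \<open>J + f\<close>.\<close>

lemma nzd_adjoin_swap:
  assumes J: "is_ideal J" and x: "x \<in> C" and f: "f \<in> C" and nx: "nzd J x" and nf: "nzd (adjoin J x) f"
  shows "nzd (adjoin J f) x"
proof -
  have "g \<in> adjoin J f" if "g \<in> C" "x * g \<in> adjoin J f" for g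
  proof -
    have "g \<in> adjoin (colon J x) f"
      using that colon_adjoin[OF J x f nf] by (auto simp: colon_def)
    moreover have "colon J x \<subseteq> J" using nx by (auto simp: colon_def nzd_def)
    ultimately show ?thesis by (auto elim!: adjoinE intro!: adjoinI)
  qed
  then show ?thesis by (auto simp: nzd_def)
qed

subsection \<open>Independence of monomials along a chain of ideals\<close>

text \<open>A common generalisation of weakly regular sequences, where each ideal is generated by its predecessor
  and the next member, and of chains of primes, where the next member is any element of the difference.\<close>

fun regular_chain :: "'a set \<Rightarrow> 'a list \<Rightarrow> 'a set \<Rightarrow> bool" where
  "regular_chain J [] L \<longleftrightarrow> J = L"
| "regular_chain J (f # fs) L \<longleftrightarrow>
    nzd J f \<and> (\<exists>J'. is_ideal J' \<and> J \<subseteq> J' \<and> f \<in> J' \<and> regular_chain J' fs L)"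

lemma regular_chain_adjoins:
  "is_ideal J \<Longrightarrow> set fs \<subseteq> C \<Longrightarrow> weakly_regular J fs \<Longrightarrow> regular_chain J fs (adjoins J fs)"
proof (induction fs arbitrary: J)
  case (Cons f fs)
  then show ?case
    using subset_adjoin[of J f] adjoin_self[of J f] is_ideal_adjoin[of J f] by auto
qed simp

definition monom :: "'a list \<Rightarrow> nat list \<Rightarrow> 'a" where
  "monom fs a = prod_list (map2 (^) fs a)"

lemma monom_simps [simp]: "monom [] a = 1" "monom (f # fs) (k # a) = f ^ k * monom fs a"
  by (simp_all add: monom_def)

lemma monom_closed: "set fs \<subseteq> C \<Longrightarrow> monom fs a \<in> C"
proof (induction fs arbitrary: a)
  case (Cons f fs)
  then show ?case by (cases a) (auto simp: closed monom_def)
qed (simp add: closed)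

text \<open>In a relation with unit coefficients divide by the lowest power of the first member \<open>f\<close> that
  occurs. The terms with a higher power of \<open>f\<close> vanish modulo the next ideal of the chain, so that the terms with
  the lowest power give a relation between the remaining members. At the end of the chain a unit times \<open>u\<close>
  would lie in \<open>L\<close>.\<close>

lemma regular_chain_lexicographic:
  assumes "regular_chain J fs L" "is_ideal J" "set fs \<subseteq> C" "u \<in> C" "u \<notin> L"
    and "finite X" "\<And>a. a \<in> X \<Longrightarrow> length a = length fs"
    and "\<And>a. a \<in> X \<Longrightarrow> c a \<in> C" "\<And>a. a \<in> X \<Longrightarrow> \<exists>d\<in>C. d * c a = 1"
    and "(\<Sum>a\<in>X. c a * monom fs a * u) \<in> J"
  shows "X = {}"
  using assms
proof (induction fs arbitrary: J X c)
  case Nil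
  show ?case
  proof (rule ccontr)
    assume "X \<noteq> {}"
    then have X: "X = {[]}" using Nil.prems(7) by auto
    then obtain d where "d \<in> C" "d * c [] = 1" using Nil.prems(9) by auto
    moreover have "c [] * u \<in> J" using Nil.prems(10) by (simp add: X)
    ultimately have "d * (c [] * u) \<in> J" using ideal_mult[OF Nil.prems(2)] by blast
    then have "u \<in> J" using \<open>d * c [] = 1\<close> by (simp flip: mult.assoc)
    then show False using Nil.prems by simp
  qed
next
  case (Cons f fs)
  then obtain J' where J': "is_ideal J'" "J \<subseteq> J'" "f \<in> J'" "regular_chain J' fs L" and nf: "nzd J f"
    by auto
  have fC: "f \<in> C" and fsC: "set fs \<subseteq> C" using Cons.prems(3) by auto
  show ?case
  proof (rule ccontr)
    assume ne: "X \<noteq> {}"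
    \<comment> \<open>the lowest power of the first member; the exponents in \<open>X0\<close> attain it\<close>
    define k where "k = Min (hd ` X)"
    have kle: "k \<le> hd a" if "a \<in> X" for a
      unfolding k_def using that Cons.prems(6) by auto
    have "k \<in> hd ` X" unfolding k_def using Cons.prems(6) ne by (intro Min_in) auto
    define X0 where "X0 = {a \<in> X. hd a = k}"
    have X0: "X0 \<noteq> {}" "finite X0" "X0 \<subseteq> X"
      using \<open>k \<in> hd ` X\<close> Cons.prems(6) by (auto simp: X0_def)
    have split: "a = hd a # tl a" if "a \<in> X" for a
      using Cons.prems(7)[OF that] by (cases a) auto
    have keq: "k # tl a = a" if "a \<in> X0" for a
      using that split[of a] by (simp add: X0_def)
    define w where "w a = c a * monom fs (tl a) * u" for a
    have wC: "w a \<in> C" if "a \<in> X" for a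
      unfolding w_def using that Cons.prems(4,8) fsC by (intro closed monom_closed) auto
    have "c a * monom (f # fs) a * u = f ^ k * (f ^ (hd a - k) * w a)" if "a \<in> X" for a
    proof -
      have "c a * monom (f # fs) a * u = f ^ hd a * w a"
        by (subst split[OF that]) (simp add: w_def algebra_simps)
      also have "f ^ hd a = f ^ k * f ^ (hd a - k)"
        using kle[OF that] by (simp flip: power_add)
      finally show ?thesis by (simp add: mult.assoc)
    qed
    then have "(\<Sum>a\<in>X. c a * monom (f # fs) a * u) = f ^ k * (\<Sum>a\<in>X. f ^ (hd a - k) * w a)"
      by (simp add: sum_distrib_left)
    then have "f ^ k * (\<Sum>a\<in>X. f ^ (hd a - k) * w a) \<in> J" using Cons.prems(10) by simp
    moreover have "(\<Sum>a\<in>X. f ^ (hd a - k) * w a) \<in> C"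
      by (intro sum_closed closed wC fC)
    ultimately have "(\<Sum>a\<in>X. f ^ (hd a - k) * w a) \<in> J'"
      using nzdD[OF nzd_power[OF nf fC]] J'(2) by blast
    moreover have "(\<Sum>a\<in>X. f ^ (hd a - k) * w a)
        = (\<Sum>a\<in>X0. f ^ (hd a - k) * w a) + (\<Sum>a\<in>X - X0. f ^ (hd a - k) * w a)"
      by (subst sum.subset_diff[OF X0(3) Cons.prems(6)]) (rule add.commute)
    moreover have "(\<Sum>a\<in>X - X0. f ^ (hd a - k) * w a) \<in> J'"
    proof (intro ideal_sum J')
      fix a assume a: "a \<in> X - X0"
      then have "k < hd a" using kle[of a] by (auto simp: X0_def)
      then obtain e where "hd a - k = Suc e" by (metis Suc_diff_Suc)
      then have "f ^ (hd a - k) * w a = (f ^ e * w a) * f" by (simp add: algebra_simps)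
      then show "f ^ (hd a - k) * w a \<in> J'"
        using a wC fC J'(3) by (auto intro!: ideal_mult[OF J'(1)] closed)
    qed
    ultimately have "(\<Sum>a\<in>X0. f ^ (hd a - k) * w a) \<in> J'"
      using ideal_diff[OF J'(1), of "(\<Sum>a\<in>X. f ^ (hd a - k) * w a)" "(\<Sum>a\<in>X - X0. f ^ (hd a - k) * w a)"]
      by simp
    then have "(\<Sum>a\<in>X0. w a) \<in> J'" by (simp add: X0_def)
    moreover have inj: "inj_on tl X0"
    proof (rule inj_onI)
      fix a b assume "a \<in> X0" "b \<in> X0" "tl a = tl b"
      then show "a = b" using split[of a] split[of b] by (auto simp: X0_def)
    qed
    ultimately have sum': "(\<Sum>a\<in>tl ` X0. c (k # a) * monom fs a * u) \<in> J'"
    proof -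
      assume a: "(\<Sum>a\<in>X0. w a) \<in> J'"
      have "(\<Sum>a\<in>tl ` X0. c (k # a) * monom fs a * u) = (\<Sum>a\<in>X0. w a)"
        unfolding sum.reindex[OF inj]
        by (rule sum.cong) (simp_all add: w_def keq)
      then show ?thesis using a by simp
    qed
    have kX: "k # tl a \<in> X" if "a \<in> X0" for a
      using that keq X0(3) by auto
    have "tl ` X0 = {}"
    proof (rule Cons.IH[where c = "\<lambda>a. c (k # a)"])
      show "regular_chain J' fs L" "is_ideal J'" "set fs \<subseteq> C" "u \<in> C" "u \<notin> L" "finite (tl ` X0)"
        using J' fsC Cons.prems X0 by auto
      show "(\<Sum>a\<in>tl ` X0. c (k # a) * monom fs a * u) \<in> J'" by (rule sum')
      show "length a = length fs" "c (k # a) \<in> C" "\<exists>d\<in>C. d * c (k # a) = 1" if a: "a \<in> tl ` X0" for a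
      proof -
        have "k # a \<in> X" using a kX by auto
        then show "length a = length fs" "c (k # a) \<in> C" "\<exists>d\<in>C. d * c (k # a) = 1"
          using Cons.prems(7)[of "k # a"] Cons.prems(8,9) by auto
      qed
    qed
    then show False using X0 by simp
  qed
qed

end

section \<open>Polynomials as finitely supported maps\<close>

abbreviation keys :: "('a \<Rightarrow>\<^sub>0 'b::zero) \<Rightarrow> 'a set" where "keys \<equiv> Poly_Mapping.keys"
abbreviation lookup :: "('a \<Rightarrow>\<^sub>0 'b::zero) \<Rightarrow> 'a \<Rightarrow> 'b" where "lookup \<equiv> Poly_Mapping.lookup"
abbreviation single :: "'a \<Rightarrow> 'b \<Rightarrow> 'a \<Rightarrow>\<^sub>0 'b::zero" where "single \<equiv> Poly_Mapping.single"

lemma keys_plus_nat: "keys (m + m' :: 'v \<Rightarrow>\<^sub>0 nat) = keys m \<union> keys m'"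
  by (auto simp: in_keys_iff lookup_add)

lemma keys_multE:
  assumes "m \<in> keys (p * q)"
  obtains a b where "m = a + b" "a \<in> keys p" "b \<in> keys q"
  using assms keys_mult[of p q] by blast

definition polys :: "'v set \<Rightarrow> ('v, 'k::field) mpolynomial set" where
  "polys V = {p. \<forall>m\<in>keys p. keys m \<subseteq> V}"

lemma carrier_mpoly_ring: "carrier (mpoly_ring V) = polys V"
  by (simp add: mpoly_ring_def polys_def)

interpretation polys: unital_subring "polys V :: ('v, 'k::field) mpolynomial set" for V
proof
  show "1 \<in> polys V" by (auto simp: polys_def)
next
  fix x y :: "('v, 'k) mpolynomial" assume xy: "x \<in> polys V" "y \<in> polys V"
  have "keys (x - y) \<subseteq> keys x \<union> keys y"
    by (auto simp: in_keys_iff lookup_minus)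
  then show "x - y \<in> polys V" using xy by (auto simp: polys_def)
  show "x * y \<in> polys V"
    using xy keys_mult[of x y] by (fastforce simp: polys_def keys_plus_nat)
qed

lemma lookup_single_mult_plus:
  "lookup (single a c * p) (a + m) = c * lookup p m"
  for p :: "('v, 'k::field) mpolynomial"
  by (simp add: lookup_mult prod_fun_def lookup_single when_mult)

lemma keys_single_mult:
  "c \<noteq> 0 \<Longrightarrow> keys (single a c * p) = (+) a ` keys p"
  for p :: "('v, 'k::field) mpolynomial"
proof (intro equalityI subsetI)
  fix m assume "c \<noteq> 0" "m \<in> keys (single a c * p)"
  then show "m \<in> (+) a ` keys p"
    using keys_mult[of "single a c" p] by auto
qed (auto simp: in_keys_iff lookup_single_mult_plus)

lemma poly_expand: "p = (\<Sum>m\<in>keys p. single m (lookup p m))"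
  by (rule poly_mapping_eqI) (simp add: lookup_sum lookup_single when_def in_keys_iff)

text \<open>Monomial ideals are determined by the terms of their elements.\<close>

lemma ideal_memI_terms:
  assumes "polys.is_ideal V J"
    and "\<And>m. m \<in> keys p \<Longrightarrow> single m (lookup p m) \<in> J"
  shows "p \<in> J"
  by (subst poly_expand) (rule polys.ideal_sum[OF assms(1)], rule assms(2))

text \<open>The sum of the terms of a polynomial whose exponent vector satisfies \<open>P\<close>; its uses are the components
  of a given degree and the substitution of 0 for a set of variables.\<close>

definition restrict_poly :: "(('v \<Rightarrow>\<^sub>0 nat) \<Rightarrow> bool) \<Rightarrow> ('v, 'k::field) mpolynomial \<Rightarrow> ('v, 'k) mpolynomial" where
  "restrict_poly P p = (\<Sum>m\<in>{m \<in> keys p. P m}. single m (lookup p m))"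

lemma lookup_restrict: "lookup (restrict_poly P p) m = (lookup p m when P m)"
  by (simp add: restrict_poly_def lookup_sum lookup_single when_def in_keys_iff)

lemma keys_restrict: "keys (restrict_poly P p) = {m \<in> keys p. P m}"
  by (auto simp: in_keys_iff lookup_restrict)

lemma restrict_add: "restrict_poly P (p + q) = restrict_poly P p + restrict_poly P q"
  by (rule poly_mapping_eqI) (simp add: lookup_restrict lookup_add when_add_distrib)

lemma restrict_self: "(\<And>m. m \<in> keys p \<Longrightarrow> P m) \<Longrightarrow> restrict_poly P p = p"
  by (rule poly_mapping_eqI) (auto simp: lookup_restrict when_def in_keys_iff)

lemma restrict_none: "(\<And>m. m \<in> keys p \<Longrightarrow> \<not> P m) \<Longrightarrow> restrict_poly P p = 0"
  by (rule poly_mapping_eqI) (auto simp: lookup_restrict when_def in_keys_iff)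

lemma restrict_split: "p = restrict_poly P p + restrict_poly (\<lambda>m. \<not> P m) p"
  by (rule poly_mapping_eqI) (auto simp: lookup_restrict lookup_add when_def)

lemma restrict_closed: "p \<in> polys V \<Longrightarrow> restrict_poly P p \<in> polys V"
  by (auto simp: polys_def keys_restrict)

section \<open>Stanley--Reisner ideals\<close>

text \<open>The ideal of all polynomials without a term supported on a face of \<open>\<Delta>\<close>. For the complex of
  independent sets it is the edge ideal, and for a full simplex on \<open>F\<close> it is the prime generated by the
  variables outside \<open>F\<close>. On these ideals, colon and sum with a variable \<open>v\<close> become the star and the deletion
  of \<open>v\<close> in \<open>\<Delta>\<close>.\<close>

definition sr_ideal :: "'v set \<Rightarrow> 'v set set \<Rightarrow> ('v, 'k::field) mpolynomial set" where
  "sr_ideal V \<Delta> = {p \<in> polys V. \<forall>m\<in>keys p. keys m \<notin> \<Delta>}"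

definition down_closed :: "'v set set \<Rightarrow> bool" where
  "down_closed \<Delta> \<longleftrightarrow> (\<forall>X\<in>\<Delta>. \<forall>Y\<subseteq>X. Y \<in> \<Delta>)"

lemma down_closed_Pow: "down_closed (Pow F)"
  by (auto simp: down_closed_def)

lemma is_ideal_sr_ideal:
  fixes V :: "'v set"
  assumes "down_closed \<Delta>"
  shows "polys.is_ideal V (sr_ideal V \<Delta> :: ('v, 'k::field) mpolynomial set)"
proof (rule polys.is_idealI)
  fix x y :: "('v, 'k) mpolynomial"
  show "x \<in> sr_ideal V \<Delta> \<Longrightarrow> y \<in> sr_ideal V \<Delta> \<Longrightarrow> x + y \<in> sr_ideal V \<Delta>"
    using Poly_Mapping.keys_add[of x y] by (auto simp: sr_ideal_def intro: polys.closed)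
  assume x: "x \<in> polys V" and y: "y \<in> sr_ideal V \<Delta>"
  have "keys m \<notin> \<Delta>" if m: "m \<in> keys (x * y)" for m
  proof -
    obtain a b where "m = a + b" "b \<in> keys y" using m by (rule keys_multE)
    then show ?thesis using y assms by (auto simp: sr_ideal_def down_closed_def keys_plus_nat)
  qed
  then show "x * y \<in> sr_ideal V \<Delta>"
    using x y by (auto simp: sr_ideal_def intro: polys.mult_closed)
qed (auto simp: sr_ideal_def polys.closed)

lemma var_closed: "v \<in> V \<Longrightarrow> var v \<in> polys V"
  by (simp add: var_def polys_def)

lemma keys_var_mult: "keys (var v * p) = (+) (single v 1) ` keys p"
  unfolding var_def by (rule keys_single_mult) simp

lemma colon_sr_ideal:
  assumes "v \<in> V"
  shows "polys.colon V (sr_ideal V \<Delta>) (var v) = sr_ideal V {X. insert v X \<in> \<Delta>}"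
  using assms by (auto simp: polys.colon_def sr_ideal_def keys_var_mult keys_plus_nat var_closed polys.closed)

lemma monomial_div_var:
  assumes "v \<in> keys (m :: 'v \<Rightarrow>\<^sub>0 nat)"
  obtains m' where "m = m' + single v 1" "keys m' \<subseteq> keys m"
proof
  let ?m = "m - single v 1"
  show "m = ?m + single v 1"
    using assms by (intro poly_mapping_eqI) (auto simp: lookup_add minus_poly_mapping.rep_eq lookup_single when_def in_keys_iff)
  show "keys ?m \<subseteq> keys m"
    by (auto simp: in_keys_iff minus_poly_mapping.rep_eq)
qed

text \<open>A term supported on a face that contains \<open>v\<close> is a multiple of the variable \<open>v\<close>.\<close>

lemma adjoin_sr_ideal:
  assumes v: "v \<in> V" and \<Delta>: "down_closed \<Delta>"
  shows "polys.adjoin V (sr_ideal V \<Delta>) (var v :: ('v, 'k::field) mpolynomial) = sr_ideal V {X \<in> \<Delta>. v \<notin> X}"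
proof
  let ?J = "polys.adjoin V (sr_ideal V \<Delta>) (var v :: ('v, 'k::field) mpolynomial)"
  have \<Delta>': "down_closed {X \<in> \<Delta>. v \<notin> X}" using \<Delta> by (auto simp: down_closed_def)
  have "var v \<in> sr_ideal V {X \<in> \<Delta>. v \<notin> X}"
    using v by (auto simp: sr_ideal_def var_closed) (auto simp: var_def split: if_splits)
  then show "?J \<subseteq> sr_ideal V {X \<in> \<Delta>. v \<notin> X}"
    by (intro polys.adjoin_least is_ideal_sr_ideal \<Delta>') (auto simp: sr_ideal_def)
  have J: "polys.is_ideal V ?J"
    using v \<Delta> by (intro polys.is_ideal_adjoin is_ideal_sr_ideal var_closed)
  show "sr_ideal V {X \<in> \<Delta>. v \<notin> X} \<subseteq> ?J"
  proof
    fix p :: "('v, 'k) mpolynomial" assume p: "p \<in> sr_ideal V {X \<in> \<Delta>. v \<notin> X}"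
    show "p \<in> ?J"
    proof (rule ideal_memI_terms[OF J])
      fix m assume m: "m \<in> keys p"
      let ?c = "lookup p m"
      have mV: "keys m \<subseteq> V" using p m by (auto simp: sr_ideal_def polys_def)
      show "single m ?c \<in> ?J"
      proof (cases "keys m \<in> \<Delta>")
        case False
        then have "single m ?c \<in> sr_ideal V \<Delta>"
          using mV by (auto simp: sr_ideal_def polys_def split: if_splits)
        then show ?thesis using polys.subset_adjoin by blast
      next
        case True
        then have "v \<in> keys m" using p m by (auto simp: sr_ideal_def)
        then obtain m' where m': "m = m' + single v 1" "keys m' \<subseteq> keys m"
          by (rule monomial_div_var)
        then have "single m ?c = single m' ?c * var v"
          by (simp add: var_def mult_single)
        moreover have "single m' ?c \<in> polys V" using m'(2) mV by (auto simp: polys_def split: if_splits)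
        ultimately show ?thesis
          using polys.ideal_mult[OF J _ polys.adjoin_self[OF is_ideal_sr_ideal[OF \<Delta>]]] by simp
      qed
    qed
  qed
qed

text \<open>Setting the variables outside \<open>F\<close> to 0 is a ring homomorphism onto a polynomial ring, which is a domain,
  and this ideal is its kernel.\<close>

lemma sr_ideal_simplex_prime:
  fixes p q :: "('v::linorder, 'k::field) mpolynomial"
  assumes "p \<in> polys V" "q \<in> polys V" "p * q \<in> sr_ideal V (Pow F)"
  shows "p \<in> sr_ideal V (Pow F) \<or> q \<in> sr_ideal V (Pow F)"
proof -
  \<comment> \<open>restriction to the terms with \<open>?P\<close> is the substitution of 0\<close>
  let ?P = "\<lambda>m. keys m \<subseteq> F"
  let ?I = "sr_ideal V (Pow F) :: ('v, 'k) mpolynomial set"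
  have I: "polys.is_ideal V ?I" by (rule is_ideal_sr_ideal) (auto simp: down_closed_def)
  have rest: "restrict_poly (\<lambda>m. \<not> ?P m) r \<in> ?I" if "r \<in> polys V" for r :: "('v, 'k) mpolynomial"
    using that by (auto simp: sr_ideal_def keys_restrict restrict_closed)
  have mem: "r \<in> ?I" if "restrict_poly ?P r = 0" "r \<in> polys V" for r :: "('v, 'k) mpolynomial"
    using rest[OF that(2)] that(1) by (metis restrict_split add_0)
  let ?p = "restrict_poly ?P p" and ?q = "restrict_poly ?P q"
  let ?p' = "restrict_poly (\<lambda>m. \<not> ?P m) p" and ?q' = "restrict_poly (\<lambda>m. \<not> ?P m) q"
  have p: "p = ?p + ?p'" and q: "q = ?q + ?q'" by (rule restrict_split)+
  have "p * q = ?p * ?q + (?p * ?q' + q * ?p')"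
  proof -
    have "p * q = ?p * q + q * ?p'" by (subst (1) p) (simp add: algebra_simps)
    also have "?p * q = ?p * ?q + ?p * ?q'" by (subst (1) q) (rule distrib_left)
    finally show ?thesis by (simp add: algebra_simps)
  qed
  moreover have "?p * ?q' + q * ?p' \<in> ?I"
    using rest assms by (intro polys.ideal_add[OF I] polys.ideal_mult[OF I] restrict_closed) auto
  ultimately have pq: "?p * ?q \<in> ?I"
    using polys.ideal_diff[OF I assms(3), of "?p * ?q' + q * ?p'"] by simp
  have "\<forall>m\<in>keys (?p * ?q). ?P m"
    by (auto simp: keys_restrict keys_plus_nat elim!: keys_multE)
  with pq have "keys (?p * ?q) = {}" unfolding sr_ideal_def by blast
  then have "?p * ?q = 0" by (simp only: keys_eq_empty)
  then have "?p = 0 \<or> ?q = 0" by (simp only: mult_eq_0_iff)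
  then show ?thesis using mem assms by auto
qed

section \<open>Homogeneous ideals and a variable\<close>

definition mdeg :: "('v \<Rightarrow>\<^sub>0 nat) \<Rightarrow> nat" where
  "mdeg m = sum (lookup m) (keys m)"

lemma mdeg_superset: "finite X \<Longrightarrow> keys m \<subseteq> X \<Longrightarrow> mdeg m = sum (lookup m) X"
  unfolding mdeg_def by (rule sum.mono_neutral_left) (auto simp: in_keys_iff)

lemma mdeg_add: "mdeg (a + b) = mdeg a + mdeg b"
  using mdeg_superset[of "keys a \<union> keys b"]
  by (simp add: keys_plus_nat lookup_add sum.distrib)

lemma lookup_le_mdeg: "lookup m v \<le> mdeg m"
  by (cases "v \<in> keys m") (auto simp: mdeg_def in_keys_iff intro: member_le_sum)

lemma mdeg_zero [simp]: "mdeg 0 = 0" by (simp add: mdeg_def)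

lemma mdeg_single [simp]: "mdeg (single v k) = k" by (simp add: mdeg_def)

definition homogeneous_poly :: "nat \<Rightarrow> ('v, 'k::field) mpolynomial \<Rightarrow> bool" where
  "homogeneous_poly e p \<longleftrightarrow> (\<forall>m\<in>keys p. mdeg m = e)"

abbreviation component :: "nat \<Rightarrow> ('v, 'k::field) mpolynomial \<Rightarrow> ('v, 'k) mpolynomial" where
  "component d \<equiv> restrict_poly (\<lambda>m. mdeg m = d)"

lemma component_mult:
  assumes f: "homogeneous_poly e f"
  shows "component (d + e) (f * g) = f * component d g"
proof -
  let ?r = "restrict_poly (\<lambda>m. mdeg m \<noteq> d) g"
  have "component (d + e) (f * component d g) = f * component d g"
    using f by (intro restrict_self) (auto simp: keys_restrict mdeg_add homogeneous_poly_def elim!: keys_multE)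
  moreover have "component (d + e) (f * ?r) = 0"
    using f by (intro restrict_none) (auto simp: keys_restrict mdeg_add homogeneous_poly_def elim!: keys_multE)
  moreover have "f * g = f * component d g + f * ?r"
    by (subst restrict_split[of g "\<lambda>m. mdeg m = d"]) (simp add: algebra_simps)
  ultimately show ?thesis by (simp add: restrict_add)
qed

lemma component_mult_low:
  assumes f: "homogeneous_poly e f" and "d < e"
  shows "component d (f * g) = 0"
  using assms by (intro restrict_none) (auto simp: mdeg_add homogeneous_poly_def elim!: keys_multE)

lemma sum_components: "p = (\<Sum>d\<in>mdeg ` keys p. component d p)"
  by (rule poly_mapping_eqI) (auto simp: lookup_sum lookup_restrict when_def in_keys_iff)

definition homogeneous_ideal :: "'v set \<Rightarrow> ('v, 'k::field) mpolynomial set \<Rightarrow> bool" where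
  "homogeneous_ideal V J \<longleftrightarrow> polys.is_ideal V J \<and> (\<forall>p\<in>J. \<forall>d. component d p \<in> J)"

lemma homogeneous_poly_var_power: "homogeneous_poly k (var v ^ k)"
proof (induction k)
  case (Suc k)
  then show ?case by (auto simp: homogeneous_poly_def keys_var_mult mdeg_add)
qed (auto simp: homogeneous_poly_def)

lemma homogeneous_sr_ideal: "down_closed \<Delta> \<Longrightarrow> homogeneous_ideal V (sr_ideal V \<Delta>)"
  by (auto simp: homogeneous_ideal_def is_ideal_sr_ideal) (auto simp: sr_ideal_def keys_restrict restrict_closed)

lemma homogeneous_adjoin:
  assumes J: "homogeneous_ideal V J" and f: "homogeneous_poly e f" "f \<in> polys V"
  shows "homogeneous_ideal V (polys.adjoin V J f)"
  unfolding homogeneous_ideal_def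
proof (intro conjI ballI allI)
  have J': "polys.is_ideal V J" using J by (simp add: homogeneous_ideal_def)
  show A: "polys.is_ideal V (polys.adjoin V J f)" by (intro polys.is_ideal_adjoin J' f)
  fix p d assume "p \<in> polys.adjoin V J f"
  then obtain j c where p: "p = j + c * f" "j \<in> J" "c \<in> polys V" by (rule polys.adjoinE)
  have "component d j \<in> J" using J p by (simp add: homogeneous_ideal_def)
  moreover have "\<exists>c'\<in>polys V. component d (c * f) = c' * f"
  proof (cases "d < e")
    case True
    then have "component d (c * f) = 0 * f" using component_mult_low[OF f(1), of d c] by (simp add: mult.commute)
    then show ?thesis using polys.zero_closed by blast
  next
    case False
    then have "component d (c * f) = component (d - e) c * f"
      using component_mult[OF f(1), of "d - e" c] by (simp add: mult.commute)
    then show ?thesis using restrict_closed[OF p(3)] by blast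
  qed
  ultimately show "component d p \<in> polys.adjoin V J f"
    by (auto simp: p(1) restrict_add intro: polys.adjoinI)
qed

text \<open>If \<open>f g \<in> J\<close>, then regularity of \<open>f\<close> modulo \<open>J + (v)\<close> and of \<open>v\<close> modulo \<open>J\<close> allow \<open>g\<close> to be divided by \<open>v\<close>
  modulo \<open>J\<close> arbitrarily often. As \<open>J\<close> is homogeneous, a component of degree \<open>d\<close> cannot survive division by
  \<open>v\<^bsup>d+1\<^esup>\<close>. This is the graded form of Nakayama's lemma.\<close>

lemma nzd_of_nzd_mod_var:
  assumes J: "homogeneous_ideal V J" and v: "v \<in> V" and f: "f \<in> polys V"
    and nv: "polys.nzd V J (var v)" and nf: "polys.nzd V (polys.adjoin V J (var v)) f"
  shows "polys.nzd V J f"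
  unfolding polys.nzd_def
proof (intro ballI impI)
  have I: "polys.is_ideal V J" using J by (simp add: homogeneous_ideal_def)
  fix g assume g: "g \<in> polys V" "f * g \<in> J"
  have div: "\<exists>j\<in>J. \<exists>h\<in>polys V. g = j + var v ^ k * h \<and> f * h \<in> J" for k
  proof (induction k)
    case 0
    then show ?case using g polys.ideal_zero[OF I] by (intro bexI[of _ 0] bexI[of _ g]) auto
  next
    case (Suc k)
    then obtain j h where jh: "j \<in> J" "h \<in> polys V" "g = j + var v ^ k * h" "f * h \<in> J" by blast
    have "h \<in> polys.adjoin V J (var v)"
      using polys.nzdD[OF nf jh(2)] polys.subset_adjoin jh(4) by blast
    then obtain j' h' where h': "h = j' + h' * var v" "j' \<in> J" "h' \<in> polys V" by (rule polys.adjoinE)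
    have "var v * (f * h') = f * h - f * j'" by (simp add: h' algebra_simps)
    then have "f * h' \<in> J"
      using polys.nzdD[OF nv, of "f * h'"] polys.ideal_diff[OF I jh(4) polys.ideal_mult[OF I f h'(2)]]
      by (simp add: polys.closed f h')
    moreover have "g = (j + var v ^ k * j') + var v ^ Suc k * h'"
      by (simp add: jh(3) h'(1) algebra_simps)
    moreover have "j + var v ^ k * j' \<in> J"
      by (intro polys.ideal_add[OF I] polys.ideal_mult[OF I] jh h' polys.closed var_closed v)
    ultimately show ?case using h'(3) by blast
  qed
  have "component d g \<in> J" for d
  proof -
    obtain j h where "j \<in> J" "h \<in> polys V" "g = j + var v ^ Suc d * h" using div[of "Suc d"] by blast
    then show ?thesis
      using component_mult_low[OF homogeneous_poly_var_power, of d "Suc d" v h] J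
      by (simp add: restrict_add homogeneous_ideal_def del: power_Suc)
  qed
  then show "g \<in> J" by (subst sum_components) (rule polys.ideal_sum[OF I])
qed

text \<open>In a graded ring a variable may be moved from the front of a regular sequence to its end.\<close>

lemma weakly_regular_of_mod_var:
  assumes "homogeneous_ideal V J" "v \<in> V" "set fs \<subseteq> polys V" "\<forall>f\<in>set fs. \<exists>e. homogeneous_poly e f"
    and "polys.nzd V J (var v)" "polys.weakly_regular V (polys.adjoin V J (var v)) fs"
  shows "polys.weakly_regular V J fs \<and> polys.nzd V (polys.adjoins V J fs) (var v)"
  using assms
proof (induction fs arbitrary: J)
  case (Cons f fs)
  have I: "polys.is_ideal V J" using Cons.prems by (simp add: homogeneous_ideal_def)
  have f: "f \<in> polys V" and nf: "polys.nzd V (polys.adjoin V J (var v)) f" using Cons.prems by auto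
  have "polys.weakly_regular V (polys.adjoin V J f) fs \<and> polys.nzd V (polys.adjoins V (polys.adjoin V J f) fs) (var v)"
  proof (rule Cons.IH)
    show "homogeneous_ideal V (polys.adjoin V J f)" using Cons.prems homogeneous_adjoin by auto
    show "polys.nzd V (polys.adjoin V J f) (var v)"
      by (rule polys.nzd_adjoin_swap[OF I var_closed[OF Cons.prems(2)] f Cons.prems(5) nf])
    show "polys.weakly_regular V (polys.adjoin V (polys.adjoin V J f) (var v)) fs"
      using Cons.prems by (subst polys.adjoin_commute) simp
  qed (use Cons.prems in auto)
  then show ?case using nzd_of_nzd_mod_var[OF _ _ f] Cons.prems nf by simp
qed simp

section \<open>Elementary symmetric polynomials as a regular sequence\<close>

text \<open>The exponent vector of the squarefree monomial with support \<open>X\<close>.\<close>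

definition indicator_exp :: "'v set \<Rightarrow> 'v \<Rightarrow>\<^sub>0 nat" where
  "indicator_exp X = (\<Sum>v\<in>X. single v 1)"

lemma lookup_indicator_exp: "finite X \<Longrightarrow> lookup (indicator_exp X) v = (1 when v \<in> X)"
  by (simp add: indicator_exp_def lookup_sum lookup_single when_def)

lemma keys_indicator_exp [simp]: "finite X \<Longrightarrow> keys (indicator_exp X) = X"
  by (auto simp: in_keys_iff lookup_indicator_exp when_def split: if_splits)

lemma mdeg_indicator_exp: "finite X \<Longrightarrow> mdeg (indicator_exp X) = card X"
  by (simp add: mdeg_def lookup_indicator_exp)

definition squarefree :: "'v set \<Rightarrow> ('v, 'k::field) mpolynomial" where
  "squarefree X = single (indicator_exp X) 1"

lemma squarefree_closed: "finite X \<Longrightarrow> X \<subseteq> V \<Longrightarrow> squarefree X \<in> polys V"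
  by (simp add: squarefree_def polys_def)

lemma squarefree_prod: "finite X \<Longrightarrow> squarefree X = (\<Prod>v\<in>X. var v :: ('v, 'k::field) mpolynomial)"
proof (induction X rule: finite_induct)
  case (insert x F)
  have "squarefree (insert x F) = var x * (squarefree F :: ('v, 'k) mpolynomial)"
    using insert.hyps
    by (simp add: squarefree_def indicator_exp_def var_def mult_single)
  then show ?case using insert by simp
qed (simp add: squarefree_def indicator_exp_def)

definition esym :: "'v set \<Rightarrow> nat \<Rightarrow> ('v, 'k::field) mpolynomial" where
  "esym W k = (\<Sum>X | X \<subseteq> W \<and> card X = k. squarefree X)"

lemma keys_esym:
  assumes "finite W"
  shows "keys (esym W k) \<subseteq> indicator_exp ` {X. X \<subseteq> W \<and> card X = k}"
  unfolding esym_def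
  using keys_sum[of squarefree] by (fastforce simp: squarefree_def split: if_splits)

lemma esym_closed:
  assumes "finite V" "W \<subseteq> V"
  shows "esym W k \<in> polys V"
  using assms by (auto simp: esym_def intro!: polys.sum_closed squarefree_closed intro: finite_subset)

lemma homogeneous_esym: "finite W \<Longrightarrow> homogeneous_poly k (esym W k)"
  using keys_esym[of W k]
  by (force simp: homogeneous_poly_def mdeg_indicator_exp dest: finite_subset)

lemma esym_card: "finite W \<Longrightarrow> esym W (card W) = squarefree W"
proof -
  assume "finite W"
  then have "{X. X \<subseteq> W \<and> card X = card W} = {W}" by (auto dest: card_subset_eq)
  then show ?thesis by (simp add: esym_def)
qed

text \<open>Setting the variables outside \<open>F\<close> to 0 turns the elementary symmetric polynomials in \<open>W\<close> into those
  in \<open>F\<close>. Hence one sequence, in all variables of the ring, serves for all faces at once.\<close>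

lemma esym_diff_mem:
  assumes V: "finite V" and "F \<subseteq> W" "W \<subseteq> V"
  shows "esym F k - esym W k \<in> (sr_ideal V (Pow F) :: ('v, 'k::field) mpolynomial set)"
proof -
  have fW: "finite W" using assms finite_subset by blast
  let ?A = "{X. X \<subseteq> F \<and> card X = k}" and ?B = "{X. X \<subseteq> W \<and> \<not> X \<subseteq> F \<and> card X = k}"
  have "{X. X \<subseteq> W \<and> card X = k} = ?A \<union> ?B" using assms(2) by auto
  moreover have "finite ?A" "finite ?B"
    using fW assms(2) by (auto intro: finite_subset[of _ "Pow W"])
  ultimately have "(esym W k :: ('v, 'k) mpolynomial) = esym F k + (\<Sum>X\<in>?B. squarefree X)"
    unfolding esym_def by (simp only:) (rule sum.union_disjoint, auto)
  then have eq: "(esym F k - esym W k :: ('v, 'k) mpolynomial) = 0 - (\<Sum>X\<in>?B. squarefree X)"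
    by simp
  have I: "polys.is_ideal V (sr_ideal V (Pow F) :: ('v, 'k) mpolynomial set)"
    by (rule is_ideal_sr_ideal[OF down_closed_Pow])
  have "squarefree X \<in> (sr_ideal V (Pow F) :: ('v, 'k) mpolynomial set)" if "X \<subseteq> W" "\<not> X \<subseteq> F" for X
  proof -
    have "finite X" using that(1) fW finite_subset by blast
    then show ?thesis
      using that squarefree_closed[of X V] order.trans[OF that(1) assms(3)]
      by (simp add: sr_ideal_def) (simp add: squarefree_def)
  qed
  then show ?thesis
    unfolding eq by (intro polys.ideal_diff[OF I] polys.ideal_zero[OF I] polys.ideal_sum[OF I]) auto
qed

lemma esym_cong:
  assumes V: "finite V" and FW: "F \<subseteq> W" "W \<subseteq> V"
    and w: "polys.weakly_regular V (sr_ideal V (Pow F) :: ('v, 'k::field) mpolynomial set) (map (esym F) ks)"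
  shows "polys.weakly_regular V (sr_ideal V (Pow F) :: ('v, 'k) mpolynomial set) (map (esym W) ks)"
proof (rule polys.weakly_regular_cong[OF _ _ w])
  show "polys.is_ideal V (sr_ideal V (Pow F) :: ('v, 'k) mpolynomial set)"
    by (rule is_ideal_sr_ideal[OF down_closed_Pow])
  show "list_all2 (\<lambda>f f'. f \<in> polys V \<and> f' \<in> polys V \<and> f - f' \<in> sr_ideal V (Pow F))
     (map (esym F) ks) (map (esym W) ks :: ('v, 'k) mpolynomial list)"
    unfolding list_all2_map1 list_all2_map2 list_all2_same
    by (intro ballI conjI esym_diff_mem[OF V FW] esym_closed[OF V FW(2)] esym_closed[OF V order.trans[OF FW]])
qed

text \<open>Induction on the number of variables. Modulo a variable \<open>x\<close> the polynomials become those of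
  \<open>F - {x}\<close>, so \<open>x, e\<^sub>1, \<dots>, e\<^sub>c\<close> with \<open>c = |F| - 1\<close> is regular, and \<open>x\<close> may be moved to the end. This settles
  all lengths below \<open>|F|\<close>. Moreover every variable is then a nonzerodivisor modulo \<open>e\<^sub>1, \<dots>, e\<^sub>c\<close>, and
  therefore so is their product, which is the last polynomial.\<close>

lemma esym_weakly_regular_simplex:
  fixes V F :: "'v set"
  assumes "finite V" "F \<subseteq> V" "r \<le> card F"
  shows "polys.weakly_regular V (sr_ideal V (Pow F) :: ('v, 'k::field) mpolynomial set) (map (esym F) [1..<Suc r])"
  using assms(2,3)
proof (induction "card F" arbitrary: F r)
  case (Suc c)
  have fF: "finite F" using Suc.prems assms(1) finite_subset by blast
  let ?I = "sr_ideal V (Pow F) :: ('v, 'k) mpolynomial set"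
  have H: "homogeneous_ideal V ?I" by (rule homogeneous_sr_ideal[OF down_closed_Pow])
  have cl: "set (map (esym F) [1..<Suc r]) \<subseteq> (polys V :: ('v, 'k) mpolynomial set)" for r
    using esym_closed[OF assms(1) Suc.prems(1)] by auto
  have step: "polys.weakly_regular V ?I (map (esym F) [1..<Suc r'])
      \<and> polys.nzd V (polys.adjoins V ?I (map (esym F) [1..<Suc r'])) (var x)"
    if x: "x \<in> F" and r': "r' \<le> c" for x r'
  proof (rule weakly_regular_of_mod_var[OF H _ cl])
    show "x \<in> V" using x Suc.prems by blast
    show "\<forall>f\<in>set (map (esym F) [1..<Suc r']). \<exists>e. homogeneous_poly e f"
      using homogeneous_esym[OF fF] by auto
    have "{X. insert x X \<in> Pow F} = Pow F" using x by auto
    then have "polys.colon V ?I (var x) = ?I" using colon_sr_ideal[OF \<open>x \<in> V\<close>, of "Pow F"] by simp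
    then show "polys.nzd V ?I (var x)" by (auto simp: polys.colon_def polys.nzd_def)
    have "{X \<in> Pow F. x \<notin> X} = Pow (F - {x})" by auto
    then have eq: "polys.adjoin V ?I (var x) = sr_ideal V (Pow (F - {x}))"
      using adjoin_sr_ideal[OF \<open>x \<in> V\<close> down_closed_Pow[of F]] by (simp only:)
    have "polys.weakly_regular V (sr_ideal V (Pow (F - {x})) :: ('v, 'k) mpolynomial set)
        (map (esym (F - {x})) [1..<Suc r'])"
      using x r' Suc.hyps(2) Suc.prems fF by (intro Suc.hyps(1)) auto
    then show "polys.weakly_regular V (polys.adjoin V ?I (var x)) (map (esym F) [1..<Suc r'])"
      unfolding eq by (rule esym_cong[OF assms(1) Diff_subset Suc.prems(1)])
  qed
  obtain x where x: "x \<in> F" using Suc.hyps(2) by fastforce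
  show ?case
  proof (cases "r = Suc c")
    case False
    then show ?thesis using step[OF x, of r] Suc by auto
  next
    case True
    have "esym F r = (\<Prod>v\<in>F. var v :: ('v, 'k) mpolynomial)"
      using esym_card[OF fF] squarefree_prod[OF fF] True Suc.hyps(2) by metis
    then have "polys.nzd V (polys.adjoins V ?I (map (esym F) [1..<Suc c])) (esym F r)"
      using step Suc.prems(1) by (simp only:) (intro polys.nzd_prod var_closed, auto simp del: upt_Suc)
    then show ?thesis using step[OF x, of c] True by (simp add: polys.weakly_regular_append)
  qed
qed simp

text \<open>Nonpure vertex decomposability in which every simplex at the end of the recursion has at least \<open>r\<close>
  vertices. The family \<open>{X. insert v X \<in> \<Delta>}\<close> is the star of \<open>v\<close>, a cone over the link, so that \<open>v\<close> counts as a vertex of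
  the simplices obtained from it.\<close>

inductive vertex_decomposable :: "'v set \<Rightarrow> nat \<Rightarrow> 'v set set \<Rightarrow> bool" for V r where
  simplex: "F \<subseteq> V \<Longrightarrow> r \<le> card F \<Longrightarrow> vertex_decomposable V r (Pow F)"
| vertex: "v \<in> V \<Longrightarrow> down_closed \<Delta> \<Longrightarrow> vertex_decomposable V r {X. insert v X \<in> \<Delta>}
    \<Longrightarrow> vertex_decomposable V r {X \<in> \<Delta>. v \<notin> X} \<Longrightarrow> vertex_decomposable V r \<Delta>"

lemma esym_weakly_regular:
  assumes "vertex_decomposable V r \<Delta>" "finite V"
  shows "polys.weakly_regular V (sr_ideal V \<Delta> :: ('v, 'k::field) mpolynomial set) (map (esym V) [1..<Suc r])"
  using assms(1)
proof induction
  case (simplex F)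
  then show ?case
    by (intro esym_cong[OF assms(2) _ _ esym_weakly_regular_simplex[OF assms(2)]]) auto
next
  case (vertex v \<Delta>)
  show ?case
  proof (rule polys.weakly_regular_of_colon_adjoin)
    show "polys.is_ideal V (sr_ideal V \<Delta> :: ('v, 'k) mpolynomial set)" using vertex by (intro is_ideal_sr_ideal)
    show "var v \<in> polys V" using vertex by (intro var_closed)
    show "set (map (esym V) [1..<Suc r]) \<subseteq> polys V" using esym_closed[OF assms(2)] by auto
  qed (use vertex in \<open>simp_all only: colon_sr_ideal adjoin_sr_ideal\<close>)
qed

section \<open>Upper bounds by counting monomials\<close>

text \<open>Gaussian elimination: a homogeneous linear system with more unknowns than equations.\<close>

lemma homogeneous_system_nontrivial_solution:
  fixes M :: "'x \<Rightarrow> 'b \<Rightarrow> 'k::field"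
  assumes "finite B" "finite X" "card B < card X"
  shows "\<exists>c. (\<exists>x\<in>X. c x \<noteq> 0) \<and> (\<forall>b\<in>B. (\<Sum>x\<in>X. c x * M x b) = 0)"
  using assms
proof (induction B arbitrary: X M rule: finite_induct)
  case empty
  then obtain x where "x \<in> X" by fastforce
  then show ?case by (intro exI[of _ "\<lambda>_. 1"]) auto
next
  case (insert b B)
  show ?case
  proof (cases "\<exists>y\<in>X. M y b \<noteq> 0")
    case False
    have "\<exists>c. (\<exists>x\<in>X. c x \<noteq> 0) \<and> (\<forall>b\<in>B. (\<Sum>x\<in>X. c x * M x b) = 0)"
      using insert by (intro insert.IH) auto
    then show ?thesis using False by fastforce
  next
    case True
    then obtain y where y: "y \<in> X" "M y b \<noteq> 0" by blast
    define M' where "M' x b' = M x b' - M x b / M y b * M y b'" for x b'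
    have "\<exists>c. (\<exists>x\<in>X-{y}. c x \<noteq> 0) \<and> (\<forall>b\<in>B. (\<Sum>x\<in>X-{y}. c x * M' x b) = 0)"
      using insert y by (intro insert.IH) (auto simp: card_Diff_singleton)
    then obtain c where c: "\<exists>x\<in>X-{y}. c x \<noteq> 0" "\<And>b. b \<in> B \<Longrightarrow> (\<Sum>x\<in>X-{y}. c x * M' x b) = 0"
      by blast
    define c' where "c' = c(y := - (\<Sum>x\<in>X-{y}. c x * M x b) / M y b)"
    have eq: "(\<Sum>x\<in>X. c' x * M x b') = (\<Sum>x\<in>X-{y}. c x * M' x b')" for b'
    proof -
      have "(\<Sum>x\<in>X. c' x * M x b') = c' y * M y b' + (\<Sum>x\<in>X-{y}. c x * M x b')"
        using insert.prems y by (subst sum.remove[of _ y]) (auto simp: c'_def intro!: sum.cong)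
      also have "c' y * M y b' = - (\<Sum>x\<in>X-{y}. c x * (M x b / M y b * M y b'))"
        by (simp add: c'_def sum_distrib_right sum_distrib_left sum_divide_distrib mult.assoc flip: sum_negf)
      finally show ?thesis by (simp add: M'_def algebra_simps sum_subtractf)
    qed
    have "(\<Sum>x\<in>X. c' x * M x b) = 0" unfolding eq using y by (simp add: M'_def)
    moreover have "\<forall>b\<in>B. (\<Sum>x\<in>X. c' x * M x b) = 0" unfolding eq using c by blast
    moreover have "\<exists>x\<in>X. c' x \<noteq> 0" using c(1) by (auto simp: c'_def)
    ultimately show ?thesis by blast
  qed
qed

lemma card_bounded_monomials:
  assumes "finite X"
  shows "finite {m :: 'v \<Rightarrow>\<^sub>0 nat. keys m = X \<and> (\<forall>v. lookup m v \<le> D)}"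
    and "card {m :: 'v \<Rightarrow>\<^sub>0 nat. keys m = X \<and> (\<forall>v. lookup m v \<le> D)} \<le> (D + 1) ^ card X"
proof -
  let ?M = "{m :: 'v \<Rightarrow>\<^sub>0 nat. keys m = X \<and> (\<forall>v. lookup m v \<le> D)}"
  let ?g = "\<lambda>m. restrict (lookup m) X"
  have inj: "inj_on ?g ?M"
  proof (rule inj_onI, rule poly_mapping_eqI)
    fix m m' v assume m: "m \<in> ?M" "m' \<in> ?M" and eq: "?g m = ?g m'"
    show "lookup m v = lookup m' v"
    proof (cases "v \<in> X")
      case True
      then show ?thesis using fun_cong[OF eq, of v] by simp
    next
      case False
      then show ?thesis using m by (auto simp: in_keys_iff)
    qed
  qed
  have sub: "?g ` ?M \<subseteq> X \<rightarrow>\<^sub>E {..D}" by auto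
  have fin: "finite (X \<rightarrow>\<^sub>E {..D})" using assms by (intro finite_PiE) auto
  show "finite ?M" by (rule finite_imageD[OF finite_subset[OF sub fin] inj])
  have "card ?M \<le> card (X \<rightarrow>\<^sub>E {..D})" by (rule card_inj_on_le[OF inj sub fin])
  then show "card ?M \<le> (D + 1) ^ card X" using assms by (simp add: card_PiE)
qed

lemma degree_bound_mult:
  assumes "\<forall>m\<in>keys p. mdeg m \<le> a" "\<forall>m\<in>keys q. mdeg m \<le> b"
  shows "\<forall>m\<in>keys (p * q). mdeg m \<le> a + b"
  using assms by (auto simp: mdeg_add intro!: add_mono elim!: keys_multE)

lemma degree_bound_power:
  assumes "\<forall>m\<in>keys p. mdeg m \<le> a"
  shows "\<forall>m\<in>keys (p ^ k). mdeg m \<le> k * a"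
proof (induction k)
  case (Suc k)
  then show ?case using degree_bound_mult[OF assms Suc] by simp
qed simp

lemma degree_bound_monom:
  assumes "\<forall>f\<in>set fs. \<forall>m\<in>keys f. mdeg m \<le> E" "set a \<subseteq> {..d}" "length a = length fs"
  shows "\<forall>m\<in>keys (polys.monom fs a). mdeg m \<le> length fs * (d * E)"
  using assms
proof (induction fs arbitrary: a)
  case (Cons f fs)
  then obtain k a' where a: "a = k # a'" by (cases a) auto
  have *: "\<forall>m\<in>keys (f ^ k * polys.monom fs a'). mdeg m \<le> k * E + length fs * (d * E)"
    using Cons.prems a by (intro degree_bound_mult degree_bound_power Cons.IH) auto
  have "k * E \<le> d * E" using Cons.prems(2) a by simp
  then have "k * E + length fs * (d * E) \<le> length (f # fs) * (d * E)" by simp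
  then show ?case using * unfolding a polys.monom_simps by (meson order.trans)
qed simp

lemma exists_degree_bound:
  assumes "finite P"
  shows "\<exists>E. \<forall>p\<in>P. \<forall>m\<in>keys p. mdeg m \<le> E"
proof -
  have "finite (\<Union>p\<in>P. mdeg ` keys p)" using assms by simp
  then obtain E where "\<forall>n\<in>(\<Union>p\<in>P. mdeg ` keys p). n \<le> E"
    using finite_nat_set_iff_bounded_le by meson
  then show ?thesis by auto
qed

text \<open>With \<open>r\<close> the length of the chain, the \<open>(d+1)\<^sup>r\<close> products of \<open>u\<close> with monomials in the chain of exponents
  at most \<open>d\<close> have degree \<open>O(d)\<close>. A multiple of \<open>u\<close> lies in \<open>J\<close> as soon as its coefficients vanish at
  the exponent vectors supported on members of \<open>\<Gamma>\<close>, of which \<open>O(d\<^sup>s)\<close> have such a degree. If \<open>r\<close> were larger than \<open>s\<close>, linear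
  algebra would give a nontrivial combination of the products in \<open>J\<close>.\<close>

lemma length_regular_chain_le:
  fixes J :: "('v, 'k::field) mpolynomial set"
  assumes chain: "polys.regular_chain V J fs L" and J: "polys.is_ideal V J"
    and fs: "set fs \<subseteq> polys V" and u: "u \<in> polys V" "u \<notin> L"
    and \<Gamma>: "finite \<Gamma>" "\<And>X. X \<in> \<Gamma> \<Longrightarrow> finite X \<and> card X \<le> s"
    and mem: "\<And>p. p \<in> polys V \<Longrightarrow> \<forall>m\<in>keys (p * u). keys m \<notin> \<Gamma> \<Longrightarrow> p * u \<in> J"
  shows "length fs \<le> s"
proof (rule ccontr)
  assume "\<not> length fs \<le> s"
  define r where "r = length fs"
  have sr: "s < r" using \<open>\<not> length fs \<le> s\<close> by (simp add: r_def)
  obtain E where E: "\<forall>p\<in>insert u (set fs). \<forall>m\<in>keys p. mdeg m \<le> E"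
    using exists_degree_bound[of "insert u (set fs)"] by auto
  \<comment> \<open>the products have degree at most \<open>D\<close>, and \<open>d\<close> makes \<open>(d+1)\<^sup>r\<close> exceed \<open>|\<Gamma>| (D+1)\<^sup>s\<close> as soon as \<open>s < r\<close>\<close>
  define q where "q = (r + 1) * E"
  define d where "d = card \<Gamma> * (q + 1) ^ s"
  define D where "D = q * (d + 1)"
  define B where "B = (\<Union>X\<in>\<Gamma>. {m. keys m = X \<and> (\<forall>v. lookup m v \<le> D)})"
  define A where "A = {a. set a \<subseteq> {..d} \<and> length a = r}"
  define w where "w a = polys.monom fs a * u" for a
  have finB: "finite B" unfolding B_def using \<Gamma> card_bounded_monomials(1) by blast
  have finA: "finite A" unfolding A_def by (rule finite_lists_length_eq) simp
  have "card B \<le> (\<Sum>X\<in>\<Gamma>. (D + 1) ^ s)"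
    unfolding B_def
  proof (rule order.trans[OF card_UN_le[OF \<Gamma>(1)]], rule sum_mono)
    fix X assume X: "X \<in> \<Gamma>"
    have "(D + 1) ^ card X \<le> (D + 1) ^ s" using \<Gamma>(2)[OF X] by (intro power_increasing) auto
    then show "card {m. keys m = X \<and> (\<forall>v. lookup m v \<le> D)} \<le> (D + 1) ^ s"
      using card_bounded_monomials(2)[of X D] \<Gamma>(2)[OF X] by linarith
  qed
  also have "\<dots> \<le> card \<Gamma> * ((q + 1) * (d + 1)) ^ s"
    by (simp add: D_def power_mono)
  also have "\<dots> = d * (d + 1) ^ s" by (simp only: d_def power_mult_distrib mult.assoc)
  also have "\<dots> < (d + 1) ^ Suc s" by simp
  also have "\<dots> \<le> (d + 1) ^ r" using sr by (intro power_increasing) auto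
  also have "\<dots> = card A" unfolding A_def by (subst card_lists_length_eq) auto
  finally obtain c where c: "\<exists>a\<in>A. c a \<noteq> 0" "\<And>m. m \<in> B \<Longrightarrow> (\<Sum>a\<in>A. c a * lookup (w a) m) = 0"
    using homogeneous_system_nontrivial_solution[OF finB finA, of "\<lambda>a m. lookup (w a) m"] by blast
  define p where "p = (\<Sum>a\<in>A. single 0 (c a) * polys.monom fs a)"
  have cC: "single 0 k \<in> polys V" for k :: 'k by (simp add: polys_def)
  have pC: "p \<in> polys V" unfolding p_def by (intro polys.sum_closed polys.mult_closed cC polys.monom_closed fs)
  have pu: "p * u = (\<Sum>a\<in>A. single 0 (c a) * w a)"
    by (simp add: p_def w_def sum_distrib_right mult.assoc)
  have scal: "lookup (single 0 k * g) m = k * lookup g m"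
    for k :: 'k and g :: "('v, 'k) mpolynomial" and m
    using lookup_single_mult_plus[of 0 k g m] by simp
  have look: "lookup (p * u) m = (\<Sum>a\<in>A. c a * lookup (w a) m)" for m
    by (simp add: pu lookup_sum scal)
  have "keys m \<notin> \<Gamma>" if m: "m \<in> keys (p * u)" for m
  proof
    assume X: "keys m \<in> \<Gamma>"
    have "(\<Sum>a\<in>A. c a * lookup (w a) m) \<noteq> 0" using m look by (simp add: in_keys_iff)
    then obtain a where a: "a \<in> A" "lookup (w a) m \<noteq> 0"
      by (metis (no_types, lifting) mult_zero_right sum.neutral)
    have "\<forall>m\<in>keys (w a). mdeg m \<le> r * (d * E) + E"
      unfolding w_def r_def using a E by (intro degree_bound_mult degree_bound_monom) (auto simp: A_def r_def)
    then have "mdeg m \<le> r * (d * E) + E" using a by (simp add: in_keys_iff)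
    also have "\<dots> \<le> D" by (simp add: D_def q_def algebra_simps)
    finally have "m \<in> B" using X lookup_le_mdeg[of m] by (auto simp: B_def intro: order.trans)
    then show False using c(2) look m by (simp add: in_keys_iff)
  qed
  then have puJ: "p * u \<in> J" using mem pC by blast
  \<comment> \<open>nonzero scalars are units, as required of the coefficients of a relation\<close>
  define A' where "A' = {a \<in> A. c a \<noteq> 0}"
  have "A' = {}"
  proof (rule polys.regular_chain_lexicographic[OF chain J fs u, where c = "\<lambda>a. single 0 (c a)"])
    show "finite A'" using finA by (simp add: A'_def)
    show "\<And>a. a \<in> A' \<Longrightarrow> length a = length fs" by (auto simp: A'_def A_def r_def)
    show "single 0 (c a) \<in> polys V" for a by (rule cC)
    show "\<exists>d\<in>polys V. d * single 0 (c a) = 1" if "a \<in> A'" for a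
      using that by (intro bexI[of _ "single 0 (1 / c a)"] cC) (simp add: mult_single A'_def)
    have "(\<Sum>a\<in>A'. single 0 (c a) * polys.monom fs a * u) = p * u"
      unfolding pu w_def using finA by (intro sum.mono_neutral_cong_left) (auto simp: mult.assoc A'_def)
    then show "(\<Sum>a\<in>A'. single 0 (c a) * polys.monom fs a * u) \<in> J" using puJ by simp
  qed
  then show False using c(1) by (auto simp: A'_def)
qed

definition proper_prime :: "'v set \<Rightarrow> ('v, 'k::field) mpolynomial set \<Rightarrow> bool" where
  "proper_prime V P \<longleftrightarrow> polys.is_ideal V P \<and> 1 \<notin> P \<and>
     (\<forall>p\<in>polys V. \<forall>q\<in>polys V. p * q \<in> P \<longrightarrow> p \<in> P \<or> q \<in> P)"

text \<open>An element outside a prime ideal is a nonzerodivisor modulo it.\<close>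

lemma regular_chain_primes:
  assumes "\<forall>i\<le>r. proper_prime V (P i)" "\<forall>i<r. P i \<subset> P (Suc i)"
  shows "\<exists>fs. set fs \<subseteq> polys V \<and> length fs = r \<and> polys.regular_chain V (P 0) fs (P r)"
  using assms
proof (induction r arbitrary: P)
  case (Suc r)
  have "\<exists>fs. set fs \<subseteq> polys V \<and> length fs = r \<and> polys.regular_chain V (P (Suc 0)) fs (P (Suc r))"
    using Suc.IH[of "\<lambda>i. P (Suc i)"] Suc.prems by auto
  then obtain fs where fs: "set fs \<subseteq> polys V" "length fs = r" "polys.regular_chain V (P (Suc 0)) fs (P (Suc r))"
    by blast
  obtain f where f: "f \<in> P (Suc 0)" "f \<notin> P 0" using Suc.prems(2) by blast
  have id1: "polys.is_ideal V (P (Suc 0))" and pr0: "proper_prime V (P 0)"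
    using Suc.prems(1) by (auto simp: proper_prime_def)
  have fC: "f \<in> polys V" using polys.ideal_closed[OF id1 f(1)] .
  have "polys.nzd V (P 0) f" using pr0 f fC by (auto simp: proper_prime_def polys.nzd_def)
  moreover have "P 0 \<subseteq> P (Suc 0)" using Suc.prems(2) by blast
  ultimately show ?case
    using fs f fC id1 by (intro exI[of _ "f # fs"]) auto
qed (auto intro: exI[of _ "[]"])

lemma prime_chain_length_le:
  fixes P :: "nat \<Rightarrow> ('v, 'k::field) mpolynomial set"
  assumes primes: "\<forall>i\<le>r. proper_prime V (P i)" "\<forall>i<r. P i \<subset> P (Suc i)"
    and sub: "sr_ideal V \<Delta> \<subseteq> P 0"
    and \<Delta>: "finite \<Delta>" "\<And>X. X \<in> \<Delta> \<Longrightarrow> finite X \<and> card X \<le> s"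
  shows "r \<le> s"
proof -
  obtain fs where fs: "set fs \<subseteq> polys V" "length fs = r" "polys.regular_chain V (P 0) fs (P r)"
    using regular_chain_primes[OF primes] by blast
  have "length fs \<le> s"
  proof (rule length_regular_chain_le[OF fs(3) _ fs(1) _ _ \<Delta>])
    show "polys.is_ideal V (P 0)" "1 \<notin> P r" using primes(1) by (auto simp: proper_prime_def)
    show "p * 1 \<in> P 0" if "p \<in> polys V" "\<forall>m\<in>keys (p * 1). keys m \<notin> \<Delta>" for p
    proof -
      have "p \<in> sr_ideal V \<Delta>" using that by (simp add: sr_ideal_def)
      then show ?thesis using sub by auto
    qed
  qed (rule polys.one_closed)
  then show ?thesis using fs by simp
qed

lemma power_high_degree:
  assumes "lookup f 0 = 0" "m \<in> keys (f ^ t)"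
  shows "t \<le> mdeg m"
  using assms(2)
proof (induction t arbitrary: m)
  case (Suc t)
  then obtain a b where ab: "m = a + b" "a \<in> keys f" "b \<in> keys (f ^ t)"
    by (auto elim: keys_multE)
  then have "a \<noteq> 0" using assms(1) by (auto simp: in_keys_iff)
  then obtain v where "lookup a v \<noteq> 0" by (metis poly_mapping_eqI lookup_zero)
  then have "1 \<le> mdeg a" using lookup_le_mdeg[of a v] by simp
  then show ?case using Suc.IH[OF ab(3)] ab(1) by (simp add: mdeg_add)
qed simp

text \<open>The multiples of \<open>x\<^sup>S\<close> modulo the Stanley--Reisner ideal form a copy of the polynomial ring in the variables
  from \<open>S\<close>, because \<open>S\<close> is a facet. This gives the bound by \<open>length_regular_chain_le\<close> with \<open>u = x\<^sup>S\<close>,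
  provided \<open>x\<^sup>S\<close> avoids the ideal generated by the sequence. Replacing every member by its power with an exponent
  larger than \<open>|S|\<close> achieves this: members without constant term then only generate terms of degree larger
  than \<open>|S|\<close>.\<close>

lemma weakly_regular_length_le:
  fixes fs :: "('v, 'k::field) mpolynomial list"
  assumes \<Delta>: "down_closed \<Delta>" and S: "S \<in> \<Delta>" "finite S" "S \<subseteq> V" "\<And>X. X \<in> \<Delta> \<Longrightarrow> S \<subseteq> X \<Longrightarrow> X = S"
    and fs: "set fs \<subseteq> polys V" "\<And>f. f \<in> set fs \<Longrightarrow> lookup f 0 = 0"
    and w: "polys.weakly_regular V (sr_ideal V \<Delta>) fs"
  shows "length fs \<le> card S"
proof -
  define t where "t = Suc (card S)"
  define gs where "gs = map (\<lambda>f. f ^ t) fs"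
  have I: "polys.is_ideal V (sr_ideal V \<Delta> :: ('v, 'k) mpolynomial set)" by (rule is_ideal_sr_ideal[OF \<Delta>])
  have gs: "set gs \<subseteq> polys V" using fs(1) by (auto simp: gs_def intro: polys.power_closed)
  have chain: "polys.regular_chain V (sr_ideal V \<Delta>) gs (polys.adjoins V (sr_ideal V \<Delta>) gs)"
    unfolding gs_def by (rule polys.regular_chain_adjoins[OF I])
      (use gs in \<open>auto simp: gs_def t_def simp del: power_Suc intro: polys.weakly_regular_powers[OF I fs(1) w]\<close>)
  \<comment> \<open>an ideal that contains the powers and the Stanley--Reisner ideal, but not \<open>x\<^sup>S\<close>\<close>
  define K :: "('v, 'k) mpolynomial set" where "K = {p \<in> polys V. \<forall>m\<in>keys p. t \<le> mdeg m \<or> keys m \<notin> \<Delta>}"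
  have K: "polys.is_ideal V K"
  proof (rule polys.is_idealI)
    fix x y :: "('v, 'k) mpolynomial"
    show "x \<in> K \<Longrightarrow> y \<in> K \<Longrightarrow> x + y \<in> K"
      using Poly_Mapping.keys_add[of x y] by (auto simp: K_def intro: polys.closed)
    assume xy: "x \<in> polys V" "y \<in> K"
    have "t \<le> mdeg m \<or> keys m \<notin> \<Delta>" if m: "m \<in> keys (x * y)" for m
    proof -
      obtain a b where ab: "m = a + b" "b \<in> keys y" using m by (rule keys_multE)
      then have "t \<le> mdeg b \<or> keys b \<notin> \<Delta>" using xy by (auto simp: K_def)
      then show ?thesis using ab(1) \<Delta> by (auto simp: mdeg_add keys_plus_nat down_closed_def)
    qed
    then show "x * y \<in> K" using xy by (auto simp: K_def intro: polys.mult_closed)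
  qed (auto simp: K_def polys.closed)
  have "polys.adjoins V (sr_ideal V \<Delta>) gs \<subseteq> K"
  proof (rule polys.adjoins_least[OF K])
    show "sr_ideal V \<Delta> \<subseteq> K" by (auto simp: sr_ideal_def K_def)
    show "set gs \<subseteq> K" using gs power_high_degree[OF fs(2)] by (fastforce simp: gs_def K_def)
  qed
  moreover have "squarefree S \<notin> K"
    using S by (simp add: K_def squarefree_def mdeg_indicator_exp t_def)
  ultimately have nu: "squarefree S \<notin> polys.adjoins V (sr_ideal V \<Delta> :: ('v, 'k) mpolynomial set) gs" by blast
  have "length gs \<le> card S"
  proof (rule length_regular_chain_le[OF chain I gs squarefree_closed[OF S(2,3)] nu, of "{S}"])
    fix p :: "('v, 'k) mpolynomial"
    assume p: "p \<in> polys V" and k: "\<forall>m\<in>keys (p * squarefree S). keys m \<notin> {S}"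
    have "keys m \<notin> \<Delta>" if m: "m \<in> keys (p * squarefree S)" for m
    proof -
      obtain a b where "m = a + b" "b \<in> keys (squarefree S :: ('v, 'k) mpolynomial)"
        using m by (rule keys_multE)
      then have "S \<subseteq> keys m" using S(2) by (simp add: squarefree_def keys_plus_nat)
      then show ?thesis using S(4) k m by auto
    qed
    then show "p * squarefree S \<in> sr_ideal V \<Delta>"
      using p squarefree_closed[OF S(2,3)] by (auto simp: sr_ideal_def intro: polys.mult_closed)
  qed (use S in auto)
  then show ?thesis by (simp add: gs_def)
qed

section \<open>Quotient rings\<close>

lemma (in cring) nonzerodivisor_quotient_iff:
  assumes J: "ideal J R" and a: "a \<in> carrier R"
  shows "nonzerodivisor (R Quot J) (J +> a) \<longleftrightarrow> (\<forall>x\<in>carrier R. a \<otimes> x \<in> J \<longrightarrow> x \<in> J)"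
proof -
  have carr: "carrier (R Quot J) = (\<lambda>x. J +> x) ` carrier R"
    by (auto simp: FactRing_def A_RCOSETS_def')
  have zero: "J +> x = J \<longleftrightarrow> x \<in> J" if "x \<in> carrier R" for x
    using ideal.rcos_const_imp_mem[OF J that] a_rcos_zero[OF J] by blast
  have mult: "(J +> a) \<otimes>\<^bsub>R Quot J\<^esub> (J +> x) = J +> (a \<otimes> x)" if "x \<in> carrier R" for x
    using ideal.rcoset_mult_add[OF J a that] by (simp add: FactRing_def)
  have z: "\<zero>\<^bsub>R Quot J\<^esub> = J" by (simp add: FactRing_def)
  show ?thesis
    unfolding nonzerodivisor_def carr z using a by (auto simp: mult zero m_closed)
qed

lemma (in ring) mem_image_quotient_iff:
  assumes I: "ideal I R" and J: "ideal J R" "I \<subseteq> J" and p: "p \<in> carrier R"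
  shows "I +> p \<in> (+>) I ` J \<longleftrightarrow> p \<in> J"
proof -
  have "\<Union> ((+>) I ` J) = J" using ideal_incl_iff[OF I J(1)] J(2) by simp
  moreover have "(+>) I ` J \<subseteq> carrier (R Quot I)"
    using additive_subgroup.a_subset[OF ideal.axioms(1)[OF J(1)]]
    by (auto simp: FactRing_def A_RCOSETS_def')
  ultimately show ?thesis using canonical_proj_vimage_mem_iff[OF I _ p] by metis
qed

text \<open>Ideals of \<open>R/I\<close> correspond to ideals of \<open>R\<close> above \<open>I\<close>; the generated ideal is the least one on
  either side.\<close>

lemma (in ring) genideal_quotient:
  assumes I: "ideal I R" and S: "S \<subseteq> carrier R"
  shows "genideal (R Quot I) ((+>) I ` S) = (+>) I ` genideal R (I \<union> S)"
proof
  interpret A: ring "R Quot I" by (rule ideal.quotient_is_ring[OF I])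
  have IC: "I \<subseteq> carrier R" by (rule additive_subgroup.a_subset[OF ideal.axioms(1)[OF I]])
  have IS: "I \<union> S \<subseteq> carrier R" using IC S by blast
  note G = genideal_ideal[OF IS] genideal_self[OF IS]
  have SA: "(+>) I ` S \<subseteq> carrier (R Quot I)" using S by (auto simp: FactRing_def A_RCOSETS_def')
  show "genideal (R Quot I) ((+>) I ` S) \<subseteq> (+>) I ` genideal R (I \<union> S)"
    using G ring_ideal_imp_quot_ideal[OF I G(1)] by (intro A.genideal_minimal) auto
  let ?K = "genideal (R Quot I) ((+>) I ` S)"
  have K: "ideal ?K (R Quot I)" by (rule A.genideal_ideal[OF SA])
  have KS: "?K \<subseteq> carrier (R Quot I)" by (rule additive_subgroup.a_subset[OF ideal.axioms(1)[OF K]])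
  have "p \<in> \<Union> ?K" if "p \<in> I \<union> S" for p
  proof -
    have "I +> p \<in> ?K"
    proof (cases "p \<in> I")
      case True
      then have "I +> p = \<zero>\<^bsub>R Quot I\<^esub>" using a_rcos_zero[OF I] by (simp add: FactRing_def)
      then show ?thesis using additive_subgroup.zero_closed[OF ideal.axioms(1)[OF K]] by simp
    next
      case False
      then show ?thesis using that A.genideal_self[OF SA] by auto
    qed
    then show ?thesis using canonical_proj_vimage_mem_iff[OF I KS] that IC S by blast
  qed
  then have "genideal R (I \<union> S) \<subseteq> \<Union> ?K"
    by (intro genideal_minimal quot_ideal_imp_ring_ideal[OF I K]) auto
  moreover have "(+>) I ` \<Union> ?K \<subseteq> ?K"
    using canonical_proj_vimage_mem_iff[OF I KS] canonical_proj_vimage_in_carrier[OF I KS] by auto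
  ultimately show "(+>) I ` genideal R (I \<union> S) \<subseteq> ?K" by blast
qed

lemma (in unital_subring) weakly_regular_iff_nth:
  "weakly_regular J fs \<longleftrightarrow> (\<forall>i<length fs. nzd (adjoins J (take i fs)) (fs ! i))"
proof (induction fs arbitrary: J)
  case (Cons f fs)
  show ?case unfolding weakly_regular.simps Cons.IH by (simp add: All_less_Suc2)
qed simp

section \<open>Generated ideals of polynomial rings\<close>

lemma mpoly_ring_simps:
  "mult (mpoly_ring V) p q = p * q" "add (mpoly_ring V) p q = p + q"
  "zero (mpoly_ring V) = 0" "one (mpoly_ring V) = 1"
  by (simp_all add: mpoly_ring_def)

lemma ideal_mpoly_ring_iff: "ideal J (mpoly_ring V) \<longleftrightarrow> polys.is_ideal V J"
  for J :: "('v, 'k::field) mpolynomial set"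
proof
  interpret R: cring "mpoly_ring V :: ('v, 'k) mpolynomial ring" by (rule cring_mpoly_ring)
  assume J: "ideal J (mpoly_ring V)"
  interpret J: ideal J "mpoly_ring V" by (rule J)
  show "polys.is_ideal V J"
    using J.a_subset J.zero_closed J.a_closed J.I_l_closed
    by (intro polys.is_idealI) (auto simp: carrier_mpoly_ring mpoly_ring_simps)
next
  interpret R: cring "mpoly_ring V :: ('v, 'k) mpolynomial ring" by (rule cring_mpoly_ring)
  assume J: "polys.is_ideal V J"
  show "ideal J (mpoly_ring V)"
  proof (rule idealI[OF R.ring_axioms])
    show "subgroup J (add_monoid (mpoly_ring V))"
    proof (rule R.add.subgroupI)
      show "J \<subseteq> carrier (mpoly_ring V)" using polys.ideal_closed[OF J] by (auto simp: carrier_mpoly_ring)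
      show "J \<noteq> {}" using polys.ideal_zero[OF J] by blast
      fix a assume a: "a \<in> J"
      have aC: "a \<in> carrier (mpoly_ring V)" "- a \<in> carrier (mpoly_ring V)"
        using polys.ideal_closed[OF J a] by (auto simp: carrier_mpoly_ring polys.uminus_closed)
      have "- a \<oplus>\<^bsub>mpoly_ring V\<^esub> a = \<zero>\<^bsub>mpoly_ring V\<^esub>" by (simp add: mpoly_ring_simps)
      then have "\<ominus>\<^bsub>mpoly_ring V\<^esub> a = - a" using aC by (rule R.minus_equality)
      then show "\<ominus>\<^bsub>mpoly_ring V\<^esub> a \<in> J"
        using polys.ideal_diff[OF J polys.ideal_zero[OF J] a] by simp
    qed (auto simp: mpoly_ring_simps intro: polys.ideal_add[OF J])
  next
    fix a x :: "('v, 'k) mpolynomial" assume "a \<in> J" "x \<in> carrier (mpoly_ring V)"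
    then have "x * a \<in> J" by (simp add: carrier_mpoly_ring polys.ideal_mult[OF J])
    then show "x \<otimes>\<^bsub>mpoly_ring V\<^esub> a \<in> J" "a \<otimes>\<^bsub>mpoly_ring V\<^esub> x \<in> J"
      by (simp_all add: mpoly_ring_simps mult.commute)
  qed
qed

lemma genideal_adjoins:
  fixes J :: "('v, 'k::field) mpolynomial set"
  assumes J: "polys.is_ideal V J" and fs: "set fs \<subseteq> polys V"
  shows "genideal (mpoly_ring V) (J \<union> set fs) = polys.adjoins V J fs"
proof
  interpret R: cring "mpoly_ring V :: ('v, 'k) mpolynomial ring" by (rule cring_mpoly_ring)
  have sub: "J \<union> set fs \<subseteq> carrier (mpoly_ring V)"
    using polys.ideal_closed[OF J] fs by (auto simp: carrier_mpoly_ring)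
  show "genideal (mpoly_ring V) (J \<union> set fs) \<subseteq> polys.adjoins V J fs"
    using polys.is_ideal_adjoins[OF J fs] polys.subset_adjoins polys.set_subset_adjoins[OF J fs]
    by (intro R.genideal_minimal) (auto simp: ideal_mpoly_ring_iff)
  show "polys.adjoins V J fs \<subseteq> genideal (mpoly_ring V) (J \<union> set fs)"
    using R.genideal_ideal[OF sub] R.genideal_self[OF sub]
    by (intro polys.adjoins_least) (auto simp: ideal_mpoly_ring_iff)
qed

text \<open>Both the edge ideal and the ideal of all variables are of this form.\<close>

lemma genideal_squarefree:
  fixes N :: "'v set set"
  assumes N: "\<And>Y. Y \<in> N \<Longrightarrow> finite Y \<and> Y \<subseteq> V"
  shows "genideal (mpoly_ring V) (squarefree ` N) = (sr_ideal V {X. \<forall>Y\<in>N. \<not> Y \<subseteq> X} :: ('v, 'k::field) mpolynomial set)"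
    (is "?G = ?I")
proof
  interpret R: cring "mpoly_ring V :: ('v, 'k) mpolynomial ring" by (rule cring_mpoly_ring)
  have sub: "squarefree ` N \<subseteq> carrier (mpoly_ring V :: ('v, 'k) mpolynomial ring)"
    using N by (auto simp: carrier_mpoly_ring intro!: squarefree_closed)
  have "polys.is_ideal V ?I" by (rule is_ideal_sr_ideal) (auto simp: down_closed_def)
  moreover have "squarefree ` N \<subseteq> ?I"
  proof (rule image_subsetI)
    fix Y assume Y: "Y \<in> N"
    then show "squarefree Y \<in> ?I"
      using N[OF Y] squarefree_closed[of Y V] by (simp add: sr_ideal_def) (auto simp: squarefree_def)
  qed
  ultimately show "?G \<subseteq> ?I" by (intro R.genideal_minimal) (auto simp: ideal_mpoly_ring_iff)
  have G: "polys.is_ideal V ?G" using R.genideal_ideal[OF sub] by (simp add: ideal_mpoly_ring_iff)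
  show "?I \<subseteq> ?G"
  proof
    fix p :: "('v, 'k) mpolynomial" assume p: "p \<in> ?I"
    show "p \<in> ?G"
    proof (rule ideal_memI_terms[OF G])
      fix m assume m: "m \<in> keys p"
      let ?c = "lookup p m"
      obtain Y where Y: "Y \<in> N" "Y \<subseteq> keys m" using p m by (auto simp: sr_ideal_def)
      \<comment> \<open>the truncated subtraction is exact, as \<open>Y\<close> is contained in the support of \<open>m\<close>\<close>
      define m' where "m' = m - indicator_exp Y"
      have mm': "m = m' + indicator_exp Y"
        unfolding m'_def using Y N
        by (intro poly_mapping_eqI)
          (auto simp: lookup_add minus_poly_mapping.rep_eq lookup_indicator_exp when_def in_keys_iff Suc_le_eq)
      have "keys m \<subseteq> V" using p m by (auto simp: sr_ideal_def polys_def)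
      then have "keys m' \<subseteq> V" using mm' keys_plus_nat[of m' "indicator_exp Y"] by simp
      then have "single m' ?c \<in> polys V" by (auto simp: polys_def split: if_splits)
      moreover have "squarefree Y \<in> ?G" using R.genideal_self[OF sub] Y by blast
      moreover have "single m ?c = single m' ?c * squarefree Y"
        by (subst mm') (simp add: squarefree_def mult_single)
      ultimately show "single m ?c \<in> ?G" using polys.ideal_mult[OF G] by metis
    qed
  qed
qed

definition independent_sets :: "'v set \<Rightarrow> 'v set set \<Rightarrow> 'v set set" where
  "independent_sets V E = {X. X \<subseteq> V \<and> (\<forall>e\<in>E. \<not> e \<subseteq> X)}"

lemma down_closed_independent_sets: "down_closed (independent_sets V E)"
  by (force simp: down_closed_def independent_sets_def)

lemma sr_ideal_cong:
  assumes "\<And>X. X \<subseteq> V \<Longrightarrow> X \<in> \<Delta> \<longleftrightarrow> X \<in> \<Delta>'"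
  shows "sr_ideal V \<Delta> = sr_ideal V \<Delta>'"
  using assms by (auto simp: sr_ideal_def polys_def)

text \<open>The generators of the edge ideal are the squarefree monomials of the edges: the two ends of an edge
  differ, so the product of their variables is squarefree.\<close>

lemma edge_ideal_eq:
  assumes E: "simple_graph V E"
  shows "edge_ideal V E = (sr_ideal V (independent_sets V E) :: ('v, 'k::field) mpolynomial set)"
proof -
  have "{var i * var j | i j. {i, j} \<in> E} = (squarefree ` E :: ('v, 'k) mpolynomial set)"
  proof (intro equalityI subsetI)
    fix p :: "('v, 'k) mpolynomial" assume "p \<in> squarefree ` E"
    then obtain e where e: "e \<in> E" "p = squarefree e" by blast
    then obtain i j where "e = {i, j}" "i \<noteq> j" using E by (auto simp: simple_graph_def card_2_iff)
    then show "p \<in> {var i * var j | i j. {i, j} \<in> E}" using e by (auto simp: squarefree_prod)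
  next
    fix p :: "('v, 'k) mpolynomial" assume "p \<in> {var i * var j | i j. {i, j} \<in> E}"
    then obtain i j where ij: "{i, j} \<in> E" "p = var i * var j" by blast
    then have "i \<noteq> j" using E by (auto simp: simple_graph_def)
    then have "p = squarefree {i, j}" using ij by (simp add: squarefree_prod)
    then show "p \<in> squarefree ` E" using ij by blast
  qed
  moreover have "finite e \<and> e \<subseteq> V" if "e \<in> E" for e
    using E that by (auto simp: simple_graph_def intro: finite_subset)
  ultimately have "edge_ideal V E = (sr_ideal V {X. \<forall>Y\<in>E. \<not> Y \<subseteq> X} :: ('v, 'k) mpolynomial set)"
    unfolding edge_ideal_def by (simp only: genideal_squarefree)
  also have "\<dots> = sr_ideal V (independent_sets V E)"
    by (rule sr_ideal_cong) (auto simp: independent_sets_def)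
  finally show ?thesis .
qed

lemma genideal_vars:
  "genideal (mpoly_ring V) (var ` V) = ({p \<in> polys V. lookup p 0 = 0} :: ('v, 'k::field) mpolynomial set)"
proof -
  have "(var ` V :: ('v, 'k) mpolynomial set) = squarefree ` ((\<lambda>v. {v}) ` V)"
    by (simp add: image_image squarefree_prod)
  then have "genideal (mpoly_ring V) (var ` V :: ('v, 'k) mpolynomial set) = sr_ideal V {X. \<forall>Y\<in>(\<lambda>v. {v}) ` V. \<not> Y \<subseteq> X}"
    by (simp only:) (rule genideal_squarefree, auto)
  also have "\<dots> = sr_ideal V {{}}" by (rule sr_ideal_cong) auto
  also have "\<dots> = {p \<in> polys V. lookup p 0 = 0}"
    by (auto simp: sr_ideal_def in_keys_iff)
  finally show ?thesis .
qed

section \<open>Depth and dimension of edge rings\<close>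

text \<open>The linear order on the variables makes the ring of polynomials an integral domain as a type-class
  instance, and the parameter \<open>K\<close> fixes the coefficient field.\<close>

context
  fixes V :: "'v::linorder set" and E :: "'v set set" and K :: "'k::field itself"
  assumes graph: "simple_graph V E"
begin

private abbreviation "R \<equiv> mpoly_ring V :: ('v, 'k) mpolynomial ring"
private abbreviation "I \<equiv> sr_ideal V (independent_sets V E) :: ('v, 'k) mpolynomial set"
private abbreviation "A \<equiv> edge_ring V E :: ('v, 'k) mpolynomial set ring"
private abbreviation "cls \<equiv> a_r_coset R I"

interpretation R: cring R by (rule cring_mpoly_ring)

private lemma A_eq: "A = R Quot I"
  by (simp add: edge_ring_def edge_ideal_eq[OF graph])

private lemma I: "polys.is_ideal V I" "ideal I R"
  using is_ideal_sr_ideal[OF down_closed_independent_sets] by (auto simp: ideal_mpoly_ring_iff)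

interpretation A: cring A
  unfolding A_eq by (rule ideal.quotient_is_cring[OF I(2) R.is_cring])

private lemma carrier_A: "carrier A = cls ` polys V"
  by (auto simp: A_eq FactRing_def A_RCOSETS_def' carrier_mpoly_ring)

private lemma cls_mult: "p \<in> polys V \<Longrightarrow> q \<in> polys V \<Longrightarrow> cls p \<otimes>\<^bsub>A\<^esub> cls q = cls (p * q)"
  using ideal.rcoset_mult_add[OF I(2), of p q]
  by (simp add: A_eq FactRing_def carrier_mpoly_ring mpoly_ring_simps)

private lemma cls_mem_iff:
  "polys.is_ideal V J \<Longrightarrow> I \<subseteq> J \<Longrightarrow> p \<in> polys V \<Longrightarrow> cls p \<in> cls ` J \<longleftrightarrow> p \<in> J"
  using R.mem_image_quotient_iff[OF I(2)] by (simp add: ideal_mpoly_ring_iff carrier_mpoly_ring)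

private lemma genideal_A:
  assumes "set fs \<subseteq> polys V"
  shows "genideal A (cls ` set fs) = cls ` polys.adjoins V I fs"
  using R.genideal_quotient[OF I(2), of "set fs"] assms genideal_adjoins[OF I(1) assms]
  by (simp add: A_eq carrier_mpoly_ring)

private lemma regular_sequence_iff:
  assumes fs: "set fs \<subseteq> polys V"
  shows "regular_sequence A (map cls fs) \<longleftrightarrow> polys.weakly_regular V I fs \<and> 1 \<notin> polys.adjoins V I fs"
proof -
  have adj: "polys.is_ideal V (polys.adjoins V I gs)" "I \<subseteq> polys.adjoins V I gs" if "set gs \<subseteq> polys V" for gs
    using that polys.is_ideal_adjoins[OF I(1)] polys.subset_adjoins by blast+
  have nz: "nonzerodivisor (A Quot genideal A (set (take i (map cls fs))))
        (genideal A (set (take i (map cls fs))) +>\<^bsub>A\<^esub> (map cls fs ! i))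
      \<longleftrightarrow> polys.nzd V (polys.adjoins V I (take i fs)) (fs ! i)" if i: "i < length fs" for i
  proof -
    have t: "set (take i fs) \<subseteq> polys V" using fs set_take_subset[of i fs] by blast
    have fi: "fs ! i \<in> polys V" using fs i by auto
    have g: "genideal A (set (take i (map cls fs))) = cls ` polys.adjoins V I (take i fs)"
      using genideal_A[OF t] by (simp add: take_map)
    have id: "ideal (cls ` polys.adjoins V I (take i fs)) A"
      unfolding g[symmetric] using fs by (intro A.genideal_ideal) (auto simp: carrier_A dest!: in_set_takeD intro!: imageI)
    show ?thesis
      unfolding g using i fi A.nonzerodivisor_quotient_iff[OF id, of "cls (fs ! i)"]
      by (auto simp: carrier_A polys.nzd_def cls_mult cls_mem_iff[OF adj[OF t]] polys.mult_closed)
  qed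
  have "genideal A (set (map cls fs)) \<noteq> carrier A \<longleftrightarrow> 1 \<notin> polys.adjoins V I fs"
  proof
    assume "genideal A (set (map cls fs)) \<noteq> carrier A"
    then have ne: "polys.adjoins V I fs \<noteq> polys V" using genideal_A[OF fs] by (auto simp: carrier_A)
    show "1 \<notin> polys.adjoins V I fs"
    proof
      assume one: "1 \<in> polys.adjoins V I fs"
      have "p \<in> polys.adjoins V I fs" if "p \<in> polys V" for p
        using polys.ideal_mult[OF adj(1)[OF fs] that one] by simp
      then show False using ne polys.ideal_closed[OF adj(1)[OF fs]] by blast
    qed
  next
    assume "1 \<notin> polys.adjoins V I fs"
    then have "cls 1 \<notin> genideal A (set (map cls fs))"
      using cls_mem_iff[OF adj[OF fs] polys.one_closed] genideal_A[OF fs] by simp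
    then show "genideal A (set (map cls fs)) \<noteq> carrier A"
      using polys.one_closed by (auto simp: carrier_A)
  qed
  moreover have "set (map cls fs) \<subseteq> carrier A" using fs by (auto simp: carrier_A)
  ultimately show ?thesis
    unfolding regular_sequence_def polys.weakly_regular_iff_nth Let_def using nz by auto
qed

private lemma max_ideal_eq:
  "edge_ring_max_ideal V E = cls ` {p \<in> polys V. lookup p 0 = 0}"
  by (simp add: edge_ring_max_ideal_def genideal_vars edge_ideal_eq[OF graph])

private lemma finV: "finite V" using graph by (simp add: simple_graph_def)

lemma depth_edge_ring_le:
  assumes S: "S \<in> independent_sets V E" "\<And>X. X \<in> independent_sets V E \<Longrightarrow> S \<subseteq> X \<Longrightarrow> X = S"
  shows "depth A (edge_ring_max_ideal V E) \<le> enat (card S)"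
  unfolding depth_def
proof (rule SUP_least)
  fix as assume "as \<in> {as. regular_sequence A as \<and> set as \<subseteq> edge_ring_max_ideal V E}"
  then have as: "regular_sequence A as" "set as \<subseteq> cls ` {p \<in> polys V. lookup p 0 = 0}"
    by (auto simp: max_ideal_eq)
  have "\<exists>fs. as = map cls fs \<and> set fs \<subseteq> {p \<in> polys V. lookup p 0 = 0}"
    using as(2)
  proof (induction as)
    case (Cons a as)
    then obtain fs p where "as = map cls fs" "set fs \<subseteq> {p \<in> polys V. lookup p 0 = 0}"
        "p \<in> {p \<in> polys V. lookup p 0 = 0}" "a = cls p"
      by auto
    then show ?case by (intro exI[of _ "p # fs"]) simp
  qed simp
  then obtain fs where fs: "as = map cls fs" "set fs \<subseteq> {p \<in> polys V. lookup p 0 = 0}" by blast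
  have fsC: "set fs \<subseteq> polys V" using fs(2) by blast
  have SV: "S \<subseteq> V" using S(1) by (simp add: independent_sets_def)
  have "length fs \<le> card S"
  proof (rule weakly_regular_length_le[OF down_closed_independent_sets S(1) finite_subset[OF SV finV] SV S(2) fsC])
    show "polys.weakly_regular V I fs" using regular_sequence_iff[OF fsC] as(1) fs(1) by simp
  qed (use fs(2) in auto)
  then show "enat (length as) \<le> enat (card S)" by (simp add: fs(1))
qed

text \<open>The elementary symmetric polynomials of degrees \<open>1, \<dots>, r\<close> in all variables are a regular sequence in
  the maximal ideal.\<close>

lemma depth_edge_ring_ge:
  assumes "vertex_decomposable V r (independent_sets V E)"
  shows "enat r \<le> depth A (edge_ring_max_ideal V E)"
proof -
  let ?fs = "map (esym V) [1..<Suc r] :: ('v, 'k) mpolynomial list"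
  let ?M = "{p \<in> polys V. lookup p 0 = 0} :: ('v, 'k) mpolynomial set"
  have low: "lookup (esym V k :: ('v, 'k) mpolynomial) 0 = 0" if "k \<ge> 1" for k
    using homogeneous_esym[OF finV, of k] that by (force simp: homogeneous_poly_def in_keys_iff)
  have fs: "set ?fs \<subseteq> polys V" using esym_closed[OF finV order.refl] by auto
  have fsM: "set ?fs \<subseteq> ?M" using fs low by auto
  have M: "polys.is_ideal V ?M"
  proof -
    have "ideal (genideal R (var ` V)) R"
      by (rule R.genideal_ideal) (auto simp: carrier_mpoly_ring var_closed)
    then show ?thesis by (simp add: genideal_vars ideal_mpoly_ring_iff)
  qed
  have "polys.weakly_regular V I ?fs" by (rule esym_weakly_regular[OF assms finV])
  moreover have "1 \<notin> polys.adjoins V I ?fs"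
  proof
    assume one: "1 \<in> polys.adjoins V I ?fs"
    show False
    proof (cases "I \<subseteq> ?M")
      case True
      then have "polys.adjoins V I ?fs \<subseteq> ?M" using fsM by (intro polys.adjoins_least[OF M])
      then show False using one by auto
    next
      case False
      then obtain p where "p \<in> I" "lookup p 0 \<noteq> 0" by (auto simp: sr_ideal_def)
      then have "{} \<notin> independent_sets V E" by (force simp: sr_ideal_def in_keys_iff)
      then show False using graph by (auto simp: independent_sets_def simple_graph_def)
    qed
  qed
  ultimately have "regular_sequence A (map cls ?fs)" using regular_sequence_iff[OF fs] by simp
  moreover have "set (map cls ?fs) \<subseteq> edge_ring_max_ideal V E" using fsM by (auto simp: max_ideal_eq)
  ultimately have "enat (length (map cls ?fs)) \<le> depth A (edge_ring_max_ideal V E)"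
    unfolding depth_def by (intro SUP_upper) blast
  then show ?thesis by (simp del: upt_Suc)
qed

private lemma prime_preimage:
  assumes P: "primeideal P A"
  shows "proper_prime V (\<Union> P)" "I \<subseteq> \<Union> P" "cls ` \<Union> P = P"
proof -
  interpret P: primeideal P A by (rule P)
  have Pid: "ideal P (R Quot I)" using P.ideal_axioms by (simp add: A_eq)
  have PA: "P \<subseteq> carrier (R Quot I)" using P.a_subset by (simp add: A_eq)
  have mem: "p \<in> \<Union> P \<longleftrightarrow> cls p \<in> P" if "p \<in> polys V" for p
    using R.canonical_proj_vimage_mem_iff[OF I(2) PA] that by (simp add: carrier_mpoly_ring)
  have id: "polys.is_ideal V (\<Union> P)"
    using R.quot_ideal_imp_ring_ideal[OF I(2) Pid] by (simp add: ideal_mpoly_ring_iff)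
  show "I \<subseteq> \<Union> P"
    using P.zero_closed by (auto simp: A_eq FactRing_def)
  show "cls ` \<Union> P = P"
  proof (intro equalityI subsetI)
    fix x assume x: "x \<in> P"
    then obtain p where p: "p \<in> polys V" "x = cls p" using P.a_subset by (auto simp: carrier_A)
    then have "p \<in> \<Union> P" using mem x by blast
    then show "x \<in> cls ` \<Union> P" using p by blast
  qed (use mem polys.ideal_closed[OF id] in blast)
  have "1 \<notin> \<Union> P"
  proof
    assume "1 \<in> \<Union> P"
    then have "cls 1 \<in> P" using mem[OF polys.one_closed] by blast
    then have "\<one>\<^bsub>A\<^esub> \<in> P" by (simp add: A_eq FactRing_def mpoly_ring_simps)
    then show False using P.one_imp_carrier P.I_notcarr by blast
  qed
  moreover have "p \<in> \<Union> P \<or> q \<in> \<Union> P" if pq: "p \<in> polys V" "q \<in> polys V" "p * q \<in> \<Union> P" for p q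
  proof -
    have "cls (p * q) \<in> P" using pq(3) mem[OF polys.mult_closed[OF pq(1,2)]] by (simp only:)
    then have "cls p \<otimes>\<^bsub>A\<^esub> cls q \<in> P" using pq by (simp only: cls_mult)
    then have "cls p \<in> P \<or> cls q \<in> P" using pq by (intro P.I_prime) (auto simp: carrier_A)
    then show ?thesis using mem pq by blast
  qed
  ultimately show "proper_prime V (\<Union> P)" using id by (simp add: proper_prime_def)
qed

private lemma prime_image:
  assumes Q: "proper_prime V Q" "I \<subseteq> Q"
  shows "primeideal (cls ` Q) A"
proof (rule primeidealI)
  have id: "polys.is_ideal V Q" using Q by (simp add: proper_prime_def)
  show "ideal (cls ` Q) A"
    using R.ring_ideal_imp_quot_ideal[OF I(2)] id by (simp add: A_eq ideal_mpoly_ring_iff)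
  show "cring A" by (rule A.is_cring)
  have "cls 1 \<notin> cls ` Q" using cls_mem_iff[OF id Q(2) polys.one_closed] Q(1) by (simp add: proper_prime_def)
  then show "carrier A \<noteq> cls ` Q" using polys.one_closed by (auto simp: carrier_A)
  fix a b assume "a \<in> carrier A" "b \<in> carrier A" and ab: "a \<otimes>\<^bsub>A\<^esub> b \<in> cls ` Q"
  then obtain p q where pq: "p \<in> polys V" "q \<in> polys V" "a = cls p" "b = cls q" by (auto simp: carrier_A)
  then have "p * q \<in> Q" using ab cls_mem_iff[OF id Q(2)] by (simp add: cls_mult polys.mult_closed)
  then have "p \<in> Q \<or> q \<in> Q" using Q(1) pq by (auto simp: proper_prime_def)
  then show "a \<in> cls ` Q \<or> b \<in> cls ` Q" using pq by blast
qed

text \<open>The primes generated by the variables outside \<open>S\<close> and a growing initial part of \<open>S\<close> form a chain of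
  length \<open>|S|\<close>; the primes of the edge ring correspond to primes above the edge ideal, whose chains are
  bounded by counting.\<close>

lemma krull_dim_edge_ring:
  assumes S: "S \<in> independent_sets V E" and max: "\<And>X. X \<in> independent_sets V E \<Longrightarrow> card X \<le> card S"
  shows "krull_dim A = enat (card S)"
  unfolding krull_dim_def
proof (rule antisym)
  show "(SUP r\<in>{r. \<exists>P. (\<forall>i\<le>r. primeideal (P i) A) \<and> (\<forall>i<r. P i \<subset> P (Suc i))}. enat r) \<le> enat (card S)"
  proof (rule SUP_least)
    fix r assume "r \<in> {r. \<exists>P. (\<forall>i\<le>r. primeideal (P i) A) \<and> (\<forall>i<r. P i \<subset> P (Suc i))}"
    then obtain P where P: "\<forall>i\<le>r. primeideal (P i) A" "\<forall>i<r. P i \<subset> P (Suc i)" by blast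
    have "r \<le> card S"
    proof (rule prime_chain_length_le)
      show "\<forall>i\<le>r. proper_prime V (\<Union> (P i))" using P(1) prime_preimage(1) by blast
      show "\<forall>i<r. \<Union> (P i) \<subset> \<Union> (P (Suc i))"
      proof (intro allI impI)
        fix i assume i: "i < r"
        have "cls ` \<Union> (P i) = P i" "cls ` \<Union> (P (Suc i)) = P (Suc i)"
          using P(1) i by (intro prime_preimage(3); simp)+
        then show "\<Union> (P i) \<subset> \<Union> (P (Suc i))" using P(2) i by (metis Union_mono psubset_eq)
      qed
      show "I \<subseteq> \<Union> (P 0)" using P(1) prime_preimage(2) by blast
      show "finite (independent_sets V E)"
        using finV by (auto simp: independent_sets_def intro: finite_subset[of _ "Pow V"])
      show "finite X \<and> card X \<le> card S" if "X \<in> independent_sets V E" for X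
        using max[OF that] that finV by (auto simp: independent_sets_def intro: finite_subset)
    qed
    then show "enat r \<le> enat (card S)" by simp
  qed
  have SV: "S \<subseteq> V" using S by (simp add: independent_sets_def)
  have fS: "finite S" using SV finV finite_subset by blast
  obtain xs where xs: "set xs = S" "distinct xs" using finite_distinct_list[OF fS] by blast
  have len: "length xs = card S" using xs distinct_card by metis
  define Q where "Q i = (sr_ideal V (Pow (set (drop i xs))) :: ('v, 'k) mpolynomial set)" for i
  have QI: "I \<subseteq> Q i" for i
    using S down_closed_independent_sets[of V E] set_drop_subset[of i xs] xs(1)
    by (fastforce simp: Q_def sr_ideal_def down_closed_def)
  have Qp: "proper_prime V (Q i)" for i
    unfolding proper_prime_def
  proof (intro conjI ballI impI)
    show "polys.is_ideal V (Q i)" unfolding Q_def by (rule is_ideal_sr_ideal[OF down_closed_Pow])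
    show "1 \<notin> Q i" by (simp add: Q_def sr_ideal_def)
    show "p \<in> Q i \<or> q \<in> Q i" if "p \<in> polys V" "q \<in> polys V" "p * q \<in> Q i" for p q
      using that sr_ideal_simplex_prime unfolding Q_def by blast
  qed
  have Qs: "Q i \<subseteq> Q (Suc i)" for i
    using set_drop_subset_set_drop[of i "Suc i" xs] by (auto simp: Q_def sr_ideal_def)
  have Qne: "cls ` Q i \<subset> cls ` Q (Suc i)" if i: "i < card S" for i
  proof -
    have x: "xs ! i \<in> V" using i len xs(1) SV by (metis nth_mem subsetD)
    have d: "drop i xs = xs ! i # drop (Suc i) xs" using i len by (simp add: Cons_nth_drop_Suc)
    have "xs ! i \<notin> set (drop (Suc i) xs)"
      using distinct_drop[OF xs(2), of i] unfolding d by simp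
    then have "var (xs ! i) \<in> Q (Suc i)"
      using var_closed[OF x] by (simp add: Q_def sr_ideal_def) (simp add: var_def)
    moreover have "var (xs ! i) \<notin> Q i"
      unfolding Q_def d by (simp add: sr_ideal_def var_def)
    ultimately have "cls (var (xs ! i)) \<in> cls ` Q (Suc i)" "cls (var (xs ! i)) \<notin> cls ` Q i"
      using cls_mem_iff[OF _ QI var_closed[OF x]] Qp by (auto simp: proper_prime_def)
    then show ?thesis using Qs[of i] by blast
  qed
  have "card S \<in> {r. \<exists>P. (\<forall>i\<le>r. primeideal (P i) A) \<and> (\<forall>i<r. P i \<subset> P (Suc i))}"
    using prime_image[OF Qp QI] Qne by (intro CollectI exI[of _ "\<lambda>i. cls ` Q i"]) auto
  then show "enat (card S) \<le> (SUP r\<in>{r. \<exists>P. (\<forall>i\<le>r. primeideal (P i) A) \<and> (\<forall>i<r. P i \<subset> P (Suc i))}. enat r)"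
    by (rule SUP_upper)
qed

end

section \<open>Vertex decompositions of independence complexes\<close>

text \<open>If \<open>u\<close> and its neighbours all lie in the closed neighbourhood of \<open>v\<close>, then a maximal
  independent set of \<open>W - {v}\<close> contains \<open>u\<close> or a neighbour of \<open>u\<close>, hence dominates \<open>v\<close> and is maximal in \<open>W\<close>.
  A maximal independent set of \<open>W\<close> without the neighbours of \<open>v\<close> contains the now isolated vertex \<open>v\<close>, and is
  maximal in \<open>W\<close> as well. So all simplices at the end of the recursion are maximal independent sets of the
  graph. The class \<open>\<W>\<close> holds the vertex sets that the recursion meets.\<close>

lemma vertex_decomposable_independent_sets:
  assumes step: "\<And>W. \<W> W \<Longrightarrow> \<exists>e\<in>E. e \<subseteq> W \<Longrightarrow> \<exists>v\<in>W. \<exists>u\<in>W. {u, v} \<in> E \<and>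
      (\<forall>x\<in>W. {u, x} \<in> E \<longrightarrow> x = v \<or> {v, x} \<in> E) \<and> \<W> (W - {v}) \<and> \<W> (W - {x. {v, x} \<in> E})"
    and E: "\<And>e. e \<in> E \<Longrightarrow> card e = 2"
    and W: "\<W> W" "finite W" "W \<subseteq> V"
    and max: "\<And>X. X \<in> independent_sets W E \<Longrightarrow>
      (\<And>Y. Y \<in> independent_sets W E \<Longrightarrow> X \<subseteq> Y \<Longrightarrow> Y = X) \<Longrightarrow> r \<le> card X"
  shows "vertex_decomposable V r (independent_sets W E)"
  using W max
proof (induction "card W" arbitrary: W rule: less_induct)
  case less
  have pairs: "X \<in> independent_sets W E \<longleftrightarrow> X \<subseteq> W \<and> (\<forall>x\<in>X. \<forall>y\<in>X. {x, y} \<notin> E)" for X W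
  proof -
    have "(\<forall>e\<in>E. \<not> e \<subseteq> X) \<longleftrightarrow> (\<forall>x\<in>X. \<forall>y\<in>X. {x, y} \<notin> E)"
    proof (intro iffI ballI notI)
      fix e assume a: "\<forall>x\<in>X. \<forall>y\<in>X. {x, y} \<notin> E" "e \<in> E" "e \<subseteq> X"
      obtain x y where "e = {x, y}" using E[OF a(2)] by (meson card_2_iff)
      then show False using a by auto
    qed auto
    then show ?thesis by (simp add: independent_sets_def)
  qed
  show ?case
  proof (cases "\<exists>e\<in>E. e \<subseteq> W")
    case False
    then have "independent_sets W E = Pow W" by (auto simp: independent_sets_def)
    moreover have "r \<le> card W" using less.prems(4)[of W] calculation by auto
    ultimately show ?thesis using less.prems(3) by (simp add: vertex_decomposable.simplex)
  next
    case True
    from step[OF less.prems(1) True] obtain v u where vu: "v \<in> W" "u \<in> W" "{u, v} \<in> E"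
      "\<And>x. x \<in> W \<Longrightarrow> {u, x} \<in> E \<Longrightarrow> x = v \<or> {v, x} \<in> E" "\<W> (W - {v})" "\<W> (W - {x. {v, x} \<in> E})"
      by blast
    let ?L = "W - {x. {v, x} \<in> E}"
    have uv: "{v, u} \<in> E" using vu(3) by (simp add: insert_commute)
    have vv: "{v, v} \<notin> E" using E[of "{v}"] by auto
    have sym: "{x, y} \<in> E \<longleftrightarrow> {y, x} \<in> E" for x y by (simp add: insert_commute)
    \<comment> \<open>the star and the deletion of \<open>v\<close> are again complexes of independent sets\<close>
    have link: "{X. insert v X \<in> independent_sets W E} = independent_sets ?L E"
      using vu(1) vv sym by (auto simp: pairs)
    have del: "{X \<in> independent_sets W E. v \<notin> X} = independent_sets (W - {v}) E"
      by (auto simp: pairs)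
    have L: "vertex_decomposable V r (independent_sets ?L E)"
    proof (rule less.hyps)
      show "card ?L < card W" using vu(2) uv less.prems(2) by (intro psubset_card_mono) auto
      show "\<W> ?L" "finite ?L" "?L \<subseteq> V" using vu less.prems by auto
      fix X assume X: "X \<in> independent_sets ?L E"
        and Xm: "\<And>Y. Y \<in> independent_sets ?L E \<Longrightarrow> X \<subseteq> Y \<Longrightarrow> Y = X"
      have "insert v X \<in> independent_sets ?L E" using X vu(1) vv sym by (auto simp: pairs)
      then have vX: "v \<in> X" using Xm by blast
      show "r \<le> card X"
      proof (rule less.prems(4))
        show "X \<in> independent_sets W E" using X by (auto simp: pairs)
        fix Y assume "Y \<in> independent_sets W E" "X \<subseteq> Y"
        then show "Y = X" using Xm[of Y] vX by (auto simp: pairs)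
      qed
    qed
    have D: "vertex_decomposable V r (independent_sets (W - {v}) E)"
    proof (rule less.hyps)
      show "card (W - {v}) < card W" using vu(1) less.prems(2) by (intro psubset_card_mono) auto
      show "\<W> (W - {v})" "finite (W - {v})" "W - {v} \<subseteq> V" using vu less.prems by auto
      fix X assume X: "X \<in> independent_sets (W - {v}) E"
        and Xm: "\<And>Y. Y \<in> independent_sets (W - {v}) E \<Longrightarrow> X \<subseteq> Y \<Longrightarrow> Y = X"
      have nv: "\<exists>x\<in>X. {v, x} \<in> E"
      proof (cases "u \<in> X")
        case False
        then have "insert u X \<notin> independent_sets (W - {v}) E" using Xm by blast
        moreover have "u \<noteq> v" using vu(3) vv by auto
        moreover have "{u, u} \<notin> E" using E[of "{u}"] by auto
        ultimately obtain x where "x \<in> X" "{u, x} \<in> E" using X vu(2) sym by (auto simp: pairs)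
        then show ?thesis using vu(4)[of x] X by (auto simp: pairs)
      qed (use uv in blast)
      show "r \<le> card X"
      proof (rule less.prems(4))
        show "X \<in> independent_sets W E" using X by (auto simp: pairs)
        fix Y assume Y: "Y \<in> independent_sets W E" "X \<subseteq> Y"
        then have "v \<notin> Y" using nv by (auto simp: pairs)
        then show "Y = X" using Xm[of Y] Y by (auto simp: pairs)
      qed
    qed
    have "v \<in> V" using vu(1) less.prems(3) by blast
    then show ?thesis
      by (rule vertex_decomposable.vertex[OF _ down_closed_independent_sets L[folded link] D[folded del]])
  qed
qed

section \<open>The shape of a Cameron--Walker graph\<close>

text \<open>The vertices of \<open>S\<close> carry one pendant edge each, with end \<open>leaf v\<close>; \<open>U\<close> is an independent set joined to \<open>S\<close> by
  the edges in \<open>N\<close>; each \<open>d\<close> in \<open>D\<close> stands for a triangle with vertices \<open>d\<close>, \<open>tip d\<close> and \<open>apex d\<close>, the last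
  of which belongs to \<open>U\<close>. Further pendant edges at a vertex of \<open>S\<close> appear as elements of \<open>U\<close> with a single
  neighbour.\<close>

locale cw_structure =
  fixes S :: "'v set" and leaf :: "'v \<Rightarrow> 'v" and U :: "'v set"
    and D :: "'v set" and tip :: "'v \<Rightarrow> 'v" and apex :: "'v \<Rightarrow> 'v" and N :: "('v \<times> 'v) set"
  assumes fin: "finite S" "finite U" "finite D"
    and inj: "inj_on leaf S" "inj_on tip D"
    and disj: "S \<inter> leaf ` S = {}" "S \<inter> U = {}" "S \<inter> D = {}" "S \<inter> tip ` D = {}"
      "leaf ` S \<inter> U = {}" "leaf ` S \<inter> D = {}" "leaf ` S \<inter> tip ` D = {}"
      "U \<inter> D = {}" "U \<inter> tip ` D = {}" "D \<inter> tip ` D = {}"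
    and apex: "\<And>d. d \<in> D \<Longrightarrow> apex d \<in> U"
    and N: "N \<subseteq> S \<times> U"
begin

definition verts :: "'v set" where
  "verts = S \<union> leaf ` S \<union> U \<union> D \<union> tip ` D"

text \<open>Each edge in one orientation; the graph itself is undirected.\<close>

definition arc :: "'v \<Rightarrow> 'v \<Rightarrow> bool" where
  "arc x y \<longleftrightarrow> (x \<in> S \<and> y = leaf x) \<or> (x, y) \<in> N \<or> (x \<in> D \<and> y = tip x) \<or> (x \<in> D \<and> y = apex x)
     \<or> (\<exists>d\<in>D. x = tip d \<and> y = apex d)"

definition edges :: "'v set set" where
  "edges = {{x, y} | x y. arc x y}"

lemma edge_iff: "{x, y} \<in> edges \<longleftrightarrow> arc x y \<or> arc y x"
  by (auto simp: edges_def doubleton_eq_iff)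

lemma apart:
  "v \<in> S \<Longrightarrow> w \<in> S \<Longrightarrow> v \<noteq> leaf w" "v \<in> S \<Longrightarrow> u \<in> U \<Longrightarrow> v \<noteq> u" "v \<in> S \<Longrightarrow> d \<in> D \<Longrightarrow> v \<noteq> d"
  "v \<in> S \<Longrightarrow> d \<in> D \<Longrightarrow> v \<noteq> tip d" "v \<in> S \<Longrightarrow> u \<in> U \<Longrightarrow> leaf v \<noteq> u" "v \<in> S \<Longrightarrow> d \<in> D \<Longrightarrow> leaf v \<noteq> d"
  "v \<in> S \<Longrightarrow> d \<in> D \<Longrightarrow> leaf v \<noteq> tip d" "u \<in> U \<Longrightarrow> d \<in> D \<Longrightarrow> u \<noteq> d" "u \<in> U \<Longrightarrow> d \<in> D \<Longrightarrow> u \<noteq> tip d"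
  "d \<in> D \<Longrightarrow> d' \<in> D \<Longrightarrow> d \<noteq> tip d'"
  by (use disj(1) in blast, use disj(2) in blast, use disj(3) in blast, use disj(4) in blast,
      use disj(5) in blast, use disj(6) in blast, use disj(7) in blast, use disj(8) in blast,
      use disj(9) in blast, use disj(10) in blast)

lemma apart_apex:
  "v \<in> S \<Longrightarrow> d \<in> D \<Longrightarrow> v \<noteq> apex d" "v \<in> S \<Longrightarrow> d \<in> D \<Longrightarrow> leaf v \<noteq> apex d"
  "d \<in> D \<Longrightarrow> d' \<in> D \<Longrightarrow> apex d \<noteq> d'" "d \<in> D \<Longrightarrow> d' \<in> D \<Longrightarrow> apex d \<noteq> tip d'"
  using apex apart(2,5,8,9) by blast+

lemma inj_iff:
  "v \<in> S \<Longrightarrow> w \<in> S \<Longrightarrow> leaf v = leaf w \<longleftrightarrow> v = w" "d \<in> D \<Longrightarrow> d' \<in> D \<Longrightarrow> tip d = tip d' \<longleftrightarrow> d = d'"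
  using inj by (auto simp: inj_on_def)

lemma adjacency_ends: "(v, u) \<in> N \<Longrightarrow> v \<in> S \<and> u \<in> U"
  using N by blast

lemma arc_verts: "arc x y \<Longrightarrow> x \<in> verts \<and> y \<in> verts \<and> x \<noteq> y"
  unfolding arc_def
  by (elim disjE bexE conjE) (auto simp: verts_def apex dest: adjacency_ends apart apart_apex apart_apex(3,4)[THEN not_sym])

lemma simple_graph: "simple_graph verts edges"
  unfolding simple_graph_def
proof (intro conjI ballI)
  show "finite verts" using fin by (simp add: verts_def)
  fix e assume "e \<in> edges"
  then obtain x y where "e = {x, y}" "arc x y" by (auto simp: edges_def)
  then show "e \<subseteq> verts" "card e = 2" using arc_verts[of x y] by auto
qed

lemma neighbour_support: "v \<in> S \<Longrightarrow> {v, x} \<in> edges \<longleftrightarrow> x = leaf v \<or> (v, x) \<in> N"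
  unfolding edge_iff arc_def by (auto simp: apex dest: adjacency_ends apart apart_apex)

lemma neighbour_leaf: "v \<in> S \<Longrightarrow> {leaf v, x} \<in> edges \<longleftrightarrow> x = v"
  unfolding edge_iff arc_def by (auto simp: apex inj_iff dest: adjacency_ends apart apart_apex)

lemma neighbour_core: "u \<in> U \<Longrightarrow> {u, x} \<in> edges \<longleftrightarrow> (x, u) \<in> N \<or> (\<exists>d\<in>D. apex d = u \<and> (x = d \<or> x = tip d))"
  unfolding edge_iff arc_def by (auto simp: apex dest: adjacency_ends apart apart_apex)

lemma neighbour_D: "d \<in> D \<Longrightarrow> {d, x} \<in> edges \<longleftrightarrow> x = tip d \<or> x = apex d"
  unfolding edge_iff arc_def by (auto simp: apex dest: adjacency_ends apart apart_apex)

lemma neighbour_tip: "d \<in> D \<Longrightarrow> {tip d, x} \<in> edges \<longleftrightarrow> x = d \<or> x = apex d"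
  unfolding edge_iff arc_def by (auto simp: apex inj_iff dest: adjacency_ends apart apart_apex)

lemma card_verts: "card verts = 2 * card S + 2 * card D + card U"
proof -
  have "card verts = card S + card (leaf ` S) + card U + card D + card (tip ` D)"
    unfolding verts_def using fin disj by (simp add: card_Un_disjoint Int_Un_distrib2)
  then show ?thesis using inj by (simp add: card_image)
qed

lemma verts_cases:
  assumes "x \<in> verts"
  obtains "x \<in> S" | v where "v \<in> S" "x = leaf v" | "x \<in> U" | "x \<in> D" | d where "d \<in> D" "x = tip d"
  using assms by (auto simp: verts_def)

lemma independent_iff:
  "X \<in> independent_sets verts edges \<longleftrightarrow> X \<subseteq> verts \<and> (\<forall>x\<in>X. \<forall>y\<in>X. {x, y} \<notin> edges)"
proof -
  have "(\<forall>e\<in>edges. \<not> e \<subseteq> X) \<longleftrightarrow> (\<forall>x\<in>X. \<forall>y\<in>X. {x, y} \<notin> edges)"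
  proof (intro iffI ballI notI)
    fix e assume a: "\<forall>x\<in>X. \<forall>y\<in>X. {x, y} \<notin> edges" "e \<in> edges" "e \<subseteq> X"
    then obtain x y where "e = {x, y}" by (auto simp: edges_def)
    then show False using a by auto
  qed auto
  then show ?thesis by (simp add: independent_sets_def)
qed

subsection \<open>Largest independent sets\<close>

text \<open>An independent set meets each clique of a cover at most once. The cover consists of the pendant edges, of one
  clique per \<open>d \<in> D\<close> within the triangle of \<open>d\<close>, and of the single vertices of \<open>U\<close> that are no apex. The map \<open>\<phi>\<close> sends a
  vertex to its clique; an apex is assigned to one of its triangles.\<close>

lemma independent_card_le:
  assumes X: "X \<in> independent_sets verts edges"
  shows "card X \<le> card S + card D + card (U - apex ` D)"
proof -
  define pick where "pick u = (SOME d. d \<in> D \<and> apex d = u)" for u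
  have pick: "pick u \<in> D \<and> apex (pick u) = u" if "u \<in> apex ` D" for u
    unfolding pick_def by (rule someI_ex) (use that in auto)
  define \<phi> where "\<phi> x = (if x \<in> leaf ` S then inv_into S leaf x else if x \<in> tip ` D then inv_into D tip x
     else if x \<in> apex ` D then pick x else x)" for x
  have \<phi>leaf: "\<phi> (leaf v) = v" if "v \<in> S" for v using that inj by (simp add: \<phi>_def)
  have \<phi>S: "\<phi> v = v" if "v \<in> S" for v
    using that apart(1)[OF that] apart(4)[OF that] apart_apex(1)[OF that] by (auto simp: \<phi>_def)
  have \<phi>D: "\<phi> d = d" if "d \<in> D" for d
    using that apart(6)[OF _ that] apart(10)[OF that] apart_apex(3)[OF _ that] by (force simp: \<phi>_def)
  have \<phi>tip: "\<phi> (tip d) = d" if "d \<in> D" for d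
  proof -
    have "tip d \<notin> leaf ` S" using apart(7)[OF _ that] by force
    then show ?thesis using that inj by (simp add: \<phi>_def)
  qed
  have \<phi>U: "\<phi> u = (if u \<in> apex ` D then pick u else u)" if "u \<in> U" for u
  proof -
    have "u \<notin> leaf ` S" using apart(5)[OF _ that] by blast
    moreover have "u \<notin> tip ` D" using apart(9)[OF that] by blast
    ultimately show ?thesis by (simp add: \<phi>_def)
  qed
  let ?K = "S \<union> D \<union> (U - apex ` D)"
  have "\<phi> ` X \<subseteq> ?K"
  proof
    fix k assume "k \<in> \<phi> ` X"
    then obtain x where x: "x \<in> X" "k = \<phi> x" by blast
    then have "x \<in> verts" using X by (auto simp: independent_iff)
    then show "k \<in> ?K"
      by (cases rule: verts_cases) (use x in \<open>auto simp: \<phi>S \<phi>leaf \<phi>U \<phi>D \<phi>tip pick\<close>)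
  qed
  moreover have "inj_on \<phi> X"
  proof (rule inj_onI, rule ccontr)
    fix x y assume xy: "x \<in> X" "y \<in> X" "\<phi> x = \<phi> y" "x \<noteq> y"
    have "x \<in> verts" "y \<in> verts" and ne: "{x, y} \<notin> edges" using X xy by (auto simp: independent_iff)
    have sym: "{x, y} = {y, x}" by auto
    have clique: "\<exists>k. (k \<in> S \<and> \<phi> x = k \<and> x \<in> {k, leaf k}) \<or> (k \<in> D \<and> \<phi> x = k \<and> x \<in> {k, tip k, apex k})
       \<or> (x = \<phi> x \<and> x \<in> U)" if "x \<in> verts" for x
      using that
    proof (cases rule: verts_cases)
      case 3
      show ?thesis
      proof (cases "x \<in> apex ` D")
        case True
        then have "pick x \<in> D" "\<phi> x = pick x" "x = apex (pick x)" using pick[of x] 3 by (auto simp: \<phi>U)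
        then show ?thesis by blast
      qed (use 3 in \<open>simp add: \<phi>U\<close>)
    qed (auto simp: \<phi>S \<phi>leaf \<phi>D \<phi>tip)
    define k where "k = \<phi> x"
    have cx: "(k \<in> S \<and> x \<in> {k, leaf k}) \<or> (k \<in> D \<and> x \<in> {k, tip k, apex k}) \<or> (x = k \<and> k \<in> U)"
      using clique[OF \<open>x \<in> verts\<close>] by (auto simp: k_def)
    have cy: "(k \<in> S \<and> y \<in> {k, leaf k}) \<or> (k \<in> D \<and> y \<in> {k, tip k, apex k}) \<or> (y = k \<and> k \<in> U)"
      using clique[OF \<open>y \<in> verts\<close>] xy(3) by (auto simp: k_def)
    have excl: "\<not> (k \<in> S \<and> k \<in> D)" "\<not> (k \<in> S \<and> k \<in> U)" "\<not> (k \<in> D \<and> k \<in> U)"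
      using disj(2,3,8) by blast+
    then consider "k \<in> S" "x \<in> {k, leaf k}" "y \<in> {k, leaf k}" | "k \<in> D" "x \<in> {k, tip k, apex k}" "y \<in> {k, tip k, apex k}"
      using cx cy xy(4) by argo
    then have "{x, y} \<in> edges"
    proof cases
      case 1
      then show ?thesis using xy(4) by (auto simp: neighbour_support neighbour_leaf)
    next
      case 2
      then have "{k, tip k} \<in> edges" "{k, apex k} \<in> edges" "{tip k, apex k} \<in> edges"
        by (simp_all add: neighbour_D neighbour_tip)
      then show ?thesis using 2(2,3) xy(4) by (auto simp: insert_commute)
    qed
    then show False using ne by simp
  qed
  ultimately have "card X \<le> card ?K" using fin by (intro card_inj_on_le) auto
  also have "card ?K = card S + card D + card (U - apex ` D)"
  proof -
    have "S \<inter> D = {}" "(S \<union> D) \<inter> (U - apex ` D) = {}" using disj(2,3,8) by blast+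
    then show ?thesis using fin by (simp add: card_Un_disjoint)
  qed
  finally show ?thesis .
qed

lemma independent_attained:
  shows "leaf ` S \<union> D \<union> (U - apex ` D) \<in> independent_sets verts edges"
    and "card (leaf ` S \<union> D \<union> (U - apex ` D)) = card S + card D + card (U - apex ` D)"
proof -
  let ?X = "leaf ` S \<union> D \<union> (U - apex ` D)"
  have "{x, y} \<notin> edges" if x: "x \<in> ?X" and y: "y \<in> ?X" for x y
  proof -
    consider v where "v \<in> S" "x = leaf v" | "x \<in> D" | "x \<in> U" "x \<notin> apex ` D" using x by blast
    then show ?thesis
      using y by cases (auto simp: neighbour_leaf neighbour_D neighbour_core
          dest: adjacency_ends apart apart_apex apex apart_apex(3,4)[THEN not_sym] apart(10)[THEN not_sym] apart(8)[THEN not_sym])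
  qed
  moreover have "?X \<subseteq> verts" by (auto simp: verts_def)
  ultimately show "?X \<in> independent_sets verts edges" unfolding independent_iff by blast
  have "leaf ` S \<inter> D = {}" "(leaf ` S \<union> D) \<inter> (U - apex ` D) = {}" using disj(5,6,8) by blast+
  then have "card ?X = card (leaf ` S) + card D + card (U - apex ` D)"
    using fin by (simp add: card_Un_disjoint)
  then show "card ?X = card S + card D + card (U - apex ` D)" using inj by (simp add: card_image)
qed

subsection \<open>Maximal independent sets\<close>

text \<open>The size of the smallest maximal independent set that meets \<open>S\<close> in \<open>A\<close>: from each pendant edge one
  end, from each triangle at a neighbour of \<open>A\<close> one base vertex, and the elements of \<open>U\<close> that have no
  neighbour in \<open>A\<close>.\<close>

definition cost :: "'v set \<Rightarrow> nat" where
  "cost A = card S + card {d \<in> D. apex d \<in> N `` A} + card (U - N `` A)"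

lemma cost_empty: "cost {} = card S + card U"
  by (simp add: cost_def)

lemma cost_support:
  assumes "N `` S = U"
  shows "cost S = card S + card D"
proof -
  have "{d \<in> D. apex d \<in> U} = D" using apex by blast
  then show ?thesis using assms by (simp add: cost_def)
qed

text \<open>Every apex is either a neighbour of \<open>A\<close>, and then contributes its triangles, or contributes itself.\<close>

lemma cost_ge: "card S + card (apex ` D) \<le> cost A"
proof -
  let ?DA = "{d \<in> D. apex d \<in> N `` A}"
  have "apex ` D \<subseteq> apex ` ?DA \<union> (U - N `` A)" using apex by blast
  then have "card (apex ` D) \<le> card (apex ` ?DA \<union> (U - N `` A))" using fin by (intro card_mono) auto
  also have "\<dots> \<le> card (apex ` ?DA) + card (U - N `` A)" by (rule card_Un_le)
  also have "card (apex ` ?DA) \<le> card ?DA" using fin by (intro card_image_le) auto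
  finally show ?thesis by (simp add: cost_def)
qed

lemma card_bare_core: "card (U - apex ` D) = card U - card (apex ` D)"
  using apex fin by (intro card_Diff_subset) auto

lemma maximal_independent_attained:
  assumes A: "A \<subseteq> S"
  obtains X where "X \<in> independent_sets verts edges" "card X = cost A"
    "\<And>Y. Y \<in> independent_sets verts edges \<Longrightarrow> X \<subseteq> Y \<Longrightarrow> Y = X"
proof
  let ?DA = "{d \<in> D. apex d \<in> N `` A}"
  let ?X = "A \<union> leaf ` (S - A) \<union> ?DA \<union> (U - N `` A)"
  have ind: "{x, y} \<notin> edges" if x: "x \<in> ?X" and y: "y \<in> ?X" for x y
  proof -
    have AS: "v \<in> S" if "v \<in> A" for v using that A by blast
    consider "x \<in> A" | v where "v \<in> S" "v \<notin> A" "x = leaf v" | "x \<in> D" "apex x \<in> N `` A" | "x \<in> U" "x \<notin> N `` A"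
      using x by blast
    then show ?thesis
    proof cases
      case 1
      then show ?thesis using y AS[OF 1]
        by (auto simp: neighbour_support inj_iff dest: AS adjacency_ends apart apart_apex apart(8)[THEN not_sym])
    next
      case 2
      then show ?thesis using y by (auto simp: neighbour_leaf dest: AS adjacency_ends apart apart_apex)
    next
      case 3
      then show ?thesis using y
        by (auto simp: neighbour_D dest: AS adjacency_ends apart apart_apex apart(10)[THEN not_sym])
    next
      case 4
      then show ?thesis using y
        by (auto simp: neighbour_core dest: AS adjacency_ends apart apart_apex apart(10)[THEN not_sym])
    qed
  qed
  have "?X \<subseteq> verts" using A by (auto simp: verts_def)
  then show X: "?X \<in> independent_sets verts edges" unfolding independent_iff using ind by blast
  have "A \<inter> leaf ` (S - A) = {}" "(A \<union> leaf ` (S - A)) \<inter> ?DA = {}"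
    "(A \<union> leaf ` (S - A) \<union> ?DA) \<inter> (U - N `` A) = {}"
    using A disj(1) disj(3,6) disj(2,5,8) by blast+
  then have "card ?X = card A + card (leaf ` (S - A)) + card ?DA + card (U - N `` A)"
    using fin finite_subset[OF A fin(1)] by (simp add: card_Un_disjoint)
  moreover have "card (leaf ` (S - A)) = card S - card A"
    using inj(1) A fin by (subst card_image) (auto intro: inj_on_subset simp: card_Diff_subset finite_subset)
  ultimately show "card ?X = cost A" using card_mono[OF fin(1) A] by (simp add: cost_def)
  fix Y assume Y: "Y \<in> independent_sets verts edges" "?X \<subseteq> Y"
  have "y \<in> ?X" if y: "y \<in> Y" for y
  proof (rule ccontr)
    assume n: "y \<notin> ?X"
    have "\<exists>x\<in>?X. {y, x} \<in> edges"
    proof -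
      have "y \<in> verts" using Y y by (auto simp: independent_iff)
      then show ?thesis
      proof (cases rule: verts_cases)
        case 1
        then show ?thesis using n by (auto simp: neighbour_support)
      next
        case (2 v)
        then show ?thesis using n by (auto simp: neighbour_leaf)
      next
        case 3
        then obtain v where "v \<in> A" "(v, y) \<in> N" using n by auto
        then show ?thesis using 3 by (auto simp: neighbour_core)
      next
        case 4
        then have "apex y \<notin> N `` A" "apex y \<in> U" using n apex by auto
        then show ?thesis using 4 by (auto simp: neighbour_D)
      next
        case (5 d)
        show ?thesis
        proof (cases "apex d \<in> N `` A")
          case True
          then show ?thesis using 5 by (auto simp: neighbour_tip)
        next
          case False
          then show ?thesis using 5 apex[of d] by (auto simp: neighbour_tip)
        qed
      qed
    qed
    then show False using Y y by (auto simp: independent_iff)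
  qed
  then show "Y = ?X" using Y by blast
qed

text \<open>A maximal independent set \<open>X\<close> contains an end of each pendant edge. An element of \<open>U\<close> with a neighbour in \<open>X \<inter> S\<close> is
  not in \<open>X\<close>, so \<open>X\<close> contains a base vertex of each of its triangles. Any other element of \<open>U\<close> is in \<open>X\<close> or has
  a base vertex of one of its triangles in \<open>X\<close>. The map \<open>\<psi>\<close> chooses these vertices, and they are distinct.\<close>

lemma maximal_independent_card_ge:
  assumes X: "X \<in> independent_sets verts edges"
    and max: "\<And>Y. Y \<in> independent_sets verts edges \<Longrightarrow> X \<subseteq> Y \<Longrightarrow> Y = X"
  shows "cost (X \<inter> S) \<le> card X"
proof -
  let ?A = "X \<inter> S"
  have dom: "x \<in> X \<or> (\<exists>y\<in>X. {x, y} \<in> edges)" if "x \<in> verts" for x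
  proof (rule ccontr)
    assume n: "\<not> ?thesis"
    have "{x, x} \<notin> edges" using simple_graph by (auto simp: simple_graph_def)
    moreover have "{x, y} = {y, x}" for y by auto
    ultimately have "insert x X \<in> independent_sets verts edges"
      using X that n by (auto simp: independent_iff)
    then show False using max n by blast
  qed
  have XV: "X \<subseteq> verts" and XI: "\<And>x y. x \<in> X \<Longrightarrow> y \<in> X \<Longrightarrow> {x, y} \<notin> edges"
    using X by (auto simp: independent_iff)
  have fX: "finite X" using XV simple_graph finite_subset by (auto simp: simple_graph_def)
  have s: "\<exists>x\<in>X. x = v \<or> x = leaf v" if "v \<in> S" for v
    using dom[of "leaf v"] that by (auto simp: neighbour_leaf verts_def)
  have d: "\<exists>x\<in>X. x = d \<or> x = tip d" if dD: "d \<in> D" "apex d \<in> N `` ?A" for d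
  proof -
    have "apex d \<notin> X"
    proof
      assume "apex d \<in> X"
      moreover obtain v where "v \<in> X" "(v, apex d) \<in> N" using dD by auto
      moreover from this have "{v, apex d} \<in> edges" by (auto simp: edge_iff arc_def)
      ultimately show False using XI by blast
    qed
    then show ?thesis using dom[of d] dD by (auto simp: neighbour_D verts_def)
  qed
  have u: "\<exists>x\<in>X. x = u \<or> (\<exists>d\<in>D. apex d = u \<and> (x = d \<or> x = tip d))" if "u \<in> U - N `` ?A" for u
    using dom[of u] that N by (auto simp: neighbour_core verts_def)
  define \<psi> where "\<psi> k = (SOME x. x \<in> X \<and> (if k \<in> S then x = k \<or> x = leaf k else if k \<in> D then x = k \<or> x = tip k
     else x = k \<or> (\<exists>d\<in>D. apex d = k \<and> (x = d \<or> x = tip d))))" for k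
  let ?K = "S \<union> {d \<in> D. apex d \<in> N `` ?A} \<union> (U - N `` ?A)"
  have \<psi>: "\<psi> k \<in> X \<and> (if k \<in> S then \<psi> k = k \<or> \<psi> k = leaf k else if k \<in> D then \<psi> k = k \<or> \<psi> k = tip k
     else \<psi> k = k \<or> (\<exists>d\<in>D. apex d = k \<and> (\<psi> k = d \<or> \<psi> k = tip d)))" if kK: "k \<in> ?K" for k
  proof -
    consider "k \<in> S" | "k \<notin> S" "k \<in> D" "apex k \<in> N `` ?A" | "k \<notin> S" "k \<notin> D" "k \<in> U - N `` ?A"
      using kK disj(2,8) by blast
    then have "\<exists>x. x \<in> X \<and> (if k \<in> S then x = k \<or> x = leaf k else if k \<in> D then x = k \<or> x = tip k
     else x = k \<or> (\<exists>d\<in>D. apex d = k \<and> (x = d \<or> x = tip d)))"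
    proof cases
      case 1
      then show ?thesis using s by auto
    next
      case 2
      then show ?thesis using d by auto
    next
      case 3
      then show ?thesis using u by simp blast
    qed
    then show ?thesis unfolding \<psi>_def by (rule someI_ex)
  qed
  have "inj_on \<psi> ?K"
  proof (rule inj_onI)
    fix k l assume kl: "k \<in> ?K" "l \<in> ?K" "\<psi> k = \<psi> l"
    consider "k \<in> S" "\<psi> k \<in> {k, leaf k}" | "k \<in> D" "k \<notin> S" "apex k \<in> N `` ?A" "\<psi> k \<in> {k, tip k}"
      | "k \<in> U - N `` ?A" "k \<notin> S" "k \<notin> D" "\<psi> k = k \<or> (\<exists>d\<in>D. apex d = k \<and> (\<psi> k = d \<or> \<psi> k = tip d))"
      using \<psi>[OF kl(1)] kl(1) disj by (auto split: if_splits)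
    note ck = this
    consider "l \<in> S" "\<psi> l \<in> {l, leaf l}" | "l \<in> D" "l \<notin> S" "apex l \<in> N `` ?A" "\<psi> l \<in> {l, tip l}"
      | "l \<in> U - N `` ?A" "l \<notin> S" "l \<notin> D" "\<psi> l = l \<or> (\<exists>d\<in>D. apex d = l \<and> (\<psi> l = d \<or> \<psi> l = tip d))"
      using \<psi>[OF kl(2)] kl(2) disj by (auto split: if_splits)
    note cl = this
    show "k = l"
      using ck
    proof cases
      case 1
      show ?thesis
        using cl
      proof cases
        case c: 1
        then show ?thesis using 1 c kl(3) by (metis apart(1) inj_iff(1) insertE singletonD)
      next
        case 2
        then show ?thesis using 1 kl(3) by (metis apart(3,4,6,7) insertE singletonD)
      next
        case 3
        then have "l \<in> U" by blast
        then show ?thesis using 1 3 kl(3) by (metis apart(2-7) insertE singletonD)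
      qed
    next
      case 2
      show ?thesis
        using cl
      proof cases
        case 1
        then show ?thesis using 2 kl(3) by (metis apart(3,4,6,7) insertE singletonD)
      next
        case c: 2
        then show ?thesis using 2 c kl(3) by (metis apart(10) inj_iff(2) insertE singletonD)
      next
        case 3
        then have "l \<in> U" by blast
        then show ?thesis using 2 3 kl(3) by (metis apart(8,9,10) inj_iff(2) insertE singletonD DiffE)
      qed
    next
      case 3
      then have kU: "k \<in> U" by blast
      show ?thesis
        using cl
      proof cases
        case 1
        then show ?thesis using 3 kU kl(3) by (metis apart(2-7) insertE singletonD)
      next
        case 2
        then show ?thesis using 3 kU kl(3) by (metis apart(8,9,10) inj_iff(2) insertE singletonD DiffE)
      next
        case c: 3
        then have "l \<in> U" by blast
        then show ?thesis using 3 c kU kl(3) by (metis apart(8,9,10) inj_iff(2))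
      qed
    qed
  qed
  moreover have "\<psi> ` ?K \<subseteq> X" using \<psi> by blast
  ultimately have "card ?K \<le> card X" using fX by (intro card_inj_on_le)
  moreover have "card ?K = cost ?A"
  proof -
    have "S \<inter> {d \<in> D. apex d \<in> N `` ?A} = {}" "(S \<union> {d \<in> D. apex d \<in> N `` ?A}) \<inter> (U - N `` ?A) = {}"
      using disj(2,3,8) by blast+
    then show ?thesis using fin by (simp add: cost_def card_Un_disjoint)
  qed
  ultimately show ?thesis by simp
qed

text \<open>In the hypothesis of \<open>vertex_decomposable_independent_sets\<close> the dominated vertex \<open>u\<close> is a leaf as long as a
  vertex of \<open>S\<close> has an edge, where \<open>v\<close> is its neighbour. Afterwards all remaining edges lie in triangles, and \<open>u\<close>
  is a base vertex, with the apex or the other base vertex as \<open>v\<close>. The recursion deletes a leaf only together with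
  all other neighbours of its support vertex; this invariant keeps the leaves available.\<close>

lemma vertex_decomposable:
  assumes r: "\<And>A. A \<subseteq> S \<Longrightarrow> r \<le> cost A"
  shows "vertex_decomposable verts r (independent_sets verts edges)"
proof (rule vertex_decomposable_independent_sets[where
      \<W> = "\<lambda>W. W \<subseteq> verts \<and> (\<forall>v\<in>S \<inter> W. leaf v \<in> W \<or> (\<forall>x\<in>W. {v, x} \<notin> edges))"])
  show "card e = 2" if "e \<in> edges" for e using simple_graph that by (simp add: simple_graph_def)
  show "finite verts" using simple_graph by (simp add: simple_graph_def)
  show "verts \<subseteq> verts \<and> (\<forall>v\<in>S \<inter> verts. leaf v \<in> verts \<or> (\<forall>x\<in>verts. {v, x} \<notin> edges))"
    by (auto simp: verts_def)
  show "verts \<subseteq> verts" ..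
  show "r \<le> card X" if "X \<in> independent_sets verts edges"
    "\<And>Y. Y \<in> independent_sets verts edges \<Longrightarrow> X \<subseteq> Y \<Longrightarrow> Y = X" for X
    using maximal_independent_card_ge[OF that] r[of "X \<inter> S"] by simp
  fix W assume W: "W \<subseteq> verts \<and> (\<forall>v\<in>S \<inter> W. leaf v \<in> W \<or> (\<forall>x\<in>W. {v, x} \<notin> edges))"
    and ex: "\<exists>e\<in>edges. e \<subseteq> W"
  let ?Inv = "\<lambda>W. W \<subseteq> verts \<and> (\<forall>v\<in>S \<inter> W. leaf v \<in> W \<or> (\<forall>x\<in>W. {v, x} \<notin> edges))"
  have keep: "?Inv (W - Z)" if "Z \<inter> leaf ` S = {}" for Z using W that by blast
  have sym: "{x, y} = {y, x}" for x y :: 'v by auto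
  show "\<exists>v\<in>W. \<exists>u\<in>W. {u, v} \<in> edges \<and> (\<forall>x\<in>W. {u, x} \<in> edges \<longrightarrow> x = v \<or> {v, x} \<in> edges) \<and>
      ?Inv (W - {v}) \<and> ?Inv (W - {x. {v, x} \<in> edges})"
  proof (cases "\<exists>v\<in>S \<inter> W. \<exists>x\<in>W. {v, x} \<in> edges")
    case True
    then obtain v where v: "v \<in> S" "v \<in> W" "leaf v \<in> W" using W by blast
    have "?Inv (W - {v})" using v disj by (intro keep) auto
    moreover have "?Inv (W - {x. {v, x} \<in> edges})"
    proof -
      have "leaf w \<in> W - {x. {v, x} \<in> edges} \<or> (\<forall>x\<in>W - {x. {v, x} \<in> edges}. {w, x} \<notin> edges)"
        if w: "w \<in> S" "w \<in> W" for w
      proof (cases "w = v")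
        case False
        have "{v, leaf w} \<notin> edges" using neighbour_leaf[OF w(1), of v] False by (simp add: sym[of v])
        then show ?thesis using W w by blast
      qed auto
      then show ?thesis using W by blast
    qed
    moreover have "{leaf v, v} \<in> edges" "\<forall>x\<in>W. {leaf v, x} \<in> edges \<longrightarrow> x = v \<or> {v, x} \<in> edges"
      using v by (auto simp: neighbour_leaf)
    ultimately show ?thesis using v by blast
  next
    case False
    then obtain x y where xy: "arc x y" "x \<in> W" "y \<in> W" using ex by (auto simp: edges_def)
    then have "x \<notin> S" using False by (auto simp: edge_iff)
    then have "\<exists>d\<in>D. (x = d \<or> x = tip d) \<and> y \<in> {tip d, apex d}" using xy N by (auto simp: arc_def)
    then obtain d where d: "d \<in> D" "x = d \<or> x = tip d" "y \<in> {tip d, apex d}" "x \<noteq> y"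
      using arc_verts[OF xy(1)] by blast
    have nl: "{d, tip d, apex d} \<inter> leaf ` S = {}"
      using apart(6,7)[OF _ d(1)] apart_apex(2)[OF _ d(1)] by force
    show ?thesis
    proof (cases "apex d \<in> W")
      case True
      have "?Inv (W - {apex d})" using nl by (intro keep) auto
      moreover have "?Inv (W - {z. {apex d, z} \<in> edges})"
        using apex[OF d(1)] disj N by (intro keep) (auto simp: neighbour_core)
      moreover obtain u where "u \<in> W" "u = d \<or> u = tip d" using xy d by blast
      moreover from this have "{u, apex d} \<in> edges"
        "\<forall>z\<in>W. {u, z} \<in> edges \<longrightarrow> z = apex d \<or> {apex d, z} \<in> edges"
        using d(1) apex[OF d(1)] by (auto simp: neighbour_D neighbour_tip neighbour_core)
      ultimately show ?thesis using True by blast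
    next
      case False
      then have dW: "d \<in> W" "tip d \<in> W" using xy d by auto
      have "?Inv (W - {d})" using nl by (intro keep) auto
      moreover have "?Inv (W - {z. {d, z} \<in> edges})" using nl d(1) by (intro keep) (auto simp: neighbour_D dest: apart apart_apex)
      moreover have "{tip d, d} \<in> edges" "\<forall>z\<in>W. {tip d, z} \<in> edges \<longrightarrow> z = d \<or> {d, z} \<in> edges"
        using d(1) by (auto simp: neighbour_D neighbour_tip)
      ultimately show ?thesis using dW by blast
    qed
  qed
qed

subsection \<open>The Cameron--Walker property\<close>

lemma finite_edges: "finite edges"
  using simple_graph unfolding simple_graph_def by (auto intro: finite_subset[of _ "Pow verts"])

definition canonical_matching :: "'v set set" where
  "canonical_matching = (\<lambda>v. {v, leaf v}) ` S \<union> (\<lambda>d. {d, tip d}) ` D"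

lemma card_canonical_matching: "card canonical_matching = card S + card D"
proof -
  have "inj_on (\<lambda>v. {v, leaf v}) S" "inj_on (\<lambda>d. {d, tip d}) D"
    by (auto simp: inj_on_def doubleton_eq_iff dest: apart)
  moreover have "(\<lambda>v. {v, leaf v}) ` S \<inter> (\<lambda>d. {d, tip d}) ` D = {}"
    by (auto simp: doubleton_eq_iff dest: apart)
  ultimately show ?thesis unfolding canonical_matching_def using fin by (simp add: card_Un_disjoint card_image)
qed

lemma induced_matching_canonical_matching: "induced_matching edges canonical_matching"
proof -
  have sub: "canonical_matching \<subseteq> edges" by (auto simp: canonical_matching_def edge_iff arc_def)
  have rep: "\<exists>k\<in>S \<union> D. e = {k, if k \<in> S then leaf k else tip k}" if "e \<in> canonical_matching" for e
    using that disj(3) by (auto simp: canonical_matching_def)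
  have nb: "y \<in> {k, if k \<in> S then leaf k else tip k} \<or> y \<in> U"
    if "k \<in> S \<union> D" "x \<in> {k, if k \<in> S then leaf k else tip k}" "{x, y} \<in> edges" for k x y
    using that apart(3) by (auto simp: neighbour_support neighbour_leaf neighbour_D neighbour_tip apex
        split: if_splits dest: adjacency_ends)
  have notU: "x \<notin> U" if "k \<in> S \<union> D" "x \<in> {k, if k \<in> S then leaf k else tip k}" for k x
    using that by (auto split: if_splits dest: apart)
  have disjoint: "e \<inter> e' = {}" if "e \<in> canonical_matching" "e' \<in> canonical_matching" "e \<noteq> e'" for e e'
    using that by (auto simp: canonical_matching_def inj_iff dest: apart)
  have "\<not> (\<exists>f\<in>edges. f \<inter> e \<noteq> {} \<and> f \<inter> e' \<noteq> {})"
    if e: "e \<in> canonical_matching" "e' \<in> canonical_matching" "e \<noteq> e'" for e e'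
  proof
    assume "\<exists>f\<in>edges. f \<inter> e \<noteq> {} \<and> f \<inter> e' \<noteq> {}"
    then obtain f x y where f: "f \<in> edges" "x \<in> f" "x \<in> e" "y \<in> f" "y \<in> e'" by blast
    have "x \<noteq> y" using disjoint[OF e] f by blast
    moreover obtain a b where "f = {a, b}" using f(1) by (auto simp: edges_def)
    ultimately have "{x, y} \<in> edges" using f by (auto simp: insert_commute)
    obtain k where k: "k \<in> S \<union> D" "e = {k, if k \<in> S then leaf k else tip k}" using rep[OF e(1)] by blast
    obtain l where l: "l \<in> S \<union> D" "e' = {l, if l \<in> S then leaf l else tip l}" using rep[OF e(2)] by blast
    have "y \<in> e \<or> y \<in> U" using nb[OF k(1), of x y] f(3) \<open>{x, y} \<in> edges\<close> k(2) by simp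
    moreover have "y \<notin> U" using notU[OF l(1), of y] f(5) l(2) by simp
    ultimately show False using disjoint[OF e] f(5) by blast
  qed
  then show ?thesis using sub disjoint by (auto simp: induced_matching_def matching_def)
qed

text \<open>The edges fall into \<open>|S| + |D|\<close> classes of pairwise intersecting edges, namely the edges at a vertex of \<open>S\<close> and the
  edges of a triangle. The map \<open>\<kappa>\<close> names the class of an edge.\<close>

lemma matching_card_le:
  assumes M: "matching edges M"
  shows "card M \<le> card S + card D"
proof -
  define \<kappa> where "\<kappa> e = (SOME k. (k \<in> S \<and> k \<in> e) \<or> (k \<in> D \<and> e \<in> {{k, tip k}, {k, apex k}, {tip k, apex k}}))" for e
  have \<kappa>: "(\<kappa> e \<in> S \<and> \<kappa> e \<in> e) \<or> (\<kappa> e \<in> D \<and> e \<in> {{\<kappa> e, tip (\<kappa> e)}, {\<kappa> e, apex (\<kappa> e)}, {tip (\<kappa> e), apex (\<kappa> e)}})"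
    if e: "e \<in> edges" for e
    unfolding \<kappa>_def
  proof (rule someI_ex)
    obtain x y where "e = {x, y}" "arc x y" using e by (auto simp: edges_def)
    then show "\<exists>k. (k \<in> S \<and> k \<in> e) \<or> (k \<in> D \<and> e \<in> {{k, tip k}, {k, apex k}, {tip k, apex k}})"
      using N by (auto simp: arc_def)
  qed
  have ME: "M \<subseteq> edges" using M by (simp add: matching_def)
  have "inj_on \<kappa> M"
  proof (rule inj_onI, rule ccontr)
    fix e f assume ef: "e \<in> M" "f \<in> M" "\<kappa> e = \<kappa> f" "e \<noteq> f"
    then have "e \<inter> f = {}" using M by (auto simp: matching_def)
    moreover have "e \<inter> f \<noteq> {}"
    proof -
      define k where "k = \<kappa> e"
      have "(k \<in> S \<and> k \<in> e) \<or> (k \<in> D \<and> e \<in> {{k, tip k}, {k, apex k}, {tip k, apex k}})"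
        "(k \<in> S \<and> k \<in> f) \<or> (k \<in> D \<and> f \<in> {{k, tip k}, {k, apex k}, {tip k, apex k}})"
        using \<kappa>[of e] \<kappa>[of f] ef ME unfolding k_def by auto
      moreover have "\<not> (k \<in> S \<and> k \<in> D)" using disj(3) by blast
      ultimately consider "k \<in> e" "k \<in> f" | "e \<in> {{k, tip k}, {k, apex k}, {tip k, apex k}}"
        "f \<in> {{k, tip k}, {k, apex k}, {tip k, apex k}}" by argo
      then show ?thesis by cases auto
    qed
    ultimately show False by simp
  qed
  moreover have "\<kappa> ` M \<subseteq> S \<union> D" using \<kappa> ME by blast
  ultimately have "card M \<le> card (S \<union> D)" using fin by (intro card_inj_on_le) auto
  then show ?thesis using fin disj(3) by (simp add: card_Un_disjoint)
qed

lemma matching_numbers: "matching_number edges = card S + card D" "induced_matching_number edges = card S + card D"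
proof -
  have sub: "{M. induced_matching edges M} \<subseteq> {M. matching edges M}" by (auto simp: induced_matching_def)
  have "{M. matching edges M} \<subseteq> Pow edges" by (auto simp: matching_def)
  then have fm: "finite {M. matching edges M}" using finite_edges by (auto intro: finite_subset)
  then have fi: "finite {M. induced_matching edges M}" using sub finite_subset by blast
  have mem: "card S + card D \<in> card ` {M. induced_matching edges M}"
    using induced_matching_canonical_matching card_canonical_matching by (metis image_eqI mem_Collect_eq)
  show "matching_number edges = card S + card D"
    unfolding matching_number_def using fm mem sub matching_card_le by (intro Max_eqI) auto
  show "induced_matching_number edges = card S + card D"
    unfolding induced_matching_number_def using fi mem sub matching_card_le by (intro Max_eqI) auto
qed

text \<open>The vertex \<open>c\<close>, adjacent to all of \<open>S\<close>, links all vertices. A pendant edge excludes a star triangle, and two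
  disjoint edges exclude a star.\<close>

lemma cameron_walker:
  assumes c: "c \<in> U" "\<And>v. v \<in> S \<Longrightarrow> (v, c) \<in> N" and S: "S \<noteq> {}"
    and dom: "\<And>u. u \<in> U \<Longrightarrow> \<exists>v\<in>S. (v, u) \<in> N"
    and big: "card S \<ge> 2 \<or> D \<noteq> {}"
  shows "cameron_walker verts edges"
proof -
  let ?r = "{(x, y). {x, y} \<in> edges}"
  have symr: "sym ?r" by (auto simp: sym_def insert_commute)
  have s: "(v, c) \<in> ?r\<^sup>*" if "v \<in> S" for v
    using c that by (auto simp: edge_iff arc_def)
  have u: "(u, c) \<in> ?r\<^sup>*" if u: "u \<in> U" for u
  proof -
    obtain v where v: "v \<in> S" "(v, u) \<in> N" using dom[OF u] by blast
    then have "(u, v) \<in> ?r" by (simp add: edge_iff arc_def)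
    then show ?thesis using s[OF v(1)] by (rule converse_rtrancl_into_rtrancl)
  qed
  have to_c: "(x, c) \<in> ?r\<^sup>*" if "x \<in> verts" for x
    using that
  proof (cases rule: verts_cases)
    case (2 v)
    then have "(x, v) \<in> ?r" by (simp add: edge_iff arc_def)
    then show ?thesis using s[OF 2(1)] by (rule converse_rtrancl_into_rtrancl)
  next
    case 4
    then have "(x, apex x) \<in> ?r" by (simp add: edge_iff arc_def)
    then show ?thesis using u[OF apex[OF 4]] by (rule converse_rtrancl_into_rtrancl)
  next
    case (5 d)
    then have "(x, apex d) \<in> ?r" by (auto simp: edge_iff arc_def)
    then show ?thesis using u[OF apex[OF 5(1)]] by (rule converse_rtrancl_into_rtrancl)
  qed (use s u in auto)
  have "(x, y) \<in> ?r\<^sup>*" if "x \<in> verts" "y \<in> verts" for x y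
  proof -
    have "(c, y) \<in> ?r\<^sup>*" using to_c[OF that(2)] symr by (meson sym_rtrancl symD)
    then show ?thesis using to_c[OF that(1)] by (rule rtrancl_trans[rotated])
  qed
  moreover have "verts \<noteq> {}" using S by (auto simp: verts_def)
  ultimately have conn: "connected_graph verts edges" by (auto simp: connected_graph_def)
  obtain v where v: "v \<in> S" using S by blast
  have leaf_edge: "{v, leaf v} \<in> edges" if "v \<in> S" for v using that by (auto simp: edge_iff arc_def)
  have ns: "\<not> star_graph verts edges"
  proof
    assume "star_graph verts edges"
    then obtain z where z: "\<And>e. e \<in> edges \<Longrightarrow> z \<in> e" by (auto simp: star_graph_def)
    show False
    proof (cases "D = {}")
      case False
      then obtain d where d: "d \<in> D" by blast
      then have dt: "{d, tip d} \<in> edges" by (auto simp: edge_iff arc_def)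
      show False using z[OF dt] z[OF leaf_edge[OF v]] v d by (auto dest: apart)
    next
      case True
      then have "card S \<ge> 2" using big by blast
      then have "card (S - {v}) \<noteq> 0" using v fin by (simp add: card_Diff_singleton)
      then obtain w where w: "w \<in> S" "w \<noteq> v" by (metis card.empty Diff_iff ex_in_conv singletonI)
      then show False using z[OF leaf_edge[OF v]] z[OF leaf_edge[OF w(1)]] v by (auto simp: inj_iff dest: apart)
    qed
  qed
  have nt: "\<not> star_triangle verts edges"
    unfolding star_triangle_def
  proof (intro notI, elim conjE exE)
    fix z T assume "\<forall>t\<in>T. card t = 3 \<and> z \<in> t" "edges = {e. card e = 2 \<and> (\<exists>t\<in>T. e \<subseteq> t)}"
    then have T: "\<forall>t\<in>T. card t = 3" "edges = {e. card e = 2 \<and> (\<exists>t\<in>T. e \<subseteq> t)}" by blast+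
    obtain t where t: "t \<in> T" "{v, leaf v} \<subseteq> t" using leaf_edge[OF v] T(2) by blast
    have "card {v, leaf v} = 2" using leaf_edge[OF v] simple_graph by (auto simp: simple_graph_def)
    then have "t \<noteq> {v, leaf v}" using T(1) t(1) by force
    then obtain x where x: "x \<in> t" "x \<noteq> v" "x \<noteq> leaf v" using t by blast
    then have "{leaf v, x} \<in> edges" unfolding T(2) using t by auto
    then show False using neighbour_leaf[OF v] x by blast
  qed
  show ?thesis
    unfolding cameron_walker_def using simple_graph conn ns nt matching_numbers by simp
qed

end

text \<open>The smallest maximal independent set, of size \<open>r\<close>, bounds the depth from above, and the vertex decomposition
  bounds it from below by the same number.\<close>

lemma cw_structure_depth_krull_dim:
  fixes S :: "'v::linorder set"
  assumes "cw_structure S leaf U D tip apex N"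
  defines "V \<equiv> cw_structure.verts S leaf U D tip" and "E \<equiv> cw_structure.edges S leaf D tip apex N"
  assumes r: "\<And>A. A \<subseteq> S \<Longrightarrow> r \<le> cw_structure.cost S U D apex N A"
    and A0: "A0 \<subseteq> S" "cw_structure.cost S U D apex N A0 = r"
  shows "depth (edge_ring V E :: ('v, 'k::field) mpolynomial set ring) (edge_ring_max_ideal V E) = enat r"
    and "krull_dim (edge_ring V E :: ('v, 'k::field) mpolynomial set ring) = enat (card S + card D + card (U - apex ` D))"
proof -
  interpret cw_structure S leaf U D tip apex N by fact
  obtain X where X: "X \<in> independent_sets V E" "card X = r"
    "\<And>Y. Y \<in> independent_sets V E \<Longrightarrow> X \<subseteq> Y \<Longrightarrow> Y = X"
    using maximal_independent_attained[OF A0(1)] A0(2) unfolding V_def E_def by metis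
  have G: "Defs.simple_graph V E" unfolding V_def E_def by (rule simple_graph)
  show "depth (edge_ring V E :: ('v, 'k) mpolynomial set ring) (edge_ring_max_ideal V E) = enat r"
  proof (rule antisym)
    show "depth (edge_ring V E :: ('v, 'k) mpolynomial set ring) (edge_ring_max_ideal V E) \<le> enat r"
      using depth_edge_ring_le[OF G X(1,3)] X(2) by simp
    show "enat r \<le> depth (edge_ring V E :: ('v, 'k) mpolynomial set ring) (edge_ring_max_ideal V E)"
      using vertex_decomposable[of r] r unfolding V_def E_def by (intro depth_edge_ring_ge simple_graph) auto
  qed
  show "krull_dim (edge_ring V E :: ('v, 'k) mpolynomial set ring) = enat (card S + card D + card (U - apex ` D))"
    using krull_dim_edge_ring[OF G, of "leaf ` S \<union> D \<union> (U - apex ` D)"] independent_attained independent_card_le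
    unfolding V_def E_def by simp
qed

section \<open>Every Cameron--Walker graph has this shape\<close>

lemma connected_graph_closed:
  assumes conn: "connected_graph V E" and C: "C \<subseteq> V" "C \<noteq> {}"
    and closed: "\<And>x y. x \<in> C \<Longrightarrow> {x, y} \<in> E \<Longrightarrow> y \<in> C"
  shows "C = V"
proof -
  obtain c where c: "c \<in> C" using C by blast
  have "v \<in> C" if "v \<in> V" for v
  proof -
    have "(c, v) \<in> {(x, y). {x, y} \<in> E}\<^sup>*" using conn c C that by (auto simp: connected_graph_def)
    then show ?thesis by (induction rule: rtrancl_induct) (use c closed in auto)
  qed
  then show ?thesis using C by blast
qed

text \<open>Let \<open>M\<close> be an induced matching that is a maximum matching, and \<open>U\<close> the set of unmatched vertices. The set \<open>U\<close> is
  independent, and no edge joins different edges of \<open>M\<close>. If the ends \<open>p\<close>, \<open>q\<close> of an edge of \<open>M\<close> had distinct neighbours \<open>u\<close>, \<open>u'\<close>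
  in \<open>U\<close>, then \<open>u p q u'\<close> would be an augmenting path. Therefore either only one end has
  neighbours in \<open>U\<close>, which makes the edge pendant, or both ends have the same single neighbour in \<open>U\<close>, which makes a
  triangle. An edge without neighbours in \<open>U\<close> would be a component, which five vertices exclude.
  Finally, without pendant edges connectedness leaves a star triangle, and with one pendant edge and no
  triangle a star.\<close>

lemma cameron_walker_structure:
  fixes V :: "'v set"
  assumes CW: "cameron_walker V E" and big: "card V \<ge> 5"
  obtains S leaf U D tip apex N where "cw_structure S leaf U D tip apex N"
    "V = cw_structure.verts S leaf U D tip" "E = cw_structure.edges S leaf D tip apex N"
    "S \<noteq> {}" "U \<noteq> {}" "N `` S = U" "card S \<ge> 2 \<or> D \<noteq> {}"
proof -
  have G: "simple_graph V E" and conn: "connected_graph V E" and im: "induced_matching_number E = matching_number E"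
    and ns: "\<not> star_graph V E" and nt: "\<not> star_triangle V E"
    using CW by (auto simp: cameron_walker_def)
  have finV: "finite V" and eV: "\<And>e. e \<in> E \<Longrightarrow> e \<subseteq> V" and e2: "\<And>e. e \<in> E \<Longrightarrow> card e = 2"
    using G by (auto simp: simple_graph_def)
  have finE: "finite E" using finV eV by (auto intro: finite_subset[of _ "Pow V"])
  have pair: "\<exists>x y. e = {x, y} \<and> x \<noteq> y" if "e \<in> E" for e using e2[OF that] by (meson card_2_iff)
  have neq: "x \<noteq> y" if "{x, y} \<in> E" for x y using e2[OF that] by auto
  have sym: "{x, y} \<in> E \<longleftrightarrow> {y, x} \<in> E" for x y by (simp add: insert_commute)
  have inV: "x \<in> V" "y \<in> V" if "{x, y} \<in> E" for x y using eV[OF that] by auto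
  have fm: "finite {M. matching E M}" using finE by (auto simp: matching_def intro: finite_subset[of _ "Pow E"])
  have fi: "finite {M. induced_matching E M}"
    using fm by (rule finite_subset[rotated]) (auto simp: induced_matching_def)
  have "induced_matching E {}" by (simp add: induced_matching_def matching_def)
  then have "induced_matching_number E \<in> card ` {M. induced_matching E M}"
    unfolding induced_matching_number_def using fi by (intro Max_in) auto
  then obtain M where M: "induced_matching E M" "card M = matching_number E" using im by auto
  have mle: "card M' \<le> card M" if "matching E M'" for M'
    unfolding M(2) matching_number_def using fm that by (intro Max_ge) auto
  have ME: "M \<subseteq> E" and Mdisj: "\<And>e e'. e \<in> M \<Longrightarrow> e' \<in> M \<Longrightarrow> e \<noteq> e' \<Longrightarrow> e \<inter> e' = {}"
    and Mind: "\<And>e e' f. e \<in> M \<Longrightarrow> e' \<in> M \<Longrightarrow> e \<noteq> e' \<Longrightarrow> f \<in> E \<Longrightarrow> f \<inter> e \<noteq> {} \<Longrightarrow> f \<inter> e' \<noteq> {} \<Longrightarrow> False"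
    using M(1) unfolding induced_matching_def matching_def by blast+
  have finM: "finite M" using ME finE finite_subset by blast
  define U where "U = V - \<Union>M"
  have inner: "{x, y} \<in> M" if xy: "{x, y} \<in> E" "x \<in> \<Union>M" "y \<in> \<Union>M" for x y
  proof -
    obtain e e' where e: "e \<in> M" "x \<in> e" "e' \<in> M" "y \<in> e'" using xy by blast
    then have "e = e'" using Mind[of e e' "{x, y}"] xy(1) by blast
    then have "e = {x, y}" using pair[of e] e ME neq[OF xy(1)] by blast
    then show ?thesis using e by blast
  qed
  have indep: "{x, y} \<notin> E" if "x \<in> U" "y \<in> U" for x y
  proof
    assume xy: "{x, y} \<in> E"
    have new: "{x, y} \<notin> M" using that by (auto simp: U_def)
    have "matching E (insert {x, y} M)"
      using ME Mdisj xy that by (auto simp: matching_def U_def)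
    then show False using mle new finM by fastforce
  qed
  \<comment> \<open>exchanging \<open>{p, q}\<close> for \<open>{p, u}\<close> and \<open>{q, u'}\<close> would enlarge \<open>M\<close>\<close>
  have augment: False if pq: "{p, q} \<in> M" and u: "u \<in> U" "u' \<in> U" "u \<noteq> u'" and e: "{p, u} \<in> E" "{q, u'} \<in> E" for p q u u'
  proof -
    let ?M = "insert {p, u} (insert {q, u'} (M - {{p, q}}))"
    have pqne: "p \<noteq> q" using neq pq ME by blast
    have pU: "p \<notin> U" "q \<notin> U" using pq by (auto simp: U_def)
    have ouU: "u \<notin> e" "u' \<notin> e" if "e \<in> M" for e using u that by (auto simp: U_def)
    have opq: "p \<notin> e" "q \<notin> e" if "e \<in> M - {{p, q}}" for e using Mdisj[OF pq, of e] that by auto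
    have "matching E ?M"
      unfolding matching_def
    proof (intro conjI ballI impI)
      show "?M \<subseteq> E" using ME e by blast
      fix a b assume ab: "a \<in> ?M" "b \<in> ?M" "a \<noteq> b"
      have d1: "{p, u} \<inter> {q, u'} = {}" using pqne pU u by auto
      have d2: "{p, u} \<inter> a = {}" "{q, u'} \<inter> a = {}" if "a \<in> M - {{p, q}}" for a
        using opq[OF that] ouU that by auto
      have d3: "a \<inter> b = {}" if "a \<in> M - {{p, q}}" "b \<in> M - {{p, q}}" using Mdisj ab(3) that by blast
      show "a \<inter> b = {}" using ab d1 d2[of a] d2[of b] d3 by (elim insertE) (simp_all add: Int_commute)
    qed
    moreover have "{p, u} \<notin> M" "{q, u'} \<notin> M" using ouU by blast+
    moreover have "{p, u} \<noteq> {q, u'}" using pqne pU u by (auto simp: doubleton_eq_iff)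
    ultimately have "card ?M = Suc (Suc (card M - 1))" using finM pq by (simp add: card_Diff_singleton)
    moreover have "card M > 0" using finM pq card_gt_0_iff by blast
    ultimately show False using mle[OF \<open>matching E ?M\<close>] by simp
  qed
  define mate where "mate x = (SOME y. {x, y} \<in> M)" for x
  have mate: "{x, mate x} \<in> M" if x: "x \<in> \<Union>M" for x
  proof -
    obtain e where e: "e \<in> M" "x \<in> e" using x by blast
    then obtain a b where "e = {a, b}" using pair[of e] ME by blast
    then have "\<exists>y. {x, y} \<in> M" using e by (auto simp: insert_commute)
    then show ?thesis unfolding mate_def by (rule someI_ex)
  qed
  have mate_eq: "y = mate x" if "{x, y} \<in> M" for x y
  proof -
    have "x \<in> \<Union>M" using that by blast
    then have "{x, y} = {x, mate x}" using Mdisj[OF that mate[OF \<open>x \<in> \<Union>M\<close>]] by blast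
    then show ?thesis using neq[of x y] neq[of x "mate x"] that mate[OF \<open>x \<in> \<Union>M\<close>] ME
      by (auto simp: doubleton_eq_iff)
  qed
  have mate_mem: "mate x \<in> \<Union>M" if "x \<in> \<Union>M" for x using mate[OF that] by blast
  have mate_mate: "mate (mate x) = x" if "x \<in> \<Union>M" for x
    using mate_eq[of "mate x" x] mate[OF that] by (simp add: insert_commute)
  have mate_ne: "mate x \<noteq> x" if "x \<in> \<Union>M" for x using neq[of x "mate x"] mate[OF that] ME by auto
  have mateE: "{x, mate x} \<in> E" if "x \<in> \<Union>M" for x using mate[OF that] ME by blast
  have nbr: "y = mate x \<or> y \<in> U" if "x \<in> \<Union>M" "{x, y} \<in> E" for x y
    using inner[OF that(2,1)] mate_eq inV[OF that(2)] by (auto simp: U_def)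
  define touch where "touch x \<longleftrightarrow> (\<exists>u\<in>U. {x, u} \<in> E)" for x
  \<comment> \<open>a matching edge has a neighbour in \<open>U\<close> at one of its ends, for otherwise it is a component\<close>
  have touched: "touch x \<or> touch (mate x)" if x: "x \<in> \<Union>M" for x
  proof (rule ccontr)
    assume n: "\<not> ?thesis"
    have "{x, mate x} = V"
    proof (rule connected_graph_closed[OF conn])
      show "{x, mate x} \<subseteq> V" using eV[OF mateE[OF x]] .
      fix a b assume "a \<in> {x, mate x}" "{a, b} \<in> E"
      then show "b \<in> {x, mate x}"
        using n nbr[OF x, of b] nbr[OF mate_mem[OF x], of b] mate_mate[OF x] by (auto simp: touch_def)
    qed simp
    then have "card V \<le> 2" by (metis card_2_iff mate_ne[OF x] order.refl)
    then show False using big by simp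
  qed
  \<comment> \<open>\<open>S\<close> holds the support vertices of the pendant edges, \<open>B\<close> the base vertices of triangles, and \<open>D\<close> one base vertex of each triangle\<close>
  define S where "S = {x \<in> \<Union>M. touch x \<and> \<not> touch (mate x)}"
  define B where "B = {x \<in> \<Union>M. touch x \<and> touch (mate x)}"
  define pick where "pick e = (SOME x. x \<in> e)" for e :: "'v set"
  define D where "D = {x \<in> B. pick {x, mate x} = x}"
  define apex where "apex x = (SOME u. u \<in> U \<and> {x, u} \<in> E)" for x
  define N where "N = {(v, u). v \<in> S \<and> u \<in> U \<and> {v, u} \<in> E}"
  have apexB: "apex x \<in> U" "{x, apex x} \<in> E" if "x \<in> B" for x
  proof -
    have "\<exists>u. u \<in> U \<and> {x, u} \<in> E" using that by (auto simp: B_def touch_def)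
    then have "apex x \<in> U \<and> {x, apex x} \<in> E" unfolding apex_def by (rule someI_ex)
    then show "apex x \<in> U" "{x, apex x} \<in> E" by auto
  qed
  have mateB: "mate x \<in> B" if "x \<in> B" for x
    using that mate_mem mate_mate by (auto simp: B_def)
  \<comment> \<open>a second neighbour \<open>w\<close> of \<open>x\<close> and the neighbour of \<open>mate x\<close> would give an augmenting path\<close>
  have apex_unique: "u = apex x \<and> u = apex (mate x)" if "x \<in> B" "u \<in> U" "{x, u} \<in> E" for x u
  proof -
    have m: "{x, mate x} \<in> M" "{mate x, x} \<in> M" using that mate by (auto simp: B_def insert_commute)
    have a: "apex (mate x) = w" if "w \<in> U" "{x, w} \<in> E" for w
      using augment[OF m(1) that(1) apexB(1)[OF mateB[OF \<open>x \<in> B\<close>]] _ that(2) apexB(2)[OF mateB[OF \<open>x \<in> B\<close>]]] by blast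
    show ?thesis using a[OF that(2,3)] a[OF apexB[OF that(1)]] by simp
  qed
  have apex_mate: "apex (mate x) = apex x" if "x \<in> B" for x
    using apex_unique[OF that apexB[OF that]] by simp
  have pick: "pick {x, y} = x \<or> pick {x, y} = y" for x y
    unfolding pick_def by (rule someI2[of _ x]) auto
  have BD: "x \<in> D \<or> x \<in> mate ` D" if "x \<in> B" for x
  proof (cases "pick {x, mate x} = x")
    case False
    then have "pick {mate x, mate (mate x)} = mate x"
      using pick[of x "mate x"] mate_mate[of x] that by (simp add: B_def insert_commute)
    then have "mate x \<in> D" using mateB[OF that] by (simp add: D_def)
    then show ?thesis using mate_mate[of x] that by (auto simp: B_def intro: rev_image_eqI)
  qed (use that in \<open>simp add: D_def\<close>)
  have DB: "D \<subseteq> B" by (auto simp: D_def)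
  have Dm: "mate x \<notin> D" if "x \<in> D" for x
  proof
    assume "mate x \<in> D"
    moreover have x: "x \<in> \<Union>M" using that by (simp add: D_def B_def)
    ultimately have "pick {mate x, x} = mate x" using mate_mate[OF x] by (simp add: D_def)
    then show False using that mate_ne[OF x] by (simp add: D_def insert_commute)
  qed
  have SM: "S \<subseteq> \<Union>M" and BM: "B \<subseteq> \<Union>M" by (auto simp: S_def B_def)
  have UM: "U \<inter> \<Union>M = {}" by (auto simp: U_def)
  have mS: "mate x \<notin> S \<and> mate x \<notin> B" if "x \<in> S" for x
    using that mate_mate by (auto simp: S_def B_def)
  have injmate: "inj_on mate (\<Union>M)" by (rule inj_on_inverseI[of _ mate]) (rule mate_mate)
  have finUM: "finite (\<Union>M)" using ME eV finV by (meson Sup_le_iff finite_subset subsetD)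
  have SB: "S \<inter> B = {}" by (auto simp: S_def B_def)
  have mateD: "mate ` D \<subseteq> B" using DB mateB by blast
  have mateSM: "mate ` S \<subseteq> \<Union>M" using SM mate_mem by blast
  interpret cw: cw_structure S mate U D mate apex N
  proof
    show "finite S" "finite U" "finite D"
      using finUM finV SM DB BM by (auto simp: U_def intro: finite_subset)
    show "inj_on mate S" "inj_on mate D"
      using inj_on_subset[OF injmate SM] inj_on_subset[OF injmate subset_trans[OF DB BM]] .
    show "S \<inter> mate ` S = {}" using mS by blast
    show "S \<inter> U = {}" using SM UM by blast
    show "S \<inter> D = {}" using DB SB by blast
    show "S \<inter> mate ` D = {}" using SB mateD by blast
    show "mate ` S \<inter> U = {}" using mateSM UM by blast
    show "mate ` S \<inter> D = {}" using mS DB by blast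
    show "mate ` S \<inter> mate ` D = {}" using mS mateD by blast
    show "U \<inter> D = {}" using DB BM UM by blast
    show "U \<inter> mate ` D = {}" using mateD BM UM by blast
    show "D \<inter> mate ` D = {}" using Dm by blast
    show "apex d \<in> U" if "d \<in> D" for d using apexB(1) DB that by blast
    show "N \<subseteq> S \<times> U" by (auto simp: N_def)
  qed
  have MV: "\<Union>M \<subseteq> V" using ME eV by blast
  have UMsplit: "x \<in> S \<or> x \<in> mate ` S \<or> x \<in> B" if "x \<in> \<Union>M" for x
  proof (cases "touch x")
    case True
    then show ?thesis using that by (auto simp: S_def B_def)
  next
    case False
    then have "mate x \<in> S" using touched[OF that] mate_mem[OF that] mate_mate[OF that] by (simp add: S_def)
    then show ?thesis using mate_mate[OF that] by (auto intro: rev_image_eqI)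
  qed
  have Vverts: "V = cw.verts"
  proof
    show "V \<subseteq> cw.verts"
    proof
      fix x assume x: "x \<in> V"
      show "x \<in> cw.verts"
      proof (cases "x \<in> U")
        case False
        then have "x \<in> \<Union>M" using x by (auto simp: U_def)
        then show ?thesis using UMsplit[of x] BD[of x] unfolding cw.verts_def by blast
      qed (simp add: cw.verts_def)
    qed
    have "U \<subseteq> V" by (auto simp: U_def)
    moreover have "S \<union> mate ` S \<union> D \<union> mate ` D \<subseteq> V"
      using SM mateSM subset_trans[OF DB BM] subset_trans[OF mateD BM] MV by blast
    ultimately show "cw.verts \<subseteq> V" unfolding cw.verts_def by blast
  qed
  have UB: "cw.arc x u \<or> cw.arc u x" if "x \<in> \<Union>M" "u \<in> U" "{x, u} \<in> E" for x u
  proof -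
    have t: "touch x" using that by (auto simp: touch_def)
    show ?thesis
    proof (cases "x \<in> B")
      case True
      have "u = apex x" "u = apex (mate x)" using apex_unique[OF True that(2,3)] by auto
      moreover have "x \<in> D \<or> (\<exists>d\<in>D. x = mate d \<and> mate x = d)"
      proof -
        have "mate (mate d) = d" if "d \<in> D" for d using mate_mate[of d] that DB BM by blast
        then show ?thesis using BD[OF True] by force
      qed
      ultimately show ?thesis unfolding cw.arc_def by auto
    next
      case False
      then have "x \<in> S" using t that by (auto simp: S_def B_def)
      then have "(x, u) \<in> N" using that by (simp add: N_def)
      then show ?thesis by (simp add: cw.arc_def)
    qed
  qed
  have Eedges: "E = cw.edges"
  proof (intro equalityI subsetI)
    fix e assume e: "e \<in> E"
    obtain x y where xy: "e = {x, y}" using pair[OF e] by blast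
    have exy: "{x, y} \<in> E" using e xy by simp
    have "cw.arc x y \<or> cw.arc y x"
    proof (cases "x \<in> U")
      case True
      then have "y \<in> \<Union>M" using indep[of x y] exy inV[OF exy] by (auto simp: U_def)
      then show ?thesis using UB[of y x] True exy sym by blast
    next
      case xM: False
      then have xM: "x \<in> \<Union>M" using inV[OF exy] by (auto simp: U_def)
      show ?thesis
      proof (cases "y \<in> U")
        case False
        then have y: "y = mate x" using nbr[OF xM exy] by blast
        have mm: "mate (mate v) = v" if "v \<in> S \<or> v \<in> D" for v using mate_mate[of v] that SM DB BM by blast
        consider "x \<in> S" | v where "v \<in> S" "x = mate v" | "x \<in> D" | d where "d \<in> D" "x = mate d"
          using UMsplit[OF xM] BD[of x] by blast
        then show ?thesis
        proof cases
          case (2 v)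
          then have "y = v" using y mm by simp
          then show ?thesis using 2 by (simp add: cw.arc_def)
        next
          case (4 d)
          then have "y = d" using y mm by simp
          then show ?thesis using 4 by (simp add: cw.arc_def)
        qed (use y in \<open>simp_all add: cw.arc_def\<close>)
      qed (use UB xM exy in blast)
    qed
    then show "e \<in> cw.edges" using cw.edge_iff[of x y] xy by simp
  next
    fix e assume "e \<in> cw.edges"
    then obtain x y where xy: "e = {x, y}" "cw.arc x y" by (auto simp: cw.edges_def)
    have DM: "d \<in> \<Union>M" "d \<in> B" if "d \<in> D" for d using that DB BM by blast+
    have "{x, y} \<in> E"
      using xy(2) unfolding cw.arc_def
    proof (elim disjE conjE bexE)
      assume "x \<in> S" "y = mate x"
      then show ?thesis using mateE[of x] SM by blast
    next
      assume "(x, y) \<in> N"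
      then show ?thesis by (simp add: N_def)
    next
      assume "x \<in> D" "y = mate x"
      then show ?thesis using mateE[of x] DM by blast
    next
      assume "x \<in> D" "y = apex x"
      then show ?thesis using apexB(2)[of x] DM by blast
    next
      fix d assume d: "d \<in> D" "x = mate d" "y = apex d"
      then show ?thesis using apexB(2)[OF mateB[OF DM(2)[OF d(1)]]] apex_mate[OF DM(2)[OF d(1)]] by simp
    qed
    then show "e \<in> E" using xy by simp
  qed
  have Sne: "S \<noteq> {}"
  proof
    assume S0: "S = {}"
    then have all: "x \<in> B" if "x \<in> \<Union>M" for x using UMsplit[OF that] by simp
    have "M \<noteq> {}"
    proof
      assume "M = {}"
      then have "U = V" by (simp add: U_def)
      obtain z where z: "z \<in> V" using big by fastforce
      have "{z} = V"
      proof (rule connected_graph_closed[OF conn])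
        show "y \<in> {z}" if "x \<in> {z}" "{x, y} \<in> E" for x y
          using indep[of x y] inV[OF that(2)] that(2) \<open>U = V\<close> by blast
      qed (use z in simp_all)
      then have "card V = card {z}" by simp
      then show False using big by simp
    qed
    then obtain e0 where e0: "e0 \<in> M" by blast
    then obtain x0 where x0: "x0 \<in> e0" using pair[of e0] ME by blast
    \<comment> \<open>without pendant edges the triangles at one apex form a component, hence the whole graph\<close>
    define c where "c = apex x0"
    have x0B: "x0 \<in> B" using all e0 x0 by blast
    have cU: "c \<in> U" using apexB[OF x0B] by (simp add: c_def)
    have VC: "insert c {x \<in> \<Union>M. apex x = c} = V"
    proof (rule connected_graph_closed[OF conn])
      show "insert c {x \<in> \<Union>M. apex x = c} \<subseteq> V" using cU MV by (auto simp: U_def)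
      fix x y assume x: "x \<in> insert c {x \<in> \<Union>M. apex x = c}" and xy: "{x, y} \<in> E"
      show "y \<in> insert c {x \<in> \<Union>M. apex x = c}"
      proof (cases "x = c")
        case True
        then have "y \<in> \<Union>M" using indep[of x y] xy cU inV[OF xy] by (auto simp: U_def)
        moreover have "c = apex y" using apex_unique[OF all[OF calculation] cU] xy True sym by simp
        ultimately show ?thesis by simp
      next
        case False
        then have xM: "x \<in> \<Union>M" "apex x = c" using x by auto
        show ?thesis
        proof (cases "y \<in> U")
          case True
          then show ?thesis using apex_unique[OF all[OF xM(1)] True xy] xM by simp
        next
          case False
          then have "y = mate x" using nbr[OF xM(1) xy] by simp
          then show ?thesis using apex_mate[OF all[OF xM(1)]] xM mate_mem by simp
        qed
      qed
    qed simp
    have rc: "apex x = c" if "x \<in> \<Union>M" for x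
    proof -
      have "x \<noteq> c" using that cU UM by blast
      moreover have "x \<in> insert c {x \<in> \<Union>M. apex x = c}" unfolding VC using that MV by blast
      ultimately show ?thesis by simp
    qed
    have Uc: "U = {c}"
    proof -
      have "x = c" if "x \<in> U" for x
      proof -
        have "x \<in> insert c {x \<in> \<Union>M. apex x = c}" unfolding VC using that by (simp add: U_def)
        then show ?thesis using that UM by blast
      qed
      then show ?thesis using cU by blast
    qed
    have ce: "c \<notin> e" if "e \<in> M" for e using cU that by (auto simp: U_def)
    define T where "T = insert c ` M"
    have "star_triangle V E"
      unfolding star_triangle_def
    proof (intro conjI exI[of _ c] exI[of _ T] G ballI impI)
      show "T \<noteq> {}" using e0 by (auto simp: T_def)
      have "insert c (\<Union>M) = V"
      proof
        show "insert c (\<Union>M) \<subseteq> V" using MV cU by (auto simp: U_def)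
        show "V \<subseteq> insert c (\<Union>M)" unfolding VC[symmetric] by blast
      qed
      moreover have "\<Union>T = insert c (\<Union>M)" using e0 unfolding T_def by blast
      ultimately show "V = \<Union>T" by simp
      fix t assume t: "t \<in> T"
      then obtain e where e: "e \<in> M" "t = insert c e" by (auto simp: T_def)
      have eE: "e \<in> E" using e(1) ME by blast
      have "card e = 2" "finite e" by (rule e2[OF eE], rule finite_subset[OF eV[OF eE] finV])
      then show "card t = 3" using ce[OF e(1)] e by simp
      show "c \<in> t" using e by simp
      fix t' assume t': "t' \<in> T" "t \<noteq> t'"
      then obtain e' where e': "e' \<in> M" "t' = insert c e'" by (auto simp: T_def)
      then have "e \<inter> e' = {}" using Mdisj[OF e(1) e'(1)] t' e by blast
      then show "t \<inter> t' = {c}" using e e' by auto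
    next
      show "E = {e. card e = 2 \<and> (\<exists>t\<in>T. e \<subseteq> t)}"
      proof (intro equalityI subsetI)
        fix e assume e: "e \<in> E"
        then obtain x y where xy: "e = {x, y}" "x \<noteq> y" using pair by blast
        have tri: "\<exists>t\<in>T. {x, y} \<subseteq> t" if "{x, y} \<in> E" "x \<in> \<Union>M" for x y
        proof -
          have "y = mate x \<or> y = c" using nbr[OF that(2,1)] Uc by auto
          then show ?thesis using mate[OF that(2)] by (auto simp: T_def)
        qed
        have "x \<in> \<Union>M \<or> y \<in> \<Union>M" using indep[of x y] e xy inV[of x y] by (auto simp: U_def)
        then have "\<exists>t\<in>T. e \<subseteq> t" using tri[of x y] tri[of y x] e xy sym by auto
        then show "e \<in> {e. card e = 2 \<and> (\<exists>t\<in>T. e \<subseteq> t)}" using e2[OF e] by simp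
      next
        fix e assume "e \<in> {e. card e = 2 \<and> (\<exists>t\<in>T. e \<subseteq> t)}"
        then obtain f x y where f: "f \<in> M" "e \<subseteq> insert c f" "e = {x, y}" "x \<noteq> y"
          by (auto simp: T_def card_2_iff)
        have cE: "{c, x} \<in> E" if "x \<in> f" for x
          using apexB(2)[OF all, of x] rc[of x] f that sym by auto
        obtain a b where ab: "f = {a, b}" using pair[of f] f ME by blast
        show "e \<in> E"
          using f cE ab ME sym by (auto simp: insert_commute)
      qed
    qed
    then show False using nt by simp
  qed
  have dom: "\<exists>v\<in>S. (v, u) \<in> N" if u: "u \<in> U" for u
  proof (rule ccontr)
    assume n: "\<not> ?thesis"
    \<comment> \<open>otherwise \<open>u\<close> and its triangles form a component that misses \<open>S\<close>\<close>
    let ?C = "insert u {x \<in> B. apex x = u}"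
    have "?C = V"
    proof (rule connected_graph_closed[OF conn])
      show "?C \<subseteq> V" using u BM MV by (auto simp: U_def)
      fix x y assume x: "x \<in> ?C" and xy: "{x, y} \<in> E"
      show "y \<in> ?C"
      proof (cases "x = u")
        case True
        then have yM: "y \<in> \<Union>M" using indep[of x y] xy u inV[OF xy] by (auto simp: U_def)
        have ty: "touch y" "{y, u} \<in> E" using xy True u sym by (auto simp: touch_def)
        have "y \<notin> S" using n ty u by (auto simp: N_def)
        then have "y \<in> B" using ty yM by (auto simp: S_def B_def)
        then show ?thesis using apex_unique[OF _ u ty(2)] by simp
      next
        case False
        then have xB: "x \<in> B" "apex x = u" using x by auto
        show ?thesis
        proof (cases "y \<in> U")
          case True
          then show ?thesis using apex_unique[OF xB(1) True xy] xB by simp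
        next
          case False
          then have "y = mate x" using nbr[OF _ xy] xB BM by auto
          then show ?thesis using apex_mate[OF xB(1)] xB mateB by simp
        qed
      qed
    qed simp
    then have "S \<subseteq> ?C" using SM MV by blast
    then show False using Sne SM UM u by (auto simp: S_def B_def)
  qed
  have NS: "N `` S = U" using dom by (auto simp: N_def)
  obtain v where v: "v \<in> S" using Sne by blast
  then obtain u where "u \<in> U" "{v, u} \<in> E" by (auto simp: S_def touch_def)
  then have Une: "U \<noteq> {}" by blast
  have two: "card S \<ge> 2 \<or> D \<noteq> {}"
  proof (rule ccontr)
    assume n: "\<not> ?thesis"
    then have "card S \<le> 1" and D0: "D = {}" by auto
    then have S1: "S = {v}" using v cw.fin(1) by (metis card_le_Suc0_iff_eq One_nat_def insertCI is_singletonI' is_singleton_def singletonD empty_iff)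
    \<comment> \<open>one pendant edge and no triangle: all edges contain \<open>v\<close>\<close>
    have star: "v \<in> e" if "e \<in> E" for e
      using that S1 D0 unfolding Eedges cw.edges_def cw.arc_def by (auto simp: N_def)
    have vu: "{v, mate v} \<in> E" using mateE SM v by blast
    have "star_graph V E"
      unfolding star_graph_def
    proof (intro conjI exI[of _ v] ballI G star)
      show "E \<noteq> {}" using vu by blast
      show "V = \<Union>E"
      proof (intro equalityI subsetI)
        fix x assume "x \<in> V"
        then show "x \<in> \<Union>E"
          unfolding Vverts
        proof (cases rule: cw.verts_cases)
          case 3
          then show ?thesis using dom[OF 3] by (auto simp: N_def)
        qed (use D0 S1 vu in auto)
      qed (use eV in blast)
    qed
    then show False using ns by simp
  qed
  show thesis
    by (rule that[OF cw.cw_structure_axioms Vverts Eedges Sne Une NS two])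
qed

section \<open>The pairs that occur\<close>

definition depth_dim_pairs :: "nat \<Rightarrow> (nat \<times> nat) set" where
  "depth_dim_pairs n = CW_2_dim n
       \<union> {(b, b) | b :: nat. real n / 3 < real b \<and> real b < real n / 2}
       \<union> {(a, b) | a b :: nat. 3 \<le> a \<and> int a \<le> \<lfloor>(real n - 1) / 2\<rfloor> \<and>
            max (real a) ((real n - real a) / 2) < real b \<and> real b \<le> real n - real a}"

lemma mem_depth_dim_pairs_iff:
  "(a, b) \<in> depth_dim_pairs n \<longleftrightarrow> (a, b) \<in> CW_2_dim n \<or> (a = b \<and> n < 3 * b \<and> 2 * b < n)
     \<or> (3 \<le> a \<and> 2 * a + 1 \<le> n \<and> a < b \<and> n < 2 * b + a \<and> a + b \<le> n)"
proof -
  have 1: "real n / 3 < real b \<longleftrightarrow> n < 3 * b" "real b < real n / 2 \<longleftrightarrow> 2 * b < n" for b by linarith+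
  have 2: "int a \<le> \<lfloor>(real n - 1) / 2\<rfloor> \<longleftrightarrow> 2 * a + 1 \<le> n"
    unfolding le_floor_iff by simp linarith
  have 3: "max (real a) ((real n - real a) / 2) < real b \<longleftrightarrow> a < b \<and> n < 2 * b + a"
    by (simp add: max_less_iff_conj) linarith
  have 4: "real b \<le> real n - real a \<longleftrightarrow> a + b \<le> n" by linarith
  show ?thesis
    unfolding depth_dim_pairs_def Un_iff by (auto simp: 1 2 3 4)
qed

text \<open>Here \<open>m\<close>, \<open>T\<close>, \<open>p\<close> and \<open>y\<close> count the pendant edges, the triangles, the vertices of \<open>U\<close> and the apices, and \<open>r\<close> is the
  depth. For \<open>r = 2\<close> the lower bound \<open>m + y \<le> r\<close> leaves few cases; if \<open>m = 1\<close>, the depth is a value of one of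
  the only two costs.\<close>

lemma structure_pair_mem:
  fixes n m T p y r :: nat
  assumes "n = 2 * m + 2 * T + p" "m \<ge> 1" "p \<ge> 1" "m \<ge> 2 \<or> T \<ge> 1"
    and "y \<le> p" "y \<le> T" "T \<ge> 1 \<longrightarrow> y \<ge> 1"
    and "m + y \<le> r" "r \<le> m + p" "r \<le> m + T" "m = 1 \<Longrightarrow> r = m + p \<or> r = m + T"
  shows "(r, m + T + (p - y)) \<in> depth_dim_pairs n"
proof -
  have "r \<ge> 2" using assms by linarith
  obtain z where z: "p = y + z" using assms(5) le_Suc_ex by blast
  have "r \<ge> 3 \<or> (r = 2 \<and> m = 1 \<and> p = 1) \<or> (r = 2 \<and> m = 1 \<and> T = 1) \<or> (r = 2 \<and> m = 2 \<and> T = 0)"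
  proof (cases "m = 1")
    case True
    then show ?thesis using assms(11) \<open>r \<ge> 2\<close> by auto
  next
    case False
    then have "m \<ge> 2" using assms(2) by simp
    then show ?thesis using assms(7,8) \<open>r \<ge> 2\<close> by (cases "T = 0") auto
  qed
  then consider "r = 2" "m = 1" "p = 1" | "r = 2" "m = 1" "T = 1" | "r = 2" "m = 2" "T = 0" | "r \<ge> 3"
    by blast
  then show ?thesis
  proof cases
    case 1
    then have "y = 1" using assms by linarith
    then show ?thesis using 1 assms(1,3) by (simp add: mem_depth_dim_pairs_iff CW_2_dim_def)
  next
    case 2
    then have "y = 1" using assms by linarith
    then show ?thesis using 2 assms(1,3) by (simp add: mem_depth_dim_pairs_iff CW_2_dim_def)
  next
    case 3
    then have "y = 0" using assms by linarith
    then show ?thesis using 3 assms(1,3) by (simp add: mem_depth_dim_pairs_iff CW_2_dim_def)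
  next
    case 4
    show ?thesis
    proof (cases "r = m + T + (p - y)")
      case True
      \<comment> \<open>equality of depth and dimension forces one triangle at each vertex of \<open>U\<close>\<close>
      then have "p = y" "T = p" using assms by linarith+
      then show ?thesis using True assms by (simp add: mem_depth_dim_pairs_iff)
    next
      case False
      then have "r < m + T + (p - y)" using assms by linarith
      moreover have "2 * r + 1 \<le> n" "n < 2 * (m + T + (p - y)) + r" "r + (m + T + (p - y)) \<le> n"
        using assms(1,2,3,8,10) by (simp_all add: z)
      ultimately show ?thesis using 4 by (simp add: mem_depth_dim_pairs_iff)
    qed
  qed
qed

lemma CW_depth_dim_subset:
  assumes n: "n \<ge> 5"
  shows "CW_depth_dim TYPE('k::field) n \<subseteq> map_prod enat enat ` depth_dim_pairs n"
proof
  fix x assume "x \<in> CW_depth_dim TYPE('k) n"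
  then obtain E where E: "cameron_walker {1..n} E"
    and x: "x = (depth (edge_ring {1..n} E :: (nat, 'k) mpolynomial set ring) (edge_ring_max_ideal {1..n} E),
      krull_dim (edge_ring {1..n} E :: (nat, 'k) mpolynomial set ring))"
    by (auto simp: CW_depth_dim_def CW_def Let_def)
  obtain S leaf U D tip apex N where cw: "cw_structure S leaf U D tip apex N"
    and V: "{1..n} = cw_structure.verts S leaf U D tip" and Eq: "E = cw_structure.edges S leaf D tip apex N"
    and ne: "S \<noteq> {}" "U \<noteq> {}" "N `` S = U" and big: "card S \<ge> 2 \<or> D \<noteq> {}"
    by (rule cameron_walker_structure[OF E]) (use n in auto)
  interpret cw_structure S leaf U D tip apex N by (rule cw)
  define r where "r = Min (cost ` Pow S)"
  have fin': "finite (cost ` Pow S)" "cost ` Pow S \<noteq> {}" using fin by auto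
  obtain A0 where A0: "A0 \<subseteq> S" "cost A0 = r" using Min_in[OF fin'] by (auto simp: r_def)
  have rle: "r \<le> cost A" if "A \<subseteq> S" for A unfolding r_def using fin' that by (intro Min_le) auto
  have pair: "x = (enat r, enat (card S + card D + card (U - apex ` D)))"
    unfolding x V Eq using cw_structure_depth_krull_dim[OF cw rle A0] by simp
  have pos: "card S \<ge> 1" "card U \<ge> 1" using ne fin by (auto simp: Suc_le_eq card_gt_0_iff)
  have "(r, card S + card D + (card U - card (apex ` D))) \<in> depth_dim_pairs n"
  proof (rule structure_pair_mem)
    show "n = 2 * card S + 2 * card D + card U" using card_verts by (simp flip: V)
    show "card S \<ge> 2 \<or> card D \<ge> 1" using big fin by (auto simp: Suc_le_eq card_gt_0_iff)
    show "card (apex ` D) \<le> card U" using apex fin by (intro card_mono) auto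
    show "card (apex ` D) \<le> card D" using fin by (intro card_image_le)
    show "card D \<ge> 1 \<longrightarrow> card (apex ` D) \<ge> 1" using fin by (auto simp: Suc_le_eq card_gt_0_iff)
    show "card S + card (apex ` D) \<le> r" using cost_ge[of A0] A0 by simp
    show "r \<le> card S + card U" using rle[of "{}"] cost_empty by simp
    show "r \<le> card S + card D" using rle[of S] cost_support[OF ne(3)] by simp
    show "r = card S + card U \<or> r = card S + card D" if "card S = 1"
    proof -
      have "A0 = {} \<or> A0 = S" using that A0(1) by (auto simp: card_1_singleton_iff)
      then show ?thesis using A0(2) cost_empty cost_support[OF ne(3)] by auto
    qed
  qed (rule pos)+
  then show "x \<in> map_prod enat enat ` depth_dim_pairs n"
    using pair card_bare_core by (auto simp: image_iff intro!: bexI[rotated])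
qed

lemma structure_realises:
  fixes S :: "nat set"
  assumes cw: "cw_structure S leaf U D tip apex N" and V: "cw_structure.verts S leaf U D tip = {1..n}"
    and c: "c \<in> U" "\<And>v. v \<in> S \<Longrightarrow> (v, c) \<in> N" and S: "S \<noteq> {}"
    and dom: "\<And>u. u \<in> U \<Longrightarrow> \<exists>v\<in>S. (v, u) \<in> N" and big: "card S \<ge> 2 \<or> D \<noteq> {}"
    and r: "\<And>A. A \<subseteq> S \<Longrightarrow> r \<le> cw_structure.cost S U D apex N A"
    and A0: "A0 \<subseteq> S" "cw_structure.cost S U D apex N A0 = r"
  shows "(enat r, enat (card S + card D + card (U - apex ` D))) \<in> CW_depth_dim TYPE('k::field) n"
proof -
  interpret cw_structure S leaf U D tip apex N by (rule cw)
  have "edges \<in> CW n" unfolding CW_def using cameron_walker[OF c S dom big] by (simp add: V)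
  then show ?thesis
    unfolding CW_depth_dim_def Let_def
    using cw_structure_depth_krull_dim[OF cw r A0, where 'k = 'k] by (auto simp: V image_iff intro!: bexI[of _ edges])
qed

text \<open>Consecutive blocks of numbers serve as \<open>S\<close>, its leaves, \<open>U\<close>, \<open>D\<close> and the tips. The first \<open>y\<close> elements of \<open>U\<close> are
  the apices; all but the last of them have exactly one triangle.\<close>

lemma standard_structure:
  fixes m p T y :: nat
  assumes y: "y \<le> p" "y \<le> T" "T \<ge> 1 \<longrightarrow> y \<ge> 1" and N: "N \<subseteq> {1..m} \<times> {2 * m + 1..2 * m + p}"
  defines "D \<equiv> {2 * m + p + 1..2 * m + p + T}" and "apex \<equiv> (\<lambda>d. 2 * m + min (d - (2 * m + p)) y)"
  shows "cw_structure {1..m} (\<lambda>v. m + v) {2 * m + 1..2 * m + p} D (\<lambda>d. d + T) apex N"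
    and "cw_structure.verts {1..m} (\<lambda>v. m + v) {2 * m + 1..2 * m + p} D (\<lambda>d. d + T) = {1..2 * m + 2 * T + p}"
    and "apex ` D = {2 * m + 1..2 * m + y}"
proof -
  have leaf: "(\<lambda>v. m + v) ` {1..m} = {m + 1..m + m}" by simp
  have tip: "(\<lambda>d. d + T) ` D = {2 * m + p + 1 + T..2 * m + p + T + T}" unfolding D_def by simp
  show cw: "cw_structure {1..m} (\<lambda>v. m + v) {2 * m + 1..2 * m + p} D (\<lambda>d. d + T) apex N"
  proof
    show "apex d \<in> {2 * m + 1..2 * m + p}" if "d \<in> D" for d
      using that y by (auto simp: D_def apex_def)
  qed (use N in \<open>auto simp: D_def\<close>)
  interpret cw_structure "{1..m}" "\<lambda>v. m + v" "{2 * m + 1..2 * m + p}" D "\<lambda>d. d + T" apex N by (rule cw)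
  show "verts = {1..2 * m + 2 * T + p}"
    unfolding verts_def leaf tip by (auto simp: D_def)
  show "apex ` D = {2 * m + 1..2 * m + y}"
  proof (intro equalityI subsetI)
    fix u assume "u \<in> {2 * m + 1..2 * m + y}"
    then have "u + p \<in> D" "apex (u + p) = u" using y by (auto simp: D_def apex_def)
    then show "u \<in> apex ` D" by force
  qed (use y in \<open>auto simp: D_def apex_def\<close>)
qed

text \<open>All of \<open>S\<close> is joined to all of \<open>U\<close>, so the cost is \<open>m + p\<close> for the empty set and \<open>m + T\<close> for any other.\<close>

lemma complete_structure_realises:
  fixes m p T y :: nat
  assumes "m \<ge> 1" "p \<ge> 1" "m \<ge> 2 \<or> T \<ge> 1" and y: "y \<le> p" "y \<le> T" "T \<ge> 1 \<longrightarrow> y \<ge> 1"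
  shows "(enat (m + min p T), enat (m + T + (p - y))) \<in> CW_depth_dim TYPE('k::field) (2 * m + 2 * T + p)"
proof -
  define N where "N = {1..m} \<times> {2 * m + 1..2 * m + p}"
  define D where "D = {2 * m + p + 1..2 * m + p + T}"
  define apex where "apex d = 2 * m + min (d - (2 * m + p)) y" for d
  note st = standard_structure[OF y, of N m, folded D_def, folded apex_def[abs_def]]
  have NN: "N \<subseteq> {1..m} \<times> {2 * m + 1..2 * m + p}" by (simp add: N_def)
  interpret cw_structure "{1..m}" "\<lambda>v. m + v" "{2 * m + 1..2 * m + p}" D "\<lambda>d. d + T" apex N
    using st(1)[OF NN] .
  have im: "N `` A = {2 * m + 1..2 * m + p}" if "A \<subseteq> {1..m}" "A \<noteq> {}" for A
    using that by (auto simp: N_def)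
  have cardD: "card D = T" by (simp add: D_def)
  have cost_ne: "cost A = m + T" if "A \<subseteq> {1..m}" "A \<noteq> {}" for A
  proof -
    have eq: "{d \<in> D. apex d \<in> {2 * m + 1..2 * m + p}} = D" using apex by blast
    show ?thesis unfolding cost_def im[OF that] eq cardD by simp
  qed
  have cost_e: "cost {} = m + p" using cost_empty by simp
  have "(enat (m + min p T), enat (card {1..m} + card D + card ({2 * m + 1..2 * m + p} - apex ` D)))
      \<in> CW_depth_dim TYPE('k) (2 * m + 2 * T + p)"
  proof (rule structure_realises[where c = "2 * m + p" and ?A0.0 = "if p \<le> T then {} else {1..m}"])
    show "cw_structure {1..m} (\<lambda>v. m + v) {2 * m + 1..2 * m + p} D (\<lambda>d. d + T) apex N" by (rule st(1)[OF NN])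
    show "verts = {1..2 * m + 2 * T + p}" by (rule st(2)[OF NN])
    show "m + min p T \<le> cost A" if "A \<subseteq> {1..m}" for A
      using cost_ne[OF that] cost_e by (cases "A = {}") auto
    show "cost (if p \<le> T then {} else {1..m}) = m + min p T"
      using cost_ne[of "{1..m}"] cost_e assms(1) by auto
    show "\<exists>v\<in>{1..m}. (v, u) \<in> N" if "u \<in> {2 * m + 1..2 * m + p}" for u
      using that assms(1) by (auto simp: N_def intro: bexI[of _ 1])
  qed (use assms in \<open>auto simp: N_def D_def\<close>)
  moreover have "card ({2 * m + 1..2 * m + p} - apex ` D) = p - y"
    using card_bare_core unfolding st(3)[OF NN] by simp
  ultimately show ?thesis by (simp add: cardD)
qed

text \<open>All triangles have the same apex \<open>2 m + 1\<close>, and \<open>1 \<in> S\<close> is joined to all other elements of \<open>U\<close>. Choosing \<open>A = {1}\<close> then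
  saves both the triangles and the elements of \<open>U\<close> other than the apex.\<close>

lemma skew_structure_realises:
  fixes m p T :: nat
  assumes "m \<ge> 2" "p \<ge> 2" "T \<ge> 1"
  shows "(enat (m + 1), enat (m + T + (p - 1))) \<in> CW_depth_dim TYPE('k::field) (2 * m + 2 * T + p)"
proof -
  define N where "N = {(v, u). v \<in> {1..m} \<and> u \<in> {2 * m + 1..2 * m + p} \<and> (v = 1 \<longrightarrow> u \<noteq> 2 * m + 1)}"
  define D where "D = {2 * m + p + 1..2 * m + p + T}"
  define apex where "apex d = 2 * m + min (d - (2 * m + p)) 1" for d
  have y: "1 \<le> p" "1 \<le> T" "T \<ge> 1 \<longrightarrow> 1 \<ge> (1::nat)" using assms by auto
  note st = standard_structure[OF y, of N m, folded D_def, folded apex_def[abs_def]]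
  have NN: "N \<subseteq> {1..m} \<times> {2 * m + 1..2 * m + p}" by (auto simp: N_def)
  interpret cw_structure "{1..m}" "\<lambda>v. m + v" "{2 * m + 1..2 * m + p}" D "\<lambda>d. d + T" apex N
    using st(1)[OF NN] .
  have cardD: "card D = T" by (simp add: D_def)
  have im1: "N `` {1} = {2 * m + 1..2 * m + p} - {2 * m + 1}" using assms by (auto simp: N_def)
  have apexD: "apex ` D = {2 * m + 1}" using st(3)[OF NN] by simp
  have cost1: "cost {1} = m + 1"
  proof -
    have "apex d = 2 * m + 1" if "d \<in> D" for d using imageI[OF that, of apex] unfolding apexD by simp
    then have "{d \<in> D. apex d \<in> N `` {1}} = {}" unfolding im1 by simp
    moreover have "{2 * m + 1..2 * m + p} - N `` {1} = {2 * m + 1}" unfolding im1 using assms by auto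
    ultimately show ?thesis unfolding cost_def by (simp only: card.empty) simp
  qed
  have "(enat (m + 1), enat (card {1..m} + card D + card ({2 * m + 1..2 * m + p} - apex ` D)))
      \<in> CW_depth_dim TYPE('k) (2 * m + 2 * T + p)"
  proof (rule structure_realises[where c = "2 * m + p" and ?A0.0 = "{1}"])
    show "cw_structure {1..m} (\<lambda>v. m + v) {2 * m + 1..2 * m + p} D (\<lambda>d. d + T) apex N" by (rule st(1)[OF NN])
    show "verts = {1..2 * m + 2 * T + p}" by (rule st(2)[OF NN])
    show "m + 1 \<le> cost A" for A using cost_ge[of A] apexD by simp
    show "\<exists>v\<in>{1..m}. (v, u) \<in> N" if "u \<in> {2 * m + 1..2 * m + p}" for u
      using that assms(1) by (auto simp: N_def intro: bexI[of _ 2])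
  qed (use assms cost1 in \<open>auto simp: N_def D_def\<close>)
  moreover have "card ({2 * m + 1..2 * m + p} - apex ` D) = p - 1"
    using card_bare_core unfolding apexD by simp
  ultimately show ?thesis by (simp add: cardD)
qed

text \<open>The parameters solve the equations for the number of vertices, the depth and the dimension. For
  \<open>3 \<le> a < b\<close> there are three cases. If \<open>2 b < n\<close>, all of \<open>U\<close> lies in triangles. Otherwise, if \<open>a + b = n\<close>, there are
  no triangles. In the remaining case, just one element of \<open>U\<close> lies in triangles and the skew graphs are used.\<close>

lemma depth_dim_pairs_realised:
  assumes n: "n \<ge> 5" and ab: "(a, b) \<in> depth_dim_pairs n"
  shows "(enat a, enat b) \<in> CW_depth_dim TYPE('k::field) n"
proof -
  have complete: "(enat a, enat b) \<in> CW_depth_dim TYPE('k) n"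
    if "m \<ge> 1" "p \<ge> 1" "m \<ge> 2 \<or> T \<ge> 1" "y \<le> p" "y \<le> T" "T \<ge> 1 \<longrightarrow> y \<ge> 1"
      "a = m + min p T" "b = m + T + (p - y)" "n = 2 * m + 2 * T + p" for m p T y
    using complete_structure_realises[OF that(1-6), where 'k = 'k] that(7-9) by simp
  consider "a = 2" "b = n - 2" | "a = 2" "b = n - 3" | "a = 2" "odd n" "b = (n - 1) div 2"
    | "a = b" "n < 3 * b" "2 * b < n" | "3 \<le> a" "2 * a + 1 \<le> n" "a < b" "n < 2 * b + a" "a + b \<le> n"
    using ab by (auto simp: mem_depth_dim_pairs_iff CW_2_dim_def split: if_splits)
  then show ?thesis
  proof cases
    case 1
    then show ?thesis using n by (intro complete[of 2 "n - 4" 0 0]) auto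
  next
    case 2
    then show ?thesis using n by (intro complete[of 1 "n - 4" 1 1]) auto
  next
    case 3
    then obtain k where "n = 2 * k + 1" by (auto elim: oddE)
    then show ?thesis using n 3 by (intro complete[of 1 1 "k - 1" 1]) auto
  next
    case 4
    then show ?thesis by (intro complete[of "3 * b - n" "n - 2 * b" "n - 2 * b" "n - 2 * b"]) auto
  next
    case 5
    consider "2 * b < n" | "n \<le> 2 * b" "a + b = n" | "n \<le> 2 * b" "a + b < n" using 5 by linarith
    then show ?thesis
    proof cases
      case 1
      then show ?thesis using 5
        by (intro complete[of "a + 2 * b - n" "n - 2 * b" "n - a - b" "n - 2 * b"]) auto
    next
      case 2
      then show ?thesis using 5 by (intro complete[of a "n - 2 * a" 0 0]) auto
    next
      case 3
      have "(enat (a - 1 + 1), enat (a - 1 + (n - a - b) + (2 * b + 2 - n - 1)))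
          \<in> CW_depth_dim TYPE('k) (2 * (a - 1) + 2 * (n - a - b) + (2 * b + 2 - n))"
        using 3 5 by (intro skew_structure_realises) auto
      moreover have "a - 1 + 1 = a" "a - 1 + (n - a - b) + (2 * b + 2 - n - 1) = b"
        "2 * (a - 1) + 2 * (n - a - b) + (2 * b + 2 - n) = n" using 3 5 by linarith+
      ultimately show ?thesis by simp
    qed
  qed
qed

theorem theorem3p15:
  fixes n :: nat
  assumes "n \<ge> 5"
  shows "CW_depth_dim TYPE('k::field) n =
    map_prod enat enat `
      (CW_2_dim n
       \<union> {(b, b) | b :: nat. real n / 3 < real b \<and> real b < real n / 2}
       \<union> {(a, b) | a b :: nat. 3 \<le> a \<and> int a \<le> \<lfloor>(real n - 1) / 2\<rfloor> \<and>
            max (real a) ((real n - real a) / 2) < real b \<and> real b \<le> real n - real a})"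
  unfolding depth_dim_pairs_def[symmetric]
proof (intro equalityI CW_depth_dim_subset[OF assms] image_subsetI)
  fix x assume "x \<in> depth_dim_pairs n"
  then show "map_prod enat enat x \<in> CW_depth_dim TYPE('k) n"
    using depth_dim_pairs_realised[OF assms] by (cases x) simp
qed

end
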